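(* Let $\epsilon \in \,]0,1/2[$, set $k = n^{(1-2\epsilon)(1-\epsilon)}$ and $\delta = n^{-5\epsilon/4+\epsilon^2/2}$. Hypothesis $(H_\epsilon)$ implies that there is no polynomial time algorithm which, given an $n \times n$ matrix $\Phi$, outputs "yes" whenever $\delta_k(\Phi) \leq \delta$ and outputs "no" whenever $\delta_k(\Phi) \geq n^{-\epsilon}/4$ (for all sufficiently large $n$). In particular, since $\delta = o(n^{-\epsilon}/4)$, under $(H_\epsilon)$ no polynomial time algorithm can approximate $\delta_k(\Phi)$ for $n\times n$ matrices within any constant factor.
   Context: A vector is $k$-sparse if it has at most $k$ nonzero coordinates. A matrix $\Phi$ satisfies the restricted isometry property (RIP) of order $k$ with parameter $\delta$ if $(1-\delta)\|x\|^2\leq\|\Phi x\|^2\leq(1+\delta)\|x\|^2$ for all $k$-sparse $x$; the RIP parameter of order $k$, $\delta_k(\Phi)$, is the smallest such $\delta \geq 0$. Approximating within a constant factor $\rho \geq 1$ means outputting a number in $[\delta_k(\Phi), \rho\,\delta_k(\Phi)]$. $G(n,1/2)$ denotes the uniform distribution on graphs with $n$ vertices. Hypothesis $(H_\epsilon)$: there is no polynomial time algorithm which, given as input a graph $G$ on $n$ vertices, (i) always outputs "yes" if $G$ contains a clique of size $n^{1/2-\epsilon}$, and (ii) outputs "no clique" with probability tending to $1$ as $n\to\infty$ when $G$ is drawn from $G(n,1/2)$. Floor and ceiling signs are omitted. *)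

theory Defs
  imports
    "HOL-Probability.Probability"
    "HOL-Library.Log_Nat"
    "HOL-Library.Landau_Symbols"
    "HOL-Computational_Algebra.Polynomial"
    "Jordan_Normal_Form.Matrix"
begin

section \<open>Restricted isometry\<close>

definition sparse :: "nat \<Rightarrow> real Matrix.vec \<Rightarrow> bool" where
  "sparse k x \<longleftrightarrow> card {i. i < dim_vec x \<and> vec_index x i \<noteq> 0} \<le> k"

definition sq_norm :: "real Matrix.vec \<Rightarrow> real" where
  "sq_norm x = scalar_prod x x"

definition RIP :: "real Matrix.mat \<Rightarrow> nat \<Rightarrow> real \<Rightarrow> bool" where
  "RIP \<Phi> k \<delta> \<longleftrightarrow> (\<forall>x \<in> carrier_vec (dim_col \<Phi>). sparse k x \<longrightarrow>
     (1 - \<delta>) * sq_norm x \<le> sq_norm (\<Phi> *\<^sub>v x) \<and> sq_norm (\<Phi> *\<^sub>v x) \<le> (1 + \<delta>) * sq_norm x)"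

definition RIP_param :: "nat \<Rightarrow> real Matrix.mat \<Rightarrow> real" where
  "RIP_param k \<Phi> = (LEAST \<delta>. 0 \<le> \<delta> \<and> RIP \<Phi> k \<delta>)"

lemma sq_norm_sum: "sq_norm x = (\<Sum>i<dim_vec x. (vec_index x i)\<^sup>2)"
  by (simp add: sq_norm_def scalar_prod_def power2_eq_square atLeast0LessThan)

lemma sq_norm_nonneg: "0 \<le> sq_norm x"
  by (simp add: sq_norm_sum sum_nonneg)

lemma sq_norm_mult_mat_vec_le:
  assumes "x \<in> carrier_vec (dim_col \<Phi>)"
  shows "sq_norm (\<Phi> *\<^sub>v x) \<le> (\<Sum>i<dim_row \<Phi>. sq_norm (row \<Phi> i)) * sq_norm x"
proof -
  have "(vec_index (\<Phi> *\<^sub>v x) i)\<^sup>2 \<le> sq_norm (row \<Phi> i) * sq_norm x" if "i < dim_row \<Phi>" for i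
  proof -
    have "vec_index (\<Phi> *\<^sub>v x) i = (\<Sum>j<dim_col \<Phi>. vec_index (row \<Phi> i) j * vec_index x j)"
      using that assms by (simp add: scalar_prod_def atLeast0LessThan)
    then show ?thesis
      using Cauchy_Schwarz_ineq_sum[of "vec_index (row \<Phi> i)" "vec_index x" "{..<dim_col \<Phi>}"] assms
      by (simp add: sq_norm_sum)
  qed
  then show ?thesis
    unfolding sum_distrib_right by (subst sq_norm_sum) (auto intro!: sum_mono)
qed

text \<open>The minimum exists, so the \<open>LEAST\<close> above is never junk.\<close>

lemma RIP_param_least:
  shows "0 \<le> RIP_param k \<Phi>" and "RIP \<Phi> k (RIP_param k \<Phi>)"
    and "0 \<le> \<delta> \<Longrightarrow> RIP \<Phi> k \<delta> \<Longrightarrow> RIP_param k \<Phi> \<le> \<delta>"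
proof -
  define D where "D = {\<delta>. 0 \<le> \<delta> \<and> RIP \<Phi> k \<delta>}"
  define C where "C = (\<Sum>i<dim_row \<Phi>. sq_norm (row \<Phi> i))"
  have C: "0 \<le> C" by (simp add: C_def sum_nonneg sq_norm_nonneg)
  have "RIP \<Phi> k (1 + C)"
    unfolding RIP_def
  proof (intro ballI impI conjI)
    fix x :: "real Matrix.vec" assume x: "x \<in> carrier_vec (dim_col \<Phi>)"
    have "- (C * sq_norm x) \<le> 0" using C sq_norm_nonneg by simp
    then show "(1 - (1 + C)) * sq_norm x \<le> sq_norm (\<Phi> *\<^sub>v x)"
      using sq_norm_nonneg[of "\<Phi> *\<^sub>v x"] by simp
    show "sq_norm (\<Phi> *\<^sub>v x) \<le> (1 + (1 + C)) * sq_norm x"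
      using sq_norm_mult_mat_vec_le[OF x] sq_norm_nonneg[of x] by (simp add: C_def distrib_right)
  qed
  then have ne: "D \<noteq> {}" using C by (auto simp: D_def intro!: exI[of _ "1 + C"])
  have bdd: "bdd_below D" by (auto simp: D_def)
  have "D = {0..} \<inter> (\<Inter>x \<in> {x \<in> carrier_vec (dim_col \<Phi>). sparse k x}.
      {\<delta>. (1 - \<delta>) * sq_norm x \<le> sq_norm (\<Phi> *\<^sub>v x)} \<inter> {\<delta>. sq_norm (\<Phi> *\<^sub>v x) \<le> (1 + \<delta>) * sq_norm x})"
    by (auto simp: D_def RIP_def)
  also have "closed \<dots>"
    by (intro closed_Int closed_INT ballI closed_Collect_le continuous_intros closed_atLeast)
  finally have "Inf D \<in> D" using closed_contains_Inf[OF ne bdd] by blast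
  moreover have "RIP_param k \<Phi> = Inf D"
    unfolding RIP_param_def
    by (rule Least_equality) (use \<open>Inf D \<in> D\<close> bdd in \<open>auto simp: D_def intro: cInf_lower\<close>)
  ultimately have "RIP_param k \<Phi> \<in> D" and le: "\<And>\<delta>. \<delta> \<in> D \<Longrightarrow> RIP_param k \<Phi> \<le> \<delta>"
    using cInf_lower[OF _ bdd] by auto
  then show "0 \<le> RIP_param k \<Phi>" "RIP \<Phi> k (RIP_param k \<Phi>)" by (auto simp: D_def)
  show "0 \<le> \<delta> \<Longrightarrow> RIP \<Phi> k \<delta> \<Longrightarrow> RIP_param k \<Phi> \<le> \<delta>" using le by (auto simp: D_def)
qed

section \<open>Simple graphs on \<open>{0..<n}\<close>\<close>

text \<open>A graph on \<open>{0..<n}\<close> is given by its set of edges, each edge being a two-element set.\<close>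

definition graphs :: "nat \<Rightarrow> nat set set set" where
  "graphs n = Pow {{u, v} | u v. u < n \<and> v < n \<and> u \<noteq> v}"

definition has_clique :: "nat \<Rightarrow> nat set set \<Rightarrow> nat \<Rightarrow> bool" where
  "has_clique n E m \<longleftrightarrow>
     (\<exists>S \<subseteq> {..<n}. card S = m \<and> (\<forall>u\<in>S. \<forall>v\<in>S. u \<noteq> v \<longrightarrow> {u, v} \<in> E))"

definition uniform_graph :: "nat \<Rightarrow> nat set set pmf" where
  "uniform_graph n = pmf_of_set (graphs n)"

lemma finite_graphs: "finite (graphs n)" and graphs_nonempty: "graphs n \<noteq> {}"
proof -
  have "{{u, v} | u v. u < n \<and> v < n \<and> u \<noteq> v} \<subseteq> Pow {..<n}" by auto
  then show "finite (graphs n)"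
    unfolding graphs_def by (meson finite_Pow_iff finite_lessThan finite_subset)
qed (auto simp: graphs_def)

lemma set_uniform_graph: "set_pmf (uniform_graph n) = graphs n"
  by (simp add: uniform_graph_def finite_graphs graphs_nonempty)

section \<open>Polynomial time\<close>

text \<open>
  The model is the random access machine with the logarithmic cost criterion
  (Cook and Reckhow, with the multiplication and division instructions of Aho, Hopcroft and
  Ullman), which is polynomially equivalent to Turing machines. Programs have structured control
  flow. A state consists of registers, which instructions address directly, and of a memory, which
  is addressed indirectly through registers; both hold integers of arbitrary size. Every
  instruction costs at least the bit length of all the integers (data and addresses) that it
  reads, and the bit length of a result is at most one more than the sum of those of the operands.
\<close>

type_synonym state = "(nat \<Rightarrow> int) \<times> (int \<Rightarrow> int)"

datatype prog =
    Skip
  | Const nat int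
  | Add nat nat nat
  | Sub nat nat nat
  | Mult nat nat nat
  | Div nat nat nat
  | Load nat nat
  | Store nat nat
  | Seq prog prog
  | IfPos nat prog prog
  | WhilePos nat prog

definition int_size :: "int \<Rightarrow> nat" where
  "int_size x = 1 + nat (bitlen \<bar>x\<bar>)"

text \<open>\<open>exec P s t s'\<close>: started in state \<open>s\<close>, program \<open>P\<close> halts in state \<open>s'\<close> at total cost \<open>t\<close>.\<close>

inductive exec :: "prog \<Rightarrow> state \<Rightarrow> nat \<Rightarrow> state \<Rightarrow> bool" where
  "exec Skip s 1 s"
| "exec (Const i c) (r, m) (int_size c) (r(i := c), m)"
| "exec (Add i j k) (r, m) (int_size (r j) + int_size (r k)) (r(i := r j + r k), m)"
| "exec (Sub i j k) (r, m) (int_size (r j) + int_size (r k)) (r(i := r j - r k), m)"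
| "exec (Mult i j k) (r, m) (int_size (r j) + int_size (r k)) (r(i := r j * r k), m)"
| "exec (Div i j k) (r, m) (int_size (r j) + int_size (r k)) (r(i := r j div r k), m)"
| "exec (Load i j) (r, m) (int_size (r j) + int_size (m (r j))) (r(i := m (r j)), m)"
| "exec (Store i j) (r, m) (int_size (r i) + int_size (r j)) (r, m(r i := r j))"
| "exec P s t s' \<Longrightarrow> exec Q s' u s'' \<Longrightarrow> exec (Seq P Q) s (t + u) s''"
| "r i > 0 \<Longrightarrow> exec P (r, m) t s' \<Longrightarrow> exec (IfPos i P Q) (r, m) (int_size (r i) + t) s'"
| "r i \<le> 0 \<Longrightarrow> exec Q (r, m) t s' \<Longrightarrow> exec (IfPos i P Q) (r, m) (int_size (r i) + t) s'"
| "r i \<le> 0 \<Longrightarrow> exec (WhilePos i P) (r, m) (int_size (r i)) (r, m)"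
| "r i > 0 \<Longrightarrow> exec P (r, m) t s' \<Longrightarrow> exec (WhilePos i P) s' u s'' \<Longrightarrow>
     exec (WhilePos i P) (r, m) (int_size (r i) + t + u) s''"

lemma exec_deterministic:
  "exec P s t s' \<Longrightarrow> exec P s u s'' \<Longrightarrow> t = u \<and> s' = s''"
proof (induction arbitrary: u s'' rule: exec.induct)
  case 1
  from "1.prems" show ?case by cases auto
next
  case 2
  from "2.prems" show ?case by cases auto
next
  case 3
  from "3.prems" show ?case by cases auto
next
  case 4
  from "4.prems" show ?case by cases auto
next
  case 5
  from "5.prems" show ?case by cases auto
next
  case 6
  from "6.prems" show ?case by cases auto
next
  case 7
  from "7.prems" show ?case by cases auto
next
  case 8
  from "8.prems" show ?case by cases auto
next
  case (9 P s t s1 Q t2 s2)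
  from "9.prems" obtain v s3 w where *: "u = v + w" "exec P s v s3" "exec Q s3 w s''"
    by cases auto
  from "9.IH"(1)[OF *(2)] have eq: "t = v" "s1 = s3" by blast+
  have "t2 = w \<and> s2 = s''" by (rule "9.IH"(2)) (unfold eq, rule *(3))
  with eq *(1) show ?case by blast
next
  case (10 r i P m t s' Q)
  from "10.prems" obtain v where "u = int_size (r i) + v" "exec P (r, m) v s''"
    by cases (use "10.hyps" in auto)
  with "10.IH" show ?case by blast
next
  case (11 r i Q m t s' P)
  from "11.prems" obtain v where "u = int_size (r i) + v" "exec Q (r, m) v s''"
    by cases (use "11.hyps" in auto)
  with "11.IH" show ?case by blast
next
  case 12
  from "12.prems" show ?case by cases (use "12.hyps" in auto)
next
  case (13 r i P m t s1 t2 s2)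
  from "13.prems" obtain v s3 w where *: "u = int_size (r i) + v + w" "exec P (r, m) v s3"
      "exec (WhilePos i P) s3 w s''"
    by cases (use "13.hyps" in auto)
  from "13.IH"(1)[OF *(2)] have eq: "t = v" "s1 = s3" by blast+
  have "t2 = w \<and> s2 = s''" by (rule "13.IH"(2)) (unfold eq, rule *(3))
  with eq *(1) show ?case by blast
qed

text \<open>Inputs are lists of integers, stored in the memory from address 0 on; everything else is 0.\<close>

definition initial :: "int list \<Rightarrow> state" where
  "initial xs = (\<lambda>_. 0, \<lambda>a. if 0 \<le> a \<and> a < int (length xs) then xs ! nat a else 0)"

definition input_size :: "int list \<Rightarrow> nat" where
  "input_size xs = sum_list (map int_size xs)"

definition polytime_on :: "int list set \<Rightarrow> prog \<Rightarrow> bool" where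
  "polytime_on I P \<longleftrightarrow>
     (\<exists>p :: nat poly. \<forall>xs\<in>I. \<exists>t s. exec P (initial xs) t s \<and> t \<le> poly p (input_size xs))"

definition outputs :: "prog \<Rightarrow> int list \<Rightarrow> int \<Rightarrow> bool" where
  "outputs P xs y \<longleftrightarrow> (\<exists>t r m. exec P (initial xs) t (r, m) \<and> r 0 = y)"

abbreviation outputs_yes :: "prog \<Rightarrow> int list \<Rightarrow> bool" where
  "outputs_yes P xs \<equiv> outputs P xs 1"

abbreviation outputs_no :: "prog \<Rightarrow> int list \<Rightarrow> bool" where
  "outputs_no P xs \<equiv> outputs P xs 0"

text \<open>A rational number is output as a numerator and a positive denominator, not necessarily in
  lowest terms.\<close>

definition outputs_rat :: "prog \<Rightarrow> int list \<Rightarrow> rat \<Rightarrow> bool" where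
  "outputs_rat P xs q \<longleftrightarrow>
     (\<exists>t r m. exec P (initial xs) t (r, m) \<and> r 1 > 0 \<and> q = of_int (r 0) / of_int (r 1))"

text \<open>The order \<open>n\<close>, followed by the adjacency matrix in row-major order.\<close>

definition encode_graph :: "nat \<Rightarrow> nat set set \<Rightarrow> int list" where
  "encode_graph n E =
     int n # concat (map (\<lambda>i. map (\<lambda>j. of_bool ({i, j} \<in> E)) [0..<n]) [0..<n])"

text \<open>The order of a square matrix, followed by the numerators and denominators of its entries in
  row-major order.\<close>

definition encode_mat :: "rat Matrix.mat \<Rightarrow> int list" where
  "encode_mat \<Phi> =
     int (dim_row \<Phi>) #
       concat (map (\<lambda>i. concat (map (\<lambda>j. case quotient_of (\<Phi> $$ (i, j)) of (a, b) \<Rightarrow> [a, b])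
         [0..<dim_col \<Phi>])) [0..<dim_row \<Phi>])"

definition graph_inputs :: "int list set" where
  "graph_inputs = {encode_graph n E | n E. E \<in> graphs n}"

definition mat_inputs :: "int list set" where
  "mat_inputs = {encode_mat \<Phi> | \<Phi> n. \<Phi> \<in> carrier_mat n n}"

section \<open>The hypothesis \<open>H\<^sub>\<epsilon>\<close>\<close>

definition hidden_clique_hypothesis :: "real \<Rightarrow> bool" where
  "hidden_clique_hypothesis \<epsilon> \<longleftrightarrow>
     \<not> (\<exists>P. polytime_on graph_inputs P \<and>
          (\<forall>n. \<forall>E \<in> graphs n. has_clique n E (nat \<lfloor>real n powr (1/2 - \<epsilon>)\<rfloor>) \<longrightarrow>
             outputs_yes P (encode_graph n E)) \<and>
          (\<lambda>n. measure_pmf.prob (uniform_graph n) {E. outputs_no P (encode_graph n E)})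
            \<longlonglongrightarrow> 1)"

end

theory Submission
  imports Defs "HOL-Real_Asymp.Real_Asymp"
begin

text \<open>
  Let \<open>A\<close> be the signed adjacency matrix of a graph on \<open>n\<close> vertices (\<open>1\<close> for edges, \<open>-1\<close> elsewhere, also
  on the diagonal), and let \<open>s\<close> be the least odd number with \<open>n \<le> s\<^sup>2\<close>. The graph is mapped to the
  matrix \<open>\<Phi>\<close> of order \<open>2 n\<close> with diagonal blocks \<open>3/5 I\<close> and off-diagonal blocks \<open>4/(5 s) A\<close>. Then
  \<open>\<parallel>\<Phi> (u, v)\<parallel>\<^sup>2 = 9/25 (\<parallel>u\<parallel>\<^sup>2 + \<parallel>v\<parallel>\<^sup>2) + 16/25 (\<parallel>A u\<parallel>\<^sup>2 + \<parallel>A v\<parallel>\<^sup>2) / s\<^sup>2 + 48/25 \<langle>u, A v\<rangle> / s\<close>.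

  For a clique \<open>S\<close> of size \<open>K\<close>, the vectors \<open>(1\<^sub>S, 1\<^sub>S)\<close> and \<open>(1\<^sub>S, - 1\<^sub>S)\<close> differ only in the sign of
  the last term, hence one of them shows a distortion of order \<open>K / s\<close>, about \<open>n powr (- \<epsilon>)\<close>.
  For a random graph and a sparse vector \<open>z\<close>, exponential moments show that \<open>\<langle>z, A z\<rangle>\<close> is small against
  \<open>s \<parallel>z\<parallel>\<^sup>2\<close> and that \<open>\<parallel>A z\<parallel>\<^sup>2\<close> is close to \<open>n \<parallel>z\<parallel>\<^sup>2\<close>; in the latter, the rows outside the support of
  \<open>z\<close> are independent, and the others are controlled by the quadratic form. A union bound over a grid of
  \<open>n ^ O(k)\<close> vectors suffices, because \<open>k log n\<close> is small against \<open>\<delta>\<^sup>2 n\<close> by a power of \<open>n\<close>.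
\<close>

section \<open>Random access machine programs\<close>

text \<open>The input matrices are rational, so the two blocks are weighted by the Pythagorean pair
  3/5, 4/5, whose squares sum to 1, and sqrt n is replaced by an integer \<open>s\<close> within
  distance 2. The doubling answers an obstacle: for a clique S, nothing is known about the rows of A
  outside S, so the squared norm of A 1_S could hide the effect of the clique on a single test
  vector. The two signs of the second half provide two vectors for which this unknown quantity is
  the same and cancels. The price is that a graph on n vertices yields order 2 n, so
  \<open>k\<close> and both thresholds are taken at 2 n, and a clique of size K gives vectors with 2
  K nonzero coordinates. Write d for the exponent with \<open>\<delta> n = n powr (- d)\<close> and
  p for that of \<open>k\<close>. The proof lives on the strict inequalities
  \<open>\<epsilon> < d\<close>, \<open>p < 1 - 2 * d\<close> and
  \<open>1 / 2 - \<epsilon> < p\<close>, each of which comes down to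
  \<open>\<epsilon> < 1 / 2\<close>. As polynomial time refers to a concrete machine, the reduction
  has to be a program, and it must hand over to the given program a memory that agrees with a
  genuine initial one at every address.\<close>

lemma int_size_le_iff: "int_size x \<le> Suc w \<longleftrightarrow> \<bar>x\<bar> < 2 ^ w"
  using bitlen_le_iff_power[of "\<bar>x\<bar>" "int w"] bitlen_nonneg[of "\<bar>x\<bar>"]
  by (auto simp: int_size_def nat_le_iff)

lemma int_size_ge_1: "1 \<le> int_size x"
  by (simp add: int_size_def)

lemma int_size_0 [simp]: "int_size 0 = 1"
  by (simp add: int_size_def)

lemma abs_less_int_size: "\<bar>x\<bar> < 2 ^ (int_size x - 1)"
  using int_size_le_iff[of x "int_size x - 1"] int_size_ge_1[of x] by simp

lemma int_size_mono: "\<bar>x\<bar> \<le> \<bar>y\<bar> \<Longrightarrow> int_size x \<le> int_size y"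
  using int_size_le_iff[of x "int_size y - 1"] abs_less_int_size[of y] int_size_ge_1[of y] by simp

lemma int_size_le_Suc_nat: "int_size x \<le> 1 + nat \<bar>x\<bar>"
proof -
  have "\<bar>x\<bar> = int (nat \<bar>x\<bar>)" by simp
  also have "\<dots> < 2 ^ nat \<bar>x\<bar>" using of_nat_less_two_power[where 'a = int] by blast
  finally show ?thesis using int_size_le_iff[of x "nat \<bar>x\<bar>"] by simp
qed

lemma int_size_add: "int_size (x + y) \<le> int_size x + int_size y"
  and int_size_diff: "int_size (x - y) \<le> int_size x + int_size y"
  and int_size_mult: "int_size (x * y) \<le> int_size x + int_size y"
proof -
  define a b where "a = int_size x - 1" and "b = int_size y - 1"
  have ab: "int_size x = Suc a" "int_size y = Suc b"
    using int_size_ge_1[of x] int_size_ge_1[of y] by (auto simp: a_def b_def)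
  have x: "\<bar>x\<bar> < 2 ^ a" and y: "\<bar>y\<bar> < 2 ^ b"
    using abs_less_int_size[of x] abs_less_int_size[of y] by (auto simp: a_def b_def)
  have "(2::int) ^ a \<le> 2 ^ (a + b)" "(2::int) ^ b \<le> 2 ^ (a + b)"
    by (auto intro: power_increasing)
  then have "\<bar>x\<bar> + \<bar>y\<bar> < 2 ^ Suc (a + b)" using x y unfolding power_Suc by linarith
  then show "int_size (x + y) \<le> int_size x + int_size y"
    and "int_size (x - y) \<le> int_size x + int_size y"
    using int_size_le_iff[of "x + y" "Suc (a + b)"] int_size_le_iff[of "x - y" "Suc (a + b)"]
    by (auto simp: ab)
  have "\<bar>x * y\<bar> < 2 ^ a * 2 ^ b"
    unfolding abs_mult using x y by (intro mult_strict_mono') auto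
  then show "int_size (x * y) \<le> int_size x + int_size y"
    using int_size_le_iff[of "x * y" "a + b"] by (simp add: ab power_add)
qed

lemma int_size_div: "int_size (x div y) \<le> int_size x"
proof (rule int_size_mono)
  show "\<bar>x div y\<bar> \<le> \<bar>x\<bar>"
  proof (cases "y = 0")
    case False
    have "\<bar>x div y\<bar> * 1 \<le> \<bar>x div y\<bar> * \<bar>y\<bar>" using False by (intro mult_left_mono) auto
    have "x = y * (x div y) + x mod y" by simp
    show ?thesis
    proof (cases "0 \<le> x div y")
      case True
      show ?thesis
      proof (cases "0 < y")
        case True
        then show ?thesis using zdiv_mono2[of x 1 y] \<open>0 \<le> x div y\<close>
          by (auto simp: pos_imp_zdiv_nonneg_iff)
      next
        case F: False
        then have "x \<le> 0" using True \<open>y \<noteq> 0\<close> by (auto simp: neg_imp_zdiv_nonneg_iff)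
        moreover have "x div y = (- x) div (- y)" by simp
        ultimately show ?thesis using True F \<open>y \<noteq> 0\<close> zdiv_mono2[of "- x" 1 "- y"] by auto
      qed
    next
      case neg: False
      \<comment> \<open>A negative quotient is rounded away from zero, so
        \<open>\<bar>x div y\<bar>\<close> may exceed \<open>\<bar>x\<bar> / \<bar>y\<bar>\<close>.
        With the sign moved to the numerator, dividing a negative number by \<open>Y\<close> instead
        of 1 can only raise the result.\<close>
      define X Y where "X = (if 0 < y then x else - x)" and "Y = \<bar>y\<bar>"
      have *: "x div y = X div Y" "0 < Y" "\<bar>x\<bar> = \<bar>X\<bar>" using False by (auto simp: X_def Y_def)
      have "X < 0" using neg *(1,2) by (metis linorder_not_le pos_imp_zdiv_nonneg_iff)
      then have "X div 1 \<le> X div Y" using zdiv_mono2_neg[of X 1 Y] *(2) by simp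
      then show ?thesis using neg * \<open>X < 0\<close> by simp
    qed
  qed simp
qed

section \<open>Frame property and cost bounds for programs\<close>

fun reg_bound :: "prog \<Rightarrow> nat" where
  "reg_bound Skip = 0"
| "reg_bound (Const i c) = Suc i"
| "reg_bound (Add i j k) = Suc (max i (max j k))"
| "reg_bound (Sub i j k) = Suc (max i (max j k))"
| "reg_bound (Mult i j k) = Suc (max i (max j k))"
| "reg_bound (Div i j k) = Suc (max i (max j k))"
| "reg_bound (Load i j) = Suc (max i j)"
| "reg_bound (Store i j) = Suc (max i j)"
| "reg_bound (Seq P Q) = max (reg_bound P) (reg_bound Q)"
| "reg_bound (IfPos i P Q) = max (Suc i) (max (reg_bound P) (reg_bound Q))"
| "reg_bound (WhilePos i P) = max (Suc i) (reg_bound P)"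

text \<open>Registers from \<open>reg_bound P\<close> on are neither read nor written by
  \<open>P\<close>. A given program can therefore run inside a larger one that keeps its own data in
  higher registers.\<close>

lemma exec_frame:
  assumes "exec P s t s'" and "reg_bound P \<le> b" and "\<And>i. i < b \<Longrightarrow> q i = fst s i"
  shows "exec P (q, snd s) t (\<lambda>i. if i < b then fst s' i else q i, snd s')"
proof -
  define mix where "mix r = (\<lambda>i. if i < b then r i else q i)" for r
  have upd: "mix (r(i := v)) = (mix r)(i := v)" if "i < b" for r i v
    using that by (auto simp: mix_def fun_eq_iff)
  have less: "mix r i = r i" if "i < b" for r i
    using that by (simp add: mix_def)
  have "exec P (mix (fst s), snd s) t (mix (fst s'), snd s')"
    using assms(1,2)
  proof (induction rule: exec.induct)
    case 1 show ?case by (rule exec.intros)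
  next
    case (2 i c r m)
    then show ?case using exec.intros(2)[of i c "mix r" m] by (simp add: upd less del: fun_upd_apply)
  next
    case (3 i j k r m)
    then show ?case using exec.intros(3)[of i j k "mix r" m] by (simp add: upd less del: fun_upd_apply)
  next
    case (4 i j k r m)
    then show ?case using exec.intros(4)[of i j k "mix r" m] by (simp add: upd less del: fun_upd_apply)
  next
    case (5 i j k r m)
    then show ?case using exec.intros(5)[of i j k "mix r" m] by (simp add: upd less del: fun_upd_apply)
  next
    case (6 i j k r m)
    then show ?case using exec.intros(6)[of i j k "mix r" m] by (simp add: upd less del: fun_upd_apply)
  next
    case (7 i j r m)
    then show ?case using exec.intros(7)[of i j "mix r" m] by (simp add: upd less del: fun_upd_apply)
  next
    case (8 i j r m)
    then show ?case using exec.intros(8)[of i j "mix r" m] by (simp add: upd less del: fun_upd_apply)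
  next
    case 9 then show ?case by (auto intro: exec.intros)
  next
    case (10 r i P m t s' Q)
    then show ?case using exec.intros(10)[of "mix r" i P m t _ Q] by (simp add: less)
  next
    case (11 r i Q m t s' P)
    then show ?case using exec.intros(11)[of "mix r" i Q m t _ P] by (simp add: less)
  next
    case (12 r i P m)
    then show ?case using exec.intros(12)[of "mix r" i P m] by (simp add: less)
  next
    case (13 r i P m t s' u s'')
    then show ?case using exec.intros(13)[of "mix r" i P m t _ u] by (simp add: less)
  qed
  moreover have "mix (fst s) = q" using assms(3) by (auto simp: mix_def)
  ultimately show ?thesis by (simp add: mix_def)
qed

definition bounded_state :: "nat \<Rightarrow> state \<Rightarrow> bool" where
  "bounded_state B s \<longleftrightarrow> (\<forall>i. int_size (fst s i) \<le> B) \<and> (\<forall>a. int_size (snd s a) \<le> B)"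

text \<open>Every instruction pays for the bit lengths of its operands, and a result is no longer
  than the operands together. A bound on the cost is thus a bound on the size of every integer that
  is created.\<close>

lemma exec_bounded_state:
  assumes "exec P s t s'" and "bounded_state B s"
  shows "bounded_state (max B t) s'"
proof -
  have "(int_size (fst s' i) \<le> int_size (fst s i) \<or> int_size (fst s' i) \<le> t) \<and>
        (int_size (snd s' a) \<le> int_size (snd s a) \<or> int_size (snd s' a) \<le> t)" for i a
    using assms(1)
  proof (induction rule: exec.induct)
    case (6 i j k r m)
    then show ?case using int_size_div[of "r j" "r k"] by auto
  next
    case (9 P s t s' Q u s'')
    then show ?case by linarith
  next
    case (13 r i P m t s' u s'')
    then show ?case by linarith
  qed (auto intro: int_size_add int_size_diff int_size_mult)
  then show ?thesis
    using assms(2) by (fastforce simp: bounded_state_def le_max_iff_disj intro: order_trans)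
qed

lemma bounded_state_mono: "bounded_state B s \<Longrightarrow> B \<le> C \<Longrightarrow> bounded_state C s"
  by (auto simp: bounded_state_def intro: order_trans)

fun loop_free :: "prog \<Rightarrow> bool" where
  "loop_free (Seq P Q) \<longleftrightarrow> loop_free P \<and> loop_free Q"
| "loop_free (IfPos i P Q) \<longleftrightarrow> loop_free P \<and> loop_free Q"
| "loop_free (WhilePos i P) \<longleftrightarrow> False"
| "loop_free _ \<longleftrightarrow> True"

text \<open>A functional semantics for loop-free programs, so that their effect can be computed by
  simplification. The value at \<open>WhilePos\<close> is a dummy, excluded by
  \<open>loop_free\<close>.\<close>

fun run :: "prog \<Rightarrow> state \<Rightarrow> state" where
  "run Skip s = s"
| "run (Const i c) (r, m) = (r(i := c), m)"
| "run (Add i j k) (r, m) = (r(i := r j + r k), m)"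
| "run (Sub i j k) (r, m) = (r(i := r j - r k), m)"
| "run (Mult i j k) (r, m) = (r(i := r j * r k), m)"
| "run (Div i j k) (r, m) = (r(i := r j div r k), m)"
| "run (Load i j) (r, m) = (r(i := m (r j)), m)"
| "run (Store i j) (r, m) = (r, m(r i := r j))"
| "run (Seq P Q) s = run Q (run P s)"
| "run (IfPos i P Q) (r, m) = (if r i > 0 then run P (r, m) else run Q (r, m))"
| "run (WhilePos i P) s = s"

text \<open>The constant depends on the program alone. In a sequence, the first part enlarges the
  bit bound by at most its own factor \<open>K\<close>, by \<open>exec_bounded_state\<close>, hence
  the constant \<open>K + L * K\<close>.\<close>

lemma loop_free_exec:
  assumes "loop_free P"
  shows "\<exists>K\<ge>1. \<forall>B s. bounded_state B s \<longrightarrow> (\<exists>t\<le>K * B. exec P s t (run P s))"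
  using assms
proof (induction P)
  let ?bound = "\<lambda>P. \<exists>K\<ge>1. \<forall>B s. bounded_state B s \<longrightarrow> (\<exists>t\<le>K * B. exec P s t (run P s))"
  have binary: "?bound P"
    if "\<And>r m. exec P (r, m) (int_size (f r m) + int_size (g r m)) (run P (r, m))"
      and "\<And>B r m. bounded_state B (r, m) \<Longrightarrow> int_size (f r m) \<le> B \<and> int_size (g r m) \<le> B"
    for P f g
  proof (rule exI[of _ 2], intro conjI allI impI)
    fix B s assume "bounded_state B s"
    then show "\<exists>t\<le>2 * B. exec P s t (run P s)"
      using that(1)[of "fst s" "snd s"] that(2)[of B "fst s" "snd s"]
      by (intro exI[of _ "int_size (f (fst s) (snd s)) + int_size (g (fst s) (snd s))"]) auto
  qed simp
  {
    case (Add i j k)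
    show ?case by (rule binary[of _ "\<lambda>r m. r j" "\<lambda>r m. r k"])
        (auto simp: bounded_state_def intro: exec.intros)
  next
    case (Sub i j k)
    show ?case by (rule binary[of _ "\<lambda>r m. r j" "\<lambda>r m. r k"])
        (auto simp: bounded_state_def intro: exec.intros)
  next
    case (Mult i j k)
    show ?case by (rule binary[of _ "\<lambda>r m. r j" "\<lambda>r m. r k"])
        (auto simp: bounded_state_def intro: exec.intros)
  next
    case (Div i j k)
    show ?case by (rule binary[of _ "\<lambda>r m. r j" "\<lambda>r m. r k"])
        (auto simp: bounded_state_def intro: exec.intros)
  next
    case (Load i j)
    show ?case by (rule binary[of _ "\<lambda>r m. r j" "\<lambda>r m. m (r j)"])
        (auto simp: bounded_state_def intro: exec.intros)
  next
    case (Store i j)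
    show ?case by (rule binary[of _ "\<lambda>r m. r i" "\<lambda>r m. r j"])
        (auto simp: bounded_state_def intro: exec.intros)
  }
  case (Seq P Q)
  then obtain K L where K: "K \<ge> 1" "\<And>B s. bounded_state B s \<Longrightarrow> \<exists>t\<le>K * B. exec P s t (run P s)"
    and L: "L \<ge> 1" "\<And>B s. bounded_state B s \<Longrightarrow> \<exists>t\<le>L * B. exec Q s t (run Q s)"
    by (metis loop_free.simps(1))
  have "\<exists>t\<le>(K + L * K) * B. exec (Seq P Q) s t (run (Seq P Q) s)" if B: "bounded_state B s" for B s
  proof -
    obtain t where t: "t \<le> K * B" "exec P s t (run P s)" using K(2)[OF B] by blast
    have "bounded_state (K * B) (run P s)"
      using exec_bounded_state[OF t(2) B] t(1) K(1)
      by (elim bounded_state_mono) (auto simp: max_def)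
    then obtain u where "u \<le> L * (K * B)" "exec Q (run P s) u (run Q (run P s))" using L(2) by blast
    then show ?thesis using t
      by (intro exI[of _ "t + u"]) (auto intro!: exec.intros simp: algebra_simps)
  qed
  then show ?case using K(1) by (intro exI[of _ "K + L * K"]) auto
next
  case (IfPos i P Q)
  then obtain K L where K: "K \<ge> 1" "\<And>B s. bounded_state B s \<Longrightarrow> \<exists>t\<le>K * B. exec P s t (run P s)"
    and L: "L \<ge> 1" "\<And>B s. bounded_state B s \<Longrightarrow> \<exists>t\<le>L * B. exec Q s t (run Q s)"
    by (metis loop_free.simps(2))
  have "\<exists>t\<le>(1 + K + L) * B. exec (IfPos i P Q) s t (run (IfPos i P Q) s)" if B: "bounded_state B s" for B s
  proof -
    obtain r m where s: "s = (r, m)" by fastforce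
    have size: "int_size (r i) \<le> B" using B by (simp add: bounded_state_def s)
    show ?thesis
    proof (cases "r i > 0")
      case True
      obtain t where t: "t \<le> K * B" "exec P s t (run P s)" using K(2)[OF B] by blast
      then have "exec (IfPos i P Q) s (int_size (r i) + t) (run (IfPos i P Q) s)"
        using exec.intros(10)[of r i P m t _ Q] True by (simp add: s)
      moreover have "int_size (r i) + t \<le> (1 + K + L) * B" using t(1) size by (simp add: algebra_simps)
      ultimately show ?thesis by blast
    next
      case False
      obtain t where t: "t \<le> L * B" "exec Q s t (run Q s)" using L(2)[OF B] by blast
      then have "exec (IfPos i P Q) s (int_size (r i) + t) (run (IfPos i P Q) s)"
        using exec.intros(11)[of r i Q m t _ P] False by (simp add: s)
      moreover have "int_size (r i) + t \<le> (1 + K + L) * B" using t(1) size by (simp add: algebra_simps)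
      ultimately show ?thesis by blast
    qed
  qed
  then show ?case by (intro exI[of _ "1 + K + L"]) auto
next
  case Skip
  show ?case
  proof (rule exI[of _ 1], intro conjI allI impI)
    fix B s assume "bounded_state B s"
    then have "1 \<le> B" using int_size_ge_1 by (metis bounded_state_def order_trans)
    then show "\<exists>t\<le>1 * B. exec Skip s t (run Skip s)" using exec.intros(1)[of s] by (intro exI[of _ 1]) simp
  qed simp
next
  case (Const i c)
  show ?case
  proof (rule exI[of _ "int_size c"], intro conjI allI impI)
    fix B and s :: state assume "bounded_state B s"
    then have "1 \<le> B" using int_size_ge_1 by (metis bounded_state_def order_trans)
    then show "\<exists>t\<le>int_size c * B. exec (Const i c) s t (run (Const i c) s)"
      by (cases s) (auto intro!: exI[of _ "int_size c"] exec.intros)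
  qed (rule int_size_ge_1)
qed simp

text \<open>Here \<open>S\<close> lists the states at the loop head, which replaces an invariant and
  a variant. The \<open>N + 1\<close> tests and \<open>N\<close> bodies cost at most
  \<open>C\<close> each.\<close>

lemma while_exec:
  assumes "\<And>i. i < N \<Longrightarrow> fst (S i) x > 0" and "fst (S N) x \<le> 0"
    and "\<And>i. i \<le> N \<Longrightarrow> int_size (fst (S i) x) \<le> C"
    and "\<And>i. i < N \<Longrightarrow> \<exists>t\<le>C. exec P (S i) t (S (Suc i))"
  shows "\<exists>t\<le>(2 * N + 1) * C. exec (WhilePos x P) (S 0) t (S N)"
  using assms
proof (induction N arbitrary: S)
  case 0
  then show ?case using exec.intros(12)[of "fst (S 0)" x P "snd (S 0)"]
    by (intro exI[of _ "int_size (fst (S 0) x)"]) auto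
next
  case (Suc N)
  have "\<exists>t\<le>(2 * N + 1) * C. exec (WhilePos x P) (S (Suc 0)) t (S (Suc N))"
    using Suc.prems by (intro Suc.IH[of "\<lambda>i. S (Suc i)"]) auto
  then obtain t u where "t \<le> (2 * N + 1) * C" "exec (WhilePos x P) (S (Suc 0)) t (S (Suc N))"
    and "u \<le> C" "exec P (S 0) u (S (Suc 0))"
    using Suc.prems(4)[of 0] by auto
  moreover have "int_size (fst (S 0) x) \<le> C" "fst (S 0) x > 0" using Suc.prems(1,3)[of 0] by auto
  ultimately show ?case
    using exec.intros(13)[of "fst (S 0)" x P "snd (S 0)" u "S (Suc 0)" t "S (Suc N)"]
    by (intro exI[of _ "int_size (fst (S 0) x) + u + t"]) auto
qed

section \<open>The reduction\<close>

lemma length_concat_uniform: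
  assumes "\<And>i. i < m \<Longrightarrow> length (f i) = L"
  shows "length (concat (map f [0..<m])) = m * L"
  using assms by (induction m) auto

lemma nth_concat_uniform:
  assumes "\<And>i. i < m \<Longrightarrow> length (f i) = L" and "i < m" and "j < L"
  shows "concat (map f [0..<m]) ! (i * L + j) = f i ! j"
  using assms
proof (induction m)
  case (Suc m)
  have len: "length (concat (map f [0..<m])) = m * L"
    using Suc.prems(1) by (intro length_concat_uniform) auto
  show ?case
  proof (cases "i < m")
    case True
    have "i * L + j < Suc i * L" using Suc.prems by simp
    also have "\<dots> \<le> m * L" using True by (intro mult_le_mono1) simp
    finally show ?thesis using Suc True len by (simp add: nth_append)
  next
    case False
    then have "i = m" using Suc.prems by simp
    then show ?thesis using len Suc.prems by (simp add: nth_append)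
  qed
qed simp

lemma snd_initial_nth: "i < length xs \<Longrightarrow> snd (initial xs) (int i) = xs ! i"
  by (simp add: initial_def)

lemma snd_initial_beyond: "int (length xs) \<le> a \<Longrightarrow> snd (initial xs) a = 0"
  by (simp add: initial_def)

lemma length_encode_graph: "length (encode_graph n E) = 1 + n * n"
proof -
  have "length (concat (map (\<lambda>i. map (\<lambda>j. of_bool ({i, j} \<in> E)) [0..<n]) [0..<n])) = n * n"
    by (rule length_concat_uniform) simp
  then show ?thesis by (simp add: encode_graph_def)
qed

lemma encode_graph_nth:
  assumes "i < n" "j < n"
  shows "encode_graph n E ! (1 + (i * n + j)) = of_bool ({i, j} \<in> E)"
proof -
  have "concat (map (\<lambda>i. map (\<lambda>j. of_bool ({i, j} \<in> E)) [0..<n]) [0..<n]) ! (i * n + j) =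
      (map (\<lambda>j. of_bool ({i, j} \<in> E)) [0..<n] ! j :: int)"
    using assms by (intro nth_concat_uniform) auto
  then show ?thesis using assms by (simp add: encode_graph_def)
qed

lemma encode_mat_eq:
  assumes "\<Phi> \<in> carrier_mat N N"
  shows "encode_mat \<Phi> = int N # concat (map (\<lambda>i. concat (map (\<lambda>j.
    [fst (quotient_of (\<Phi> $$ (i, j))), snd (quotient_of (\<Phi> $$ (i, j)))]) [0..<N])) [0..<N])"
  using assms by (simp add: encode_mat_def case_prod_beta)

lemma length_encode_mat:
  assumes "\<Phi> \<in> carrier_mat N N"
  shows "length (encode_mat \<Phi>) = 1 + 2 * (N * N)"
proof -
  have len: "length (concat (map (\<lambda>j. [fst (quotient_of (\<Phi> $$ (i, j))), snd (quotient_of (\<Phi> $$ (i, j)))])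
      [0..<N])) = N * 2" for i
    by (rule length_concat_uniform) simp
  have "length (concat (map (\<lambda>i. concat (map (\<lambda>j. [fst (quotient_of (\<Phi> $$ (i, j))),
      snd (quotient_of (\<Phi> $$ (i, j)))]) [0..<N])) [0..<N])) = N * (N * 2)"
    by (rule length_concat_uniform) (rule len)
  then show ?thesis by (simp add: encode_mat_eq[OF assms])
qed

lemma encode_mat_nth:
  assumes "\<Phi> \<in> carrier_mat N N" and "i < N" "j < N"
  shows "encode_mat \<Phi> ! (1 + 2 * (i * N + j)) = fst (quotient_of (\<Phi> $$ (i, j)))" (is ?fst)
    and "encode_mat \<Phi> ! (2 + 2 * (i * N + j)) = snd (quotient_of (\<Phi> $$ (i, j)))" (is ?snd)
proof -
  define g where "g i j = [fst (quotient_of (\<Phi> $$ (i, j))), snd (quotient_of (\<Phi> $$ (i, j)))]" for i j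
  define f where "f i = concat (map (g i) [0..<N])" for i
  have len: "length (f i) = N * 2" for i
    unfolding f_def by (rule length_concat_uniform) (simp add: g_def)
  have "concat (map f [0..<N]) ! (2 * (i * N + j) + d) = g i j ! d" if "d < 2" for d
  proof -
    have "j * 2 + d < Suc j * 2" using that by simp
    also have "\<dots> \<le> N * 2" using assms by (intro mult_le_mono1) simp
    finally have "concat (map f [0..<N]) ! (i * (N * 2) + (j * 2 + d)) = f i ! (j * 2 + d)"
      using assms by (intro nth_concat_uniform len) auto
    also have "\<dots> = g i j ! d"
      unfolding f_def using assms that by (intro nth_concat_uniform) (auto simp: g_def)
    finally show ?thesis by (simp add: algebra_simps)
  qed
  from this[of 0] this[of 1] show ?fst ?snd
    by (simp_all add: encode_mat_eq[OF assms(1)] f_def[abs_def] g_def[abs_def])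
qed

definition edge_sign :: "nat set set \<Rightarrow> nat \<Rightarrow> nat \<Rightarrow> int" where
  "edge_sign E i j = 2 * of_bool ({i, j} \<in> E) - 1"

definition entry_num :: "nat \<Rightarrow> nat set set \<Rightarrow> nat \<Rightarrow> nat \<Rightarrow> int" where
  "entry_num n E i j =
     (if i div n \<noteq> j div n then 4 * edge_sign E (i mod n) (j mod n) else if i = j then 3 else 0)"

text \<open>Zero entries get denominator 1, the form in which \<open>quotient_of\<close> returns 0;
  the program has to write exactly these pairs.\<close>

definition entry_den :: "nat \<Rightarrow> nat \<Rightarrow> nat \<Rightarrow> nat \<Rightarrow> int" where
  "entry_den n s i j = (if i div n \<noteq> j div n then 5 * int s else if i = j then 5 else 1)"

definition graph_mat :: "nat \<Rightarrow> nat set set \<Rightarrow> nat \<Rightarrow> rat Matrix.mat" where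
  "graph_mat n E s =
     Matrix.mat (2 * n) (2 * n) (\<lambda>(i, j). of_int (entry_num n E i j) / of_int (entry_den n s i j))"

lemma graph_mat_carrier: "graph_mat n E s \<in> carrier_mat (2 * n) (2 * n)"
  by (simp add: graph_mat_def)

text \<open>This is why \<open>s\<close> is odd: all entries are in lowest terms.\<close>

lemma quotient_of_graph_mat:
  assumes "odd s" and "i < 2 * n" "j < 2 * n"
  shows "quotient_of (graph_mat n E s $$ (i, j)) = (entry_num n E i j, entry_den n s i j)"
proof -
  have "0 < s" using assms(1) by (cases s) auto
  have "coprime (2 ^ 2) (5 * int s)"
    unfolding coprime_power_left_iff using assms(1) by simp
  then have "coprime (4 * edge_sign E (i mod n) (j mod n)) (5 * int s)"
    by (auto simp: edge_sign_def)
  moreover have "coprime (3 :: int) 5" by code_simp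
  ultimately have "coprime (entry_num n E i j) (entry_den n s i j)" "0 < entry_den n s i j"
    using \<open>0 < s\<close> by (auto simp: entry_num_def entry_den_def)
  then show ?thesis
    using assms by (simp add: graph_mat_def Fract_of_int_quotient[symmetric] quotient_of_Fract normalize_stable)
qed

section \<open>The program that replaces a graph by its matrix\<close>

definition odd_sqrt :: "nat \<Rightarrow> nat" where
  "odd_sqrt n = 2 * (LEAST i. n \<le> (2 * i + 1)\<^sup>2) + 1"

fun seqs :: "prog list \<Rightarrow> prog" where
  "seqs [] = Skip"
| "seqs (P # Ps) = Seq P (seqs Ps)"

text \<open>One step of the search for \<open>odd_sqrt\<close>: register \<open>b+2\<close> holds
  the odd candidate and \<open>b+5\<close> holds n minus its square, which is the loop
  guard.\<close>

definition sqrt_body :: "nat \<Rightarrow> prog" where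
  "sqrt_body b = seqs [Const (b+4) 2, Add (b+2) (b+2) (b+4), Mult (b+4) (b+2) (b+2),
     Sub (b+5) b (b+4), Const (b+4) 0]"

text \<open>
  The matrix overwrites the graph in place, from the last entry down: entry \<open>p\<close> goes to the addresses
  \<open>1 + 2 p\<close> and \<open>2 + 2 p\<close>, beyond all adjacencies that are still to be read. The temporary registers
  are reset so that the state between two iterations is a function of the counter.
\<close>

definition fill_body :: "nat \<Rightarrow> prog" where
  "fill_body b = seqs
    [Const (b+4) 1, Sub (b+3) (b+3) (b+4),
     Div (b+6) (b+3) (b+1), Mult (b+5) (b+6) (b+1), Sub (b+7) (b+3) (b+5),
     Div (b+8) (b+6) b, Div (b+9) (b+7) b, Sub (b+10) (b+8) (b+9), Mult (b+10) (b+10) (b+10),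
     IfPos (b+10)
       (seqs [Mult (b+5) (b+8) b, Sub (b+6) (b+6) (b+5), Mult (b+5) (b+9) b, Sub (b+7) (b+7) (b+5),
          Mult (b+5) (b+6) b, Add (b+5) (b+5) (b+7), Add (b+5) (b+5) (b+4), Load (b+11) (b+5),
          Add (b+11) (b+11) (b+11), Sub (b+11) (b+11) (b+4), Const (b+5) 4,
          Mult (b+11) (b+5) (b+11), Const (b+12) 5, Mult (b+12) (b+12) (b+2)])
       (seqs [Sub (b+10) (b+6) (b+7), Mult (b+10) (b+10) (b+10),
          IfPos (b+10) (seqs [Const (b+11) 0, Const (b+12) 1])
            (seqs [Const (b+11) 3, Const (b+12) 5])]),
     Add (b+5) (b+3) (b+3), Add (b+5) (b+5) (b+4), Store (b+5) (b+11),
     Add (b+5) (b+5) (b+4), Store (b+5) (b+12),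
     Const (b+4) 0, Const (b+5) 0, Const (b+6) 0, Const (b+7) 0, Const (b+8) 0, Const (b+9) 0,
     Const (b+10) 0, Const (b+11) 0, Const (b+12) 0]"

text \<open>The registers at a loop head, all others being 0: the numbers of vertices and of matrix
  rows, the scaling integer, the counter \<open>c\<close> of entries still to be written, and
  \<open>d\<close>, which is the guard of the square root search and afterwards the address 0 for
  the final \<open>Store\<close>.\<close>

definition regs :: "nat \<Rightarrow> int \<Rightarrow> int \<Rightarrow> int \<Rightarrow> int \<Rightarrow> int \<Rightarrow> nat \<Rightarrow> int" where
  "regs b n N s c d = (\<lambda>_. 0)(b := n, b+1 := N, b+2 := s, b+3 := c, b+5 := d)"

lemma run_sqrt_body:
  "run (sqrt_body b) (regs b n 0 s 0 d, M) = (regs b n 0 (s + 2) 0 (n - (s + 2) * (s + 2)), M)"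
  by (auto simp: sqrt_body_def regs_def fun_eq_iff)

text \<open>The counter is one more than the index of the entry being written, so that
  \<open>WhilePos\<close> stops right after entry 0.\<close>

lemma run_fill_body:
  assumes "p < N * N" and "N = 2 * n"
    and "M (1 + (int (p div N mod n) * int n + int (p mod N mod n))) =
      of_bool ({p div N mod n, p mod N mod n} \<in> E)"
  shows "run (fill_body b) (regs b (int n) (int N) (int s) (int p + 1) 0, M) =
    (regs b (int n) (int N) (int s) (int p) 0,
     M(1 + 2 * int p := entry_num n E (p div N) (p mod N),
       2 + 2 * int p := entry_den n s (p div N) (p mod N)))"
proof -
  have m: "int x - int (x div y) * int y = int (x mod y)" for x y
    by (metis add_diff_cancel_left' div_mult_mod_eq of_nat_add of_nat_mult)
  have M: "M (int (p div N mod n) * int n + int (p mod N mod n) + 1) =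
      of_bool ({p div N mod n, p mod N mod n} \<in> E)"
    using assms(3) by (simp add: algebra_simps)
  \<comment> \<open>Branching is on positivity only, so the program tests whether two indices differ
    by squaring their difference.\<close>
  have sq: "0 < (x - y) * (x - y) \<longleftrightarrow> x \<noteq> y" for x y :: int
    by (auto simp: zero_less_mult_iff)
  consider "p div N div n \<noteq> p mod N div n" | "p mod N = p div N"
    | "p div N div n = p mod N div n" "p div N \<noteq> p mod N" by fastforce
  then show ?thesis
    by cases (simp_all add: fill_body_def regs_def m M sq zdiv_int[symmetric] entry_num_def entry_den_def
        edge_sign_def fun_eq_iff)
qed

lemma odd_sqrt_le: "n \<le> (odd_sqrt n)\<^sup>2"
  unfolding odd_sqrt_def by (rule LeastI[of _ n]) (auto simp: power2_eq_square)

lemma odd_odd_sqrt: "odd (odd_sqrt n)"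
  by (simp add: odd_sqrt_def)

lemma odd_sqrt_minimal: "2 * i + 1 < odd_sqrt n \<Longrightarrow> (2 * i + 1)\<^sup>2 < n"
  unfolding odd_sqrt_def using not_less_Least[of i "\<lambda>i. n \<le> (2 * i + 1)\<^sup>2"] by auto

lemma odd_sqrt_upper: "odd_sqrt n \<le> 2 * n + 1"
  unfolding odd_sqrt_def by (auto intro!: Least_le simp: power2_eq_square)

lemma length_le_input_size: "length xs \<le> input_size xs"
  unfolding input_size_def by (induction xs) (auto simp: int_size_def)

lemma poly_nat_mono: "x \<le> y \<Longrightarrow> poly p x \<le> poly p (y :: nat)"
  by (induction p) (auto intro: add_mono mult_mono)

definition runs :: "prog \<Rightarrow> state \<Rightarrow> state \<Rightarrow> nat \<Rightarrow> bool" where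
  "runs P s s' T \<longleftrightarrow> (\<exists>t\<le>T. exec P s t s')"

lemma runs_Seq: "runs P s s' T \<Longrightarrow> runs Q s' s'' U \<Longrightarrow> runs (Seq P Q) s s'' (T + U)"
  unfolding runs_def by (meson add_mono exec.intros(9))

lemma runs_mono: "runs P s s' T \<Longrightarrow> T \<le> U \<Longrightarrow> runs P s s' U"
  unfolding runs_def by (meson order_trans)

lemma input_bounded:
  assumes "xs \<noteq> []"
  shows "bounded_state (input_size xs) (initial xs)"
proof -
  have 1: "int_size x \<le> input_size xs" if "x \<in> set xs" for x
    unfolding input_size_def using that by (simp add: member_le_sum_list)
  moreover have "1 \<le> input_size xs" using length_le_input_size[of xs] assms by (cases xs) auto
  ultimately show ?thesis by (auto simp: bounded_state_def initial_def)
qed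

lemma runs_IfPos:
  "fst s i > 0 \<Longrightarrow> runs P s s' T \<Longrightarrow> int_size (fst s i) \<le> C \<Longrightarrow> runs (IfPos i P Q) s s' (C + T)"
  "fst s i \<le> 0 \<Longrightarrow> runs Q s s' T \<Longrightarrow> int_size (fst s i) \<le> C \<Longrightarrow> runs (IfPos i P Q) s s' (C + T)"
proof -
  show "runs (IfPos i P Q) s s' (C + T)"
    if *: "fst s i > 0" "runs P s s' T" "int_size (fst s i) \<le> C"
  proof -
    obtain t where "t \<le> T" "exec P s t s'" using *(2) by (auto simp: runs_def)
    then show ?thesis using * exec.intros(10)[of "fst s" i P "snd s" t s' Q]
      by (auto simp: runs_def intro!: exI[of _ "int_size (fst s i) + t"])
  qed
  show "runs (IfPos i P Q) s s' (C + T)"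
    if *: "fst s i \<le> 0" "runs Q s s' T" "int_size (fst s i) \<le> C"
  proof -
    obtain t where "t \<le> T" "exec Q s t s'" using *(2) by (auto simp: runs_def)
    then show ?thesis using * exec.intros(11)[of "fst s" i Q "snd s" t s' P]
      by (auto simp: runs_def intro!: exI[of _ "int_size (fst s i) + t"])
  qed
qed

lemma bounded_stateI:
  "(\<And>i. \<bar>fst s i\<bar> \<le> int V) \<Longrightarrow> (\<And>a. \<bar>snd s a\<bar> \<le> int V) \<Longrightarrow> bounded_state (1 + V) s"
  unfolding bounded_state_def by (smt (verit) int_size_le_Suc_nat nat_le_iff add_left_mono order_trans)

lemma abs_regs_le:
  assumes "\<bar>n\<bar> \<le> V" "\<bar>N\<bar> \<le> V" "\<bar>s\<bar> \<le> V" "\<bar>c\<bar> \<le> V" "\<bar>d\<bar> \<le> V"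
  shows "\<bar>regs b n N s c d i\<bar> \<le> V"
  using assms by (auto simp: regs_def)

lemma abs_snd_initial_le: "(\<And>x. x \<in> set xs \<Longrightarrow> \<bar>x\<bar> \<le> V) \<Longrightarrow> 0 \<le> V \<Longrightarrow> \<bar>snd (initial xs) a\<bar> \<le> V"
  by (auto simp: initial_def)

lemma encode_graph_entries: "x \<in> set (encode_graph n E) \<Longrightarrow> \<bar>x\<bar> \<le> int n + 1"
  by (auto simp: encode_graph_def)

lemma graph_mat_entries:
  assumes "odd s" and "x \<in> set (encode_mat (graph_mat n E s))"
  shows "\<bar>x\<bar> \<le> 2 * int n + 5 * int s + 4"
proof -
  have "x = 2 * int n \<or> (\<exists>i<2 * n. \<exists>j<2 * n. x = entry_num n E i j \<or> x = entry_den n s i j)"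
    using assms(2) quotient_of_graph_mat[OF assms(1)]
    by (auto simp: encode_mat_eq[OF graph_mat_carrier]) blast+
  then show ?thesis
    by (auto simp: entry_num_def entry_den_def edge_sign_def split: if_splits)
qed

text \<open>A number x has \<open>int_size x\<close> at most 1 plus its absolute value, and all
  numbers in play are polynomial in n, so their magnitude already serves as a bit bound. The
  quadratic term covers the counter \<open>4 * n * n\<close> and the square of the candidate
  root.\<close>

definition work_bound :: "nat \<Rightarrow> nat" where
  "work_bound n = 1 + 100 * (n + 1) * (n + 1)"

lemma work_bound_bounded_state:
  assumes "\<And>i. \<bar>fst s i\<bar> \<le> 100 * (int n + 1) * (int n + 1)"
    and "\<And>a. \<bar>snd s a\<bar> \<le> 20 * (int n + 1)"
  shows "bounded_state (work_bound n) s"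
proof -
  have "20 * (int n + 1) \<le> 100 * (int n + 1) * (int n + 1)" by (simp add: algebra_simps)
  then have "\<bar>snd s a\<bar> \<le> 100 * (int n + 1) * (int n + 1)" for a
    using assms(2) order_trans by blast
  then have "bounded_state (1 + 100 * (n + 1) * (n + 1)) s"
    using assms(1) by (intro bounded_stateI) (simp_all add: algebra_simps)
  then show ?thesis by (simp add: work_bound_def)
qed

definition build :: "nat \<Rightarrow> prog" where
  "build b = Seq (seqs [Const (b+2) 1, Sub (b+5) b (b+2)]) (Seq (WhilePos (b+5) (sqrt_body b))
     (Seq (seqs [Add (b+1) b b, Mult (b+3) (b+1) (b+1), Const (b+5) 0])
     (Seq (WhilePos (b+3) (fill_body b)) (Store (b+5) (b+1)))))"

text \<open>The value \<open>d\<close> is left open because register \<open>b+5\<close> still holds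
  the outcome of a comparison when \<open>build\<close> starts.\<close>

lemma build_runs:
  "\<exists>K. \<forall>n E d. 1 \<le> n \<longrightarrow> \<bar>d\<bar> \<le> int n \<longrightarrow>
     runs (build b) (regs b (int n) 0 0 0 d, snd (initial (encode_graph n E)))
       (regs b (int n) (2 * int n) (int (odd_sqrt n)) 0 0,
        snd (initial (encode_mat (graph_mat n E (odd_sqrt n)))))
       (K * (work_bound n * (10 + 10 * n * n)))"
proof -
  define A where "A = seqs [Const (b+2) 1, Sub (b+5) b (b+2)]"
  define D where "D = seqs [Add (b+1) b b, Mult (b+3) (b+1) (b+1), Const (b+5) 0]"
  have "loop_free A" "loop_free D" "loop_free (sqrt_body b)" "loop_free (fill_body b)"
    "loop_free (Store (b+5) (b+1))"
    by (simp_all add: A_def D_def sqrt_body_def fill_body_def)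
  note this[THEN loop_free_exec]
  then obtain K1 K2 K3 K4 K5 where K:
      "\<And>B s. bounded_state B s \<Longrightarrow> runs A s (run A s) (K1 * B)"
      "\<And>B s. bounded_state B s \<Longrightarrow> runs D s (run D s) (K2 * B)"
      "\<And>B s. bounded_state B s \<Longrightarrow> runs (sqrt_body b) s (run (sqrt_body b) s) (K3 * B)"
      "\<And>B s. bounded_state B s \<Longrightarrow> runs (fill_body b) s (run (fill_body b) s) (K4 * B)"
      "\<And>B s. bounded_state B s \<Longrightarrow> runs (Store (b+5) (b+1)) s (run (Store (b+5) (b+1)) s) (K5 * B)"
      "1 \<le> K3" "1 \<le> K4"
    unfolding runs_def by metis
  show ?thesis
  proof (intro exI[of _ "K1 + K2 + K3 + K4 + K5"] allI impI)
    fix n :: nat and E :: "nat set set" and d :: int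
    assume n: "1 \<le> n" and d: "\<bar>d\<bar> \<le> int n"
    define N s B where "N = 2 * n" and "s = odd_sqrt n" and "B = work_bound n"
    define xs ys where "xs = encode_graph n E" and "ys = encode_mat (graph_mat n E s)"
    \<comment> \<open>Address \<open>1 + 2 * p\<close> is the border: the finished part of the
      matrix begins there, and the graph still stands below it.\<close>
    define M where "M p = (\<lambda>a. if 1 + 2 * int p \<le> a then snd (initial ys) a else snd (initial xs) a)" for p
    define W where "W = 100 * (int n + 1) * (int n + 1)"
    have odd: "odd s" by (simp add: s_def odd_odd_sqrt)
    have W: "int n \<le> W" "1 \<le> W" "10 * int n \<le> W" "2 * int n + 1 \<le> W" "4 * int n * int n \<le> W"
        "int n + (2 * int n + 1) * (2 * int n + 1) \<le> W"
      by (auto simp: W_def algebra_simps)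
    have s: "int s \<le> 2 * int n + 1" using odd_sqrt_upper[of n] by (simp add: s_def)
    have xs: "\<bar>snd (initial xs) a\<bar> \<le> 20 * (int n + 1)" for a
      using encode_graph_entries[of _ n E] by (intro abs_snd_initial_le) (force simp: xs_def)+
    have ys: "\<bar>snd (initial ys) a\<bar> \<le> 20 * (int n + 1)" for a
      using graph_mat_entries[OF odd, of _ n E] s by (intro abs_snd_initial_le) (force simp: ys_def)+
    have bnd: "bounded_state B (regs b (int n) x y z w, m)"
      if "\<bar>x\<bar> \<le> W" "\<bar>y\<bar> \<le> W" "\<bar>z\<bar> \<le> W" "\<bar>w\<bar> \<le> W" "\<And>a. \<bar>m a\<bar> \<le> 20 * (int n + 1)" for x y z w m
      unfolding B_def using that W by (intro work_bound_bounded_state) (auto simp: W_def intro!: abs_regs_le)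
    have len: "length xs = 1 + n * n" "length ys = 1 + 2 * (N * N)"
      using length_encode_mat[OF graph_mat_carrier, of n E s]
      by (simp_all add: xs_def ys_def length_encode_graph N_def)

    define h where "h = (LEAST i. n \<le> (2 * i + 1)\<^sup>2)"
    have sh: "s = 2 * h + 1" by (simp add: s_def odd_sqrt_def h_def)
    define S where "S i = (regs b (int n) 0 (2 * int i + 1) 0
      (int n - (2 * int i + 1) * (2 * int i + 1)), snd (initial xs))" for i
    have "runs A (regs b (int n) 0 0 0 d, snd (initial xs))
        (run A (regs b (int n) 0 0 0 d, snd (initial xs))) (K1 * B)"
      using d W xs by (intro K bnd) auto
    also have "run A (regs b (int n) 0 0 0 d, snd (initial xs)) = S 0"
      by (auto simp: A_def S_def regs_def fun_eq_iff)
    finally have 1: "runs A (regs b (int n) 0 0 0 d, snd (initial xs)) (S 0) (K1 * B)" .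

    have SB: "bounded_state B (S i)" if "i \<le> h" for i
    proof -
      have i: "2 * int i + 1 \<le> 2 * int n + 1" using that s sh by simp
      then have "(2 * int i + 1) * (2 * int i + 1) \<le> (2 * int n + 1) * (2 * int n + 1)"
        by (intro mult_mono) auto
      moreover have "0 \<le> (2 * int i + 1) * (2 * int i + 1)" by simp
      ultimately have "\<bar>int n - (2 * int i + 1) * (2 * int i + 1)\<bar> \<le> W"
        using W(6) by linarith
      then show ?thesis unfolding S_def using W xs i by (intro bnd) auto
    qed
    have Sx: "fst (S i) (b+5) = int n - int ((2 * i + 1)\<^sup>2)" for i
      by (simp add: S_def regs_def power2_eq_square algebra_simps)
    have "\<exists>t\<le>(2 * h + 1) * (K3 * B). exec (WhilePos (b+5) (sqrt_body b)) (S 0) t (S h)"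
    proof (rule while_exec)
      fix i assume i: "i < h"
      then have "(2 * i + 1)\<^sup>2 < n" using odd_sqrt_minimal[of i n] sh s_def by simp
      then show "0 < fst (S i) (b+5)" unfolding Sx by linarith
      have "2 * int i + 1 + 2 = 2 * int (Suc i) + 1" by simp
      then have "run (sqrt_body b) (S i) = S (Suc i)"
        unfolding S_def run_sqrt_body by (simp only: of_nat_Suc)
      then show "\<exists>t\<le>K3 * B. exec (sqrt_body b) (S i) t (S (Suc i))"
        using K(3)[OF SB[of i]] i by (simp add: runs_def)
    next
      have "n \<le> (2 * h + 1)\<^sup>2" using odd_sqrt_le[of n] sh s_def by simp
      then show "fst (S h) (b+5) \<le> 0" unfolding Sx by linarith
    next
      fix i assume "i \<le> h"
      then have "int_size (fst (S i) (b+5)) \<le> B" using SB[of i] by (simp add: bounded_state_def)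
      also have "\<dots> \<le> K3 * B" using K(6) by simp
      finally show "int_size (fst (S i) (b+5)) \<le> K3 * B" .
    qed
    then have 2: "runs (WhilePos (b+5) (sqrt_body b)) (S 0) (S h) ((2 * h + 1) * (K3 * B))"
      by (simp add: runs_def)

    define R where "R p = (regs b (int n) (int N) (int s) (int p) 0, M p)" for p
    \<comment> \<open>Initially the border is at \<open>1 + 8 * n * n\<close>, past the ends of both
      lists, where both memories are 0.\<close>
    have M0: "M (N * N) = snd (initial xs)"
    proof -
      have "snd (initial xs) a = 0" if "1 + 8 * (int n * int n) \<le> a" for a
      proof (rule snd_initial_beyond)
        have "0 \<le> int n * int n" by simp
        then have "1 + int n * int n \<le> a" using that by linarith
        then show "int (length xs) \<le> a" using len by simp
      qed
      moreover have "snd (initial ys) a = 0" if "1 + 8 * (int n * int n) \<le> a" for a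
        using that len by (intro snd_initial_beyond) (simp add: N_def)
      ultimately show ?thesis by (auto simp: M_def fun_eq_iff N_def)
    qed
    have "run D (S h) = R (N * N)"
      unfolding R_def M0 by (auto simp: D_def S_def regs_def fun_eq_iff N_def sh)
    then have 3: "runs D (S h) (R (N * N)) (K2 * B)"
      using K(2)[OF SB[of h]] by simp

    have RB: "bounded_state B (R p)" if "p \<le> N * N" for p
    proof -
      have "int p \<le> int (N * N)" using that by (simp only: of_nat_le_iff)
      then show ?thesis
        unfolding R_def using s W xs ys by (intro bnd) (auto simp: N_def M_def)
    qed
    have step: "run (fill_body b) (R (Suc p)) = R p" if p: "p < N * N" for p
    proof -
      have lt: "p div N < N" "p mod N < N"
        using p n by (auto simp: less_mult_imp_div_less N_def)
      define i j where "i = p div N mod n" and "j = p mod N mod n"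
      have ij: "i < n" "j < n" using n by (auto simp: i_def j_def)
      \<comment> \<open>Reducing row and column modulo n only decreases the index, so the adjacency
        needed for entry \<open>p\<close> is at an address at most \<open>1 + p\<close>, below the
        border \<open>1 + 2 * (p + 1)\<close>, and is still intact.\<close>
      have "i * n \<le> (p div N) * N" by (intro mult_mono) (auto simp: i_def N_def)
      moreover have "j \<le> p mod N" by (simp add: j_def)
      ultimately have le: "i * n + j \<le> p" using div_mult_mod_eq[of p N] by linarith
      then have "int (i * n + j) \<le> int p" by (simp only: of_nat_le_iff)
      then have "M (Suc p) (1 + (int i * int n + int j)) = snd (initial xs) (int (1 + (i * n + j)))"
        by (simp add: M_def)
      also have "\<dots> = xs ! (1 + (i * n + j))"
      proof (rule snd_initial_nth)
        have "i * n + j < Suc i * n" using ij by simp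
        also have "\<dots> \<le> n * n" using ij by (intro mult_le_mono1) simp
        finally show "1 + (i * n + j) < length xs" using len by simp
      qed
      also have "\<dots> = of_bool ({i, j} \<in> E)" using encode_graph_nth[OF ij] by (simp add: xs_def)
      finally have read: "M (Suc p) (1 + (int i * int n + int j)) = of_bool ({i, j} \<in> E)" .
      have q: "quotient_of (graph_mat n E s $$ (p div N, p mod N)) =
          (entry_num n E (p div N) (p mod N), entry_den n s (p div N) (p mod N))"
        using lt odd by (intro quotient_of_graph_mat) (auto simp: N_def)
      have "ys ! (1 + 2 * p) = entry_num n E (p div N) (p mod N)"
        "ys ! (2 + 2 * p) = entry_den n s (p div N) (p mod N)"
        using encode_mat_nth[OF graph_mat_carrier[of n E s, folded N_def] lt] q
        by (simp_all add: ys_def)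
      then have "snd (initial ys) (1 + 2 * int p) = entry_num n E (p div N) (p mod N)"
        "snd (initial ys) (2 + 2 * int p) = entry_den n s (p div N) (p mod N)"
        using snd_initial_nth[of "1 + 2 * p" ys] snd_initial_nth[of "2 + 2 * p" ys] len p by simp_all
      then have "(M (Suc p))(1 + 2 * int p := entry_num n E (p div N) (p mod N),
          2 + 2 * int p := entry_den n s (p div N) (p mod N)) = M p"
        by (auto simp: M_def fun_eq_iff)
      then show ?thesis
        using run_fill_body[where M = "M (Suc p)", OF p N_def read[unfolded i_def j_def], of b s] by (simp add: R_def add.commute)
    qed
    have "\<exists>t\<le>(2 * (N * N) + 1) * (K4 * B).
        exec (WhilePos (b+3) (fill_body b)) (R (N * N - 0)) t (R (N * N - N * N))"
    proof (rule while_exec)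
      fix i assume i: "i < N * N"
      then show "0 < fst (R (N * N - i)) (b+3)" by (simp add: R_def regs_def del: of_nat_mult)
      have "N * N - i = Suc (N * N - Suc i)" using i by simp
      then have "run (fill_body b) (R (N * N - i)) = R (N * N - Suc i)" using step[of "N * N - Suc i"] i by simp
      then show "\<exists>t\<le>K4 * B. exec (fill_body b) (R (N * N - i)) t (R (N * N - Suc i))"
        using K(4)[OF RB[of "N * N - i"]] by (simp add: runs_def)
    next
      show "fst (R (N * N - N * N)) (b+3) \<le> 0" by (simp add: R_def regs_def)
    next
      fix i
      have "int_size (fst (R (N * N - i)) (b+3)) \<le> B" using RB[of "N * N - i"] by (simp add: bounded_state_def)
      also have "\<dots> \<le> K4 * B" using K(7) by simp
      finally show "int_size (fst (R (N * N - i)) (b+3)) \<le> K4 * B" .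
    qed
    then have 4: "runs (WhilePos (b+3) (fill_body b)) (R (N * N)) (R 0) ((2 * (N * N) + 1) * (K4 * B))"
      by (simp add: runs_def)

    have "snd (initial ys) 0 = 2 * int n"
      using snd_initial_nth[of 0 ys] len graph_mat_carrier[of n E s]
      by (simp add: ys_def encode_mat_eq[OF graph_mat_carrier])
    moreover have "snd (initial xs) a = 0" "snd (initial ys) a = 0" if "a < 0" for a
      using that by (auto simp: initial_def)
    ultimately have "run (Store (b+5) (b+1)) (R 0) = (regs b (int n) (2 * int n) (int s) 0 0, snd (initial ys))"
      by (auto simp: R_def regs_def M_def fun_eq_iff N_def)
    then have 5: "runs (Store (b+5) (b+1)) (R 0)
        (regs b (int n) (2 * int n) (int s) 0 0, snd (initial ys)) (K5 * B)"
      using K(5)[OF RB[of 0]] by simp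

    have "h \<le> n" using s sh by simp
    then have "(2 * h + 1) * (K3 * B) \<le> K3 * (B * (10 + 10 * n * n))"
    proof -
      have "h \<le> n * n" using \<open>h \<le> n\<close> n by (metis le_square order_trans)
      then have "2 * h + 1 \<le> 10 + 10 * n * n" by simp
      then have "(2 * h + 1) * (K3 * B) \<le> (10 + 10 * n * n) * (K3 * B)" by (rule mult_le_mono1)
      then show ?thesis by (simp only: ac_simps)
    qed
    moreover have "(2 * (N * N) + 1) * (K4 * B) \<le> K4 * (B * (10 + 10 * n * n))"
      by (simp add: N_def algebra_simps)
    moreover have "K * B \<le> K * (B * (10 + 10 * n * n))" for K by (simp add: algebra_simps)
    ultimately have "K1 * B + ((2 * h + 1) * (K3 * B) + (K2 * B + ((2 * (N * N) + 1) * (K4 * B) + K5 * B)))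
        \<le> K1 * (B * (10 + 10 * n * n)) + (K3 * (B * (10 + 10 * n * n)) + (K2 * (B * (10 + 10 * n * n)) +
          (K4 * (B * (10 + 10 * n * n)) + K5 * (B * (10 + 10 * n * n)))))"
      by (intro add_mono)
    also have "\<dots> = (K1 + K2 + K3 + K4 + K5) * (B * (10 + 10 * n * n))"
      unfolding add_mult_distrib by (simp only: add_ac)
    finally have "K1 * B + ((2 * h + 1) * (K3 * B) + (K2 * B + ((2 * (N * N) + 1) * (K4 * B) + K5 * B)))
        \<le> (K1 + K2 + K3 + K4 + K5) * (B * (10 + 10 * n * n))" .
    then show "runs (build b) (regs b (int n) 0 0 0 d, snd (initial (encode_graph n E)))
       (regs b (int n) (2 * int n) (int (odd_sqrt n)) 0 0,
        snd (initial (encode_mat (graph_mat n E (odd_sqrt n)))))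
       ((K1 + K2 + K3 + K4 + K5) * (work_bound n * (10 + 10 * n * n)))"
      using runs_mono[OF runs_Seq[OF 1 runs_Seq[OF 2 runs_Seq[OF 3 runs_Seq[OF 4 5]]]]]
      by (simp add: build_def A_def D_def xs_def ys_def s_def B_def)
  qed
qed

text \<open>The answer is flipped to \<open>1 - y\<close> because a clique makes the RIP parameter
  large, which \<open>P\<close> answers with no. Graphs with fewer than \<open>n1\<close> vertices
  are all answered yes: this respects the clause on cliques and does not affect a limit in
  n.\<close>

lemma graph_reduction:
  assumes "polytime_on mat_inputs P" and "1 \<le> n1"
  shows "\<exists>R. polytime_on graph_inputs R \<and>
    (\<forall>n E. n < n1 \<longrightarrow> outputs R (encode_graph n E) 1) \<and>
    (\<forall>n E y. n1 \<le> n \<longrightarrow> outputs P (encode_mat (graph_mat n E (odd_sqrt n))) y \<longrightarrow>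
      outputs R (encode_graph n E) (1 - y))"
proof -
  \<comment> \<open>The output register 0 has to lie below \<open>b\<close> even if \<open>P\<close>
    mentions no register.\<close>
  define b where "b = max 1 (reg_bound P)"
  define H where "H = seqs [Load b b, Const (b+5) (int n1 - 1), Sub (b+5) b (b+5)]"
  define F where "F = seqs [Const (b+5) 1, Sub 0 (b+5) 0]"
  define R where "R = Seq H (IfPos (b+5) (Seq (build b) (Seq P F)) (Const 0 1))"
  have "loop_free H" "loop_free F" by (simp_all add: H_def F_def)
  note this[THEN loop_free_exec]
  then obtain K1 K2 where K:
      "\<And>B s. bounded_state B s \<Longrightarrow> runs H s (run H s) (K1 * B)"
      "\<And>B s. bounded_state B s \<Longrightarrow> runs F s (run F s) (K2 * B)"
    unfolding runs_def by metis
  obtain K3 where K3: "\<And>n E d. 1 \<le> n \<Longrightarrow> \<bar>d\<bar> \<le> int n \<Longrightarrow>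
     runs (build b) (regs b (int n) 0 0 0 d, snd (initial (encode_graph n E)))
       (regs b (int n) (2 * int n) (int (odd_sqrt n)) 0 0,
        snd (initial (encode_mat (graph_mat n E (odd_sqrt n)))))
       (K3 * (work_bound n * (10 + 10 * n * n)))"
    using build_runs[of b] by blast
  obtain p where p: "\<And>xs. xs \<in> mat_inputs \<Longrightarrow> \<exists>t s. exec P (initial xs) t s \<and> t \<le> poly p (input_size xs)"
    using assms(1) unfolding polytime_on_def by blast
  have H: "run H (initial (encode_graph n E)) =
      (regs b (int n) 0 0 0 (int n - int n1 + 1), snd (initial (encode_graph n E)))" for n E
    using snd_initial_nth[of 0 "encode_graph n E"]
    by (auto simp: H_def regs_def fun_eq_iff initial_def encode_graph_def)
  have BH: "bounded_state (work_bound n) (initial (encode_graph n E))" for n E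
  proof (rule work_bound_bounded_state)
    show "\<bar>snd (initial (encode_graph n E)) a\<bar> \<le> 20 * (int n + 1)" for a
      using encode_graph_entries[of _ n E] by (intro abs_snd_initial_le) force+
  qed (simp add: initial_def)
  have RH: "runs H (initial (encode_graph n E))
      (regs b (int n) 0 0 0 (int n - int n1 + 1), snd (initial (encode_graph n E)))
      (K1 * work_bound n)" for n E
    using K(1)[OF BH, of n E] by (simp add: H)

  have small: "\<exists>s. runs R (initial (encode_graph n E)) s (K1 * work_bound n + (n1 + 2 + 2)) \<and> fst s 0 = 1"
    if "n < n1" for n E
  proof -
    define s where "s = (regs b (int n) 0 0 0 (int n - int n1 + 1), snd (initial (encode_graph n E)))"
    have "int_size 1 \<le> 2" using int_size_le_Suc_nat[of 1] by simp
    then have "runs (Const 0 1) s ((fst s)(0 := 1), snd s) 2"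
      unfolding runs_def using exec.intros(2)[of 0 1 "fst s" "snd s"] by auto
    moreover have "fst s (b+5) = int n - int n1 + 1" by (simp add: s_def regs_def)
    moreover have "int_size (int n - int n1 + 1) \<le> n1 + 2"
      using int_size_le_Suc_nat[of "int n - int n1 + 1"] that by simp
    ultimately have "runs (IfPos (b+5) (Seq (build b) (Seq P F)) (Const 0 1)) s
        ((fst s)(0 := 1), snd s) (n1 + 2 + 2)"
      using that by (intro runs_IfPos(2)) auto
    then show ?thesis using runs_Seq[OF RH[of n E]] unfolding R_def s_def by fastforce
  qed

  \<comment> \<open>\<open>Bp\<close> is \<open>work_bound\<close>, \<open>Dp\<close> the number of
    steps of \<open>build\<close> up to a constant, and \<open>sp\<close> bounds the size of the
    matrix encoding: \<open>1 + 8 * n * n\<close> integers of size at most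
    \<open>work_bound n\<close>. Hence \<open>pcompose p sp\<close> bounds the cost of
    \<open>P\<close> in terms of n, and \<open>Q\<close> the total cost.\<close>
  define Bp :: "nat poly" where "Bp = [:1:] + [:100:] * [:1, 1:] * [:1, 1:]"
  define Dp where "Dp = [:10:] + [:10:] * [:0, 1:] * [:0, 1 :: nat:]"
  define sp where "sp = Bp * ([:1:] + [:8:] * [:0, 1:] * [:0, 1:])"
  define Q where "Q = [:K1:] * Bp + [:n1 + 4:] + (Bp + ([:K3:] * (Bp * Dp) +
    (pcompose p sp + [:K2:] * (Bp + pcompose p sp))))"
  have Bp: "poly Bp n = work_bound n" for n
    by (simp add: Bp_def work_bound_def algebra_simps)
  have Dp: "poly Dp n = 10 + 10 * n * n" for n
    by (simp add: Dp_def algebra_simps)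
  have sp: "poly sp n = work_bound n * (1 + 8 * n * n)" for n
    by (simp add: sp_def Bp algebra_simps)

  have large: "\<exists>s s' t. runs R (initial (encode_graph n E)) s (poly Q n) \<and>
      exec P (initial (encode_mat (graph_mat n E (odd_sqrt n)))) t s' \<and> fst s 0 = 1 - fst s' 0"
    if "n1 \<le> n" for n E
  proof -
    define ys where "ys = encode_mat (graph_mat n E (odd_sqrt n))"
    define s1 where "s1 = (regs b (int n) 0 0 0 (int n - int n1 + 1), snd (initial (encode_graph n E)))"
    define q where "q = regs b (int n) (2 * int n) (int (odd_sqrt n)) 0 0"
    have s: "odd_sqrt n \<le> 2 * n + 1" by (rule odd_sqrt_upper)
    have ys: "\<bar>x\<bar> \<le> 20 * (int n + 1)" if "x \<in> set ys" for x
      using graph_mat_entries[OF odd_odd_sqrt, of x n E n] that s by (force simp: ys_def)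
    have "input_size ys \<le> (\<Sum>x\<leftarrow>ys. work_bound n)"
      unfolding input_size_def
    proof (rule sum_list_mono)
      fix x assume "x \<in> set ys"
      then have "nat \<bar>x\<bar> \<le> 20 * (n + 1)" using ys by fastforce
      also have "\<dots> \<le> 100 * (n + 1) * (n + 1)" by simp
      finally show "int_size x \<le> work_bound n"
        using int_size_le_Suc_nat[of x] unfolding work_bound_def by linarith
    qed
    also have "\<dots> = work_bound n * (1 + 8 * n * n)"
      using length_encode_mat[OF graph_mat_carrier, of n E "odd_sqrt n"]
      by (simp add: ys_def sum_list_triv)
    finally have size: "input_size ys \<le> poly sp n" by (simp add: sp)
    have "ys \<in> mat_inputs" unfolding ys_def mat_inputs_def using graph_mat_carrier by blast
    then obtain t s' where t: "exec P (initial ys) t s'" "t \<le> poly p (input_size ys)" using p by blast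
    then have t': "t \<le> poly (pcompose p sp) n"
      using poly_nat_mono[OF size, of p] by (simp add: poly_pcompose)
    define s2 where "s2 = (\<lambda>i. if i < b then fst s' i else q i, snd s')"
    \<comment> \<open>The leftovers of \<open>build\<close> lie in registers from \<open>b\<close>
      on; below \<open>b\<close> everything is 0, as \<open>P\<close> expects at the start.\<close>
    have "exec P (q, snd (initial ys)) t s2"
      unfolding s2_def using t(1) by (rule exec_frame) (auto simp: b_def q_def regs_def initial_def)
    moreover have "bounded_state (work_bound n) (q, snd (initial ys))"
    proof (rule work_bound_bounded_state)
      show "\<bar>snd (q, snd (initial ys)) a\<bar> \<le> 20 * (int n + 1)" for a
        using ys by (auto intro: abs_snd_initial_le)
      show "\<bar>fst (q, snd (initial ys)) i\<bar> \<le> 100 * (int n + 1) * (int n + 1)" for i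
      proof -
        have "int (odd_sqrt n) \<le> 2 * int n + 1" using s by simp
        also have "\<dots> \<le> 100 * (int n + 1) * (int n + 1)" by (simp add: algebra_simps)
        finally have "int (odd_sqrt n) \<le> 100 * (int n + 1) * (int n + 1)" .
        then show ?thesis
          unfolding q_def fst_conv by (intro abs_regs_le) (simp_all add: algebra_simps)
      qed
    qed
    ultimately have "bounded_state (max (work_bound n) t) s2" by (rule exec_bounded_state)
    then have "bounded_state (work_bound n + poly (pcompose p sp) n) s2"
      by (rule bounded_state_mono) (use t' in auto)
    from K(2)[OF this] have 3: "runs F s2 (run F s2) (K2 * (work_bound n + poly (pcompose p sp) n))" .
    have 2: "runs P (q, snd (initial ys)) s2 (poly (pcompose p sp) n)"
      using \<open>exec P (q, snd (initial ys)) t s2\<close> t' unfolding runs_def by blast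
    have 1: "runs (build b) s1 (q, snd (initial ys)) (K3 * (work_bound n * (10 + 10 * n * n)))"
      unfolding s1_def q_def ys_def using that assms(2) by (intro K3) auto
    have "int_size (fst s1 (b+5)) \<le> work_bound n"
    proof -
      have "int_size (fst s1 (b+5)) \<le> int_size (int n)"
        using that assms(2) by (intro int_size_mono) (simp add: s1_def regs_def)
      also have "\<dots> \<le> work_bound n" using int_size_le_Suc_nat[of "int n"] by (simp add: work_bound_def)
      finally show ?thesis .
    qed
    then have *: "runs (IfPos (b+5) (Seq (build b) (Seq P F)) (Const 0 1)) s1 (run F s2)
        (work_bound n + (K3 * (work_bound n * (10 + 10 * n * n)) + (poly (pcompose p sp) n +
          K2 * (work_bound n + poly (pcompose p sp) n))))"
      using that by (intro runs_IfPos(1) runs_Seq[OF 1] runs_Seq[OF 2 3]) (auto simp: s1_def regs_def)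
    have "runs R (initial (encode_graph n E)) (run F s2) (poly Q n)"
      unfolding R_def
      by (rule runs_mono[OF runs_Seq[OF RH[of n E] *[unfolded s1_def]]]) (auto simp: Q_def Bp Dp)
    moreover have "fst (run F s2) 0 = 1 - fst s' 0"
      by (simp add: F_def s2_def b_def)
    ultimately show ?thesis using t(1) unfolding ys_def by blast
  qed

  have "polytime_on graph_inputs R"
    unfolding polytime_on_def
  proof (intro exI[of _ Q] ballI)
    fix xs assume "xs \<in> graph_inputs"
    then obtain n E where xs: "xs = encode_graph n E" by (auto simp: graph_inputs_def)
    have "n \<le> input_size xs"
      using length_le_input_size[of xs] le_square[of n] unfolding xs length_encode_graph by linarith
    then have Q: "poly Q n \<le> poly Q (input_size xs)" by (rule poly_nat_mono)
    show "\<exists>t s. exec R (initial xs) t s \<and> t \<le> poly Q (input_size xs)"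
    proof (cases "n < n1")
      case True
      have "K1 * work_bound n + (n1 + 2 + 2) \<le> poly Q n" by (simp add: Q_def Bp)
      then show ?thesis using small[OF True, of E] Q unfolding runs_def xs by (meson order_trans)
    next
      case False
      then show ?thesis using large[of n E] Q unfolding runs_def xs by (meson order_trans not_le)
    qed
  qed
  moreover have "outputs R (encode_graph n E) 1" if "n < n1" for n E
    using small[OF that, of E] unfolding outputs_def runs_def by (metis prod.collapse)
  moreover have "outputs R (encode_graph n E) (1 - y)"
    if le: "n1 \<le> n" and y: "outputs P (encode_mat (graph_mat n E (odd_sqrt n))) y" for n E y
  proof -
    obtain s s' t where *: "runs R (initial (encode_graph n E)) s (poly Q n)"
      "exec P (initial (encode_mat (graph_mat n E (odd_sqrt n)))) t s'" "fst s 0 = 1 - fst s' 0"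
      using large[OF le] by blast
    have "fst s' 0 = y"
      using y exec_deterministic[OF *(2)] unfolding outputs_def by fastforce
    then show ?thesis using * unfolding outputs_def runs_def by (metis prod.collapse)
  qed
  ultimately show ?thesis by blast
qed

section \<open>Turning an approximation into a yes/no answer\<close>

fun power_prog :: "nat \<Rightarrow> nat \<Rightarrow> nat \<Rightarrow> prog" where
  "power_prog i j 0 = Const i 1"
| "power_prog i j (Suc e) = Seq (power_prog i j e) (Mult i i j)"

lemma loop_free_power_prog: "loop_free (power_prog i j e)"
  by (induction e) auto

lemma run_power_prog: "i \<noteq> j \<Longrightarrow> run (power_prog i j e) (r, m) = (r(i := r j ^ e), m)"
  by (induction e) (auto simp: fun_eq_iff)

text \<open>As \<open>\<epsilon>\<close> need not be computable, the threshold is \<open>N powr (- a / b)\<close> for a rational exponent.\<close>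

lemma threshold_reduction:
  assumes "polytime_on mat_inputs P"
  shows "\<exists>R. polytime_on mat_inputs R \<and>
    (\<forall>N. \<forall>\<Phi> \<in> carrier_mat N N. \<forall>q. outputs_rat P (encode_mat \<Phi>) q \<longrightarrow>
      outputs R (encode_mat \<Phi>) (if q ^ b * of_nat N ^ a \<le> 1 then 1 else 0))"
proof -
  \<comment> \<open>The summand 2 keeps registers 0 and 1, which carry the numerator and denominator
    of the answer, below \<open>z\<close>.\<close>
  define z where "z = reg_bound P + 2"
  \<comment> \<open>The exponents are constants of the program, so the powers are unrolled and
    \<open>F\<close> remains loop-free.\<close>
  define F where "F = seqs [power_prog (z+1) 0 b, power_prog (z+2) 1 b, power_prog (z+3) z a,
    Mult (z+1) (z+1) (z+3), Sub (z+1) (z+1) (z+2), IfPos (z+1) (Const 0 0) (Const 0 1)]"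
  define R where "R = Seq (Load z z) (Seq P F)"
  have "loop_free (Load z z)" "loop_free F" by (simp_all add: F_def loop_free_power_prog)
  note this[THEN loop_free_exec]
  then obtain K1 K2 where K:
      "\<And>B s. bounded_state B s \<Longrightarrow> runs (Load z z) s (run (Load z z) s) (K1 * B)"
      "\<And>B s. bounded_state B s \<Longrightarrow> runs F s (run F s) (K2 * B)"
    unfolding runs_def by metis
  \<comment> \<open>With the answer given as \<open>r 0 / r 1\<close> and \<open>r 1\<close>
    positive, clearing denominators turns the test \<open>q ^ b * N ^ a \<le> 1\<close> into this
    comparison of integers.\<close>
  have F: "fst (run F (r, m)) 0 = (if r 0 ^ b * r z ^ a \<le> r 1 ^ b then 1 else 0)" for r m
    by (simp add: F_def run_power_prog z_def)
  obtain p where p: "\<And>xs. xs \<in> mat_inputs \<Longrightarrow> \<exists>t s. exec P (initial xs) t s \<and> t \<le> poly p (input_size xs)"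
    using assms(1) unfolding polytime_on_def by blast
  define Q where "Q = [:K1:] * [:0, 1:] + (p + [:K2:] * ([:0, 1:] + p))"
  have main: "\<exists>s t s'. runs R (initial xs) s (poly Q (input_size xs)) \<and> exec P (initial xs) t s' \<and>
      fst s 0 = (if fst s' 0 ^ b * int N ^ a \<le> fst s' 1 ^ b then 1 else 0)"
    if xs: "xs = encode_mat \<Phi>" "\<Phi> \<in> carrier_mat N N" for xs \<Phi> N
  proof -
    have "xs \<noteq> []" by (simp add: xs encode_mat_eq[OF xs(2)])
    then have B: "bounded_state (input_size xs) (initial xs)" by (rule input_bounded)
    define q :: "nat \<Rightarrow> int" where "q = (\<lambda>_. 0)(z := int N)"
    have "snd (initial xs) 0 = int N" by (simp add: initial_def xs encode_mat_eq[OF xs(2)])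
    then have "run (Load z z) (initial xs) = (q, snd (initial xs))"
      by (auto simp: q_def initial_def)
    with K(1)[OF B] have 1: "runs (Load z z) (initial xs) (q, snd (initial xs)) (K1 * input_size xs)"
      by simp
    have "xs \<in> mat_inputs" unfolding mat_inputs_def xs using xs(2) by blast
    then obtain t s' where t: "exec P (initial xs) t s'" "t \<le> poly p (input_size xs)" using p by blast
    define s2 where "s2 = (\<lambda>i. if i < z then fst s' i else q i, snd s')"
    have *: "exec P (q, snd (initial xs)) t s2"
      unfolding s2_def using t(1) by (rule exec_frame) (auto simp: z_def q_def initial_def)
    then have 2: "runs P (q, snd (initial xs)) s2 (poly p (input_size xs))"
      using t(2) unfolding runs_def by blast
    have "int_size (int N) \<le> input_size xs"
      by (simp add: input_size_def xs encode_mat_eq[OF xs(2)])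
    then have "bounded_state (input_size xs) (q, snd (initial xs))"
      using B int_size_ge_1[of "int N"] by (auto simp: bounded_state_def q_def)
    with * have "bounded_state (max (input_size xs) t) s2" by (rule exec_bounded_state)
    then have "bounded_state (input_size xs + poly p (input_size xs)) s2"
      by (rule bounded_state_mono) (use t(2) in auto)
    from K(2)[OF this] have 3: "runs F s2 (run F s2) (K2 * (input_size xs + poly p (input_size xs)))" .
    have "runs R (initial xs) (run F s2) (poly Q (input_size xs))"
      unfolding R_def by (rule runs_mono[OF runs_Seq[OF 1 runs_Seq[OF 2 3]]]) (simp add: Q_def)
    moreover have "fst (run F s2) 0 = (if fst s' 0 ^ b * int N ^ a \<le> fst s' 1 ^ b then 1 else 0)"
      by (simp add: s2_def F q_def z_def)
    ultimately show ?thesis using t(1) by blast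
  qed
  have "polytime_on mat_inputs R"
    unfolding polytime_on_def
  proof (intro exI[of _ Q] ballI)
    fix xs assume "xs \<in> mat_inputs"
    then show "\<exists>t s. exec R (initial xs) t s \<and> t \<le> poly Q (input_size xs)"
      using main unfolding mat_inputs_def runs_def by blast
  qed
  moreover have "outputs R (encode_mat \<Phi>) (if q ^ b * of_nat N ^ a \<le> 1 then 1 else 0)"
    if \<Phi>: "\<Phi> \<in> carrier_mat N N" and q: "outputs_rat P (encode_mat \<Phi>) q" for N \<Phi> q
  proof -
    obtain s t s' where s: "runs R (initial (encode_mat \<Phi>)) s (poly Q (input_size (encode_mat \<Phi>)))"
      "exec P (initial (encode_mat \<Phi>)) t s'"
      "fst s 0 = (if fst s' 0 ^ b * int N ^ a \<le> fst s' 1 ^ b then 1 else 0)"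
      using main[OF refl \<Phi>] by blast
    have q': "0 < fst s' 1" "q = of_int (fst s' 0) / of_int (fst s' 1)"
      using q exec_deterministic[OF s(2)] unfolding outputs_rat_def by fastforce+
    have "q ^ b * of_nat N ^ a \<le> 1 \<longleftrightarrow> (of_int (fst s' 0) ^ b * of_nat N ^ a :: rat) \<le> of_int (fst s' 1) ^ b"
      using q' by (simp add: power_divide divide_le_eq)
    also have "\<dots> \<longleftrightarrow> (of_int (fst s' 0 ^ b * int N ^ a) :: rat) \<le> of_int (fst s' 1 ^ b)" by simp
    also have "\<dots> \<longleftrightarrow> fst s' 0 ^ b * int N ^ a \<le> fst s' 1 ^ b" by (rule of_int_le_iff)
    finally show ?thesis using s(1,3) unfolding outputs_def runs_def by (metis prod.collapse)
  qed
  ultimately show ?thesis by blast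
qed

section \<open>Concentration for sparse vectors\<close>

definition edge_val :: "'a set \<Rightarrow> 'a \<Rightarrow> real" where
  "edge_val E e = (if e \<in> E then 1 else -1)"

lemma two_power_fact_le: "2 ^ n * fact n \<le> (fact (2 * n) :: real)"
proof (induction n)
  case (Suc n)
  have "2 ^ Suc n * fact (Suc n) = 2 * (real n + 1) * (2 ^ n * fact n)"
    by (simp add: algebra_simps)
  also have "\<dots> \<le> (2 * (real n + 1) * (2 * real n + 1)) * fact (2 * n)"
    using Suc by (intro mult_mono) (auto simp: algebra_simps)
  also have "\<dots> = fact (2 * Suc n)" by (simp add: algebra_simps)
  finally show ?case .
qed simp

text \<open>The power series of cosh x and exp (x^2 / 2) are compared term by term; the coefficients
  are ordered by \<open>two_power_fact_le\<close>.\<close>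

lemma cosh_le_exp_half_square: "exp x + exp (- x) \<le> 2 * exp (x\<^sup>2 / 2)" for x :: real
proof -
  have "strict_mono (\<lambda>n::nat. 2 * n)" by (rule strict_monoI) simp
  then have 1: "(\<lambda>n. x ^ (2 * n) /\<^sub>R fact (2 * n)) sums cosh x"
    using sums_mono_reindex[of "\<lambda>n. 2 * n" "\<lambda>n. if even n then x ^ n /\<^sub>R fact n else 0" "cosh x", THEN iffD2]
      cosh_converges[of x]
    by (force simp: image_iff elim!: evenE)
  have 2: "(\<lambda>n. (x\<^sup>2 / 2) ^ n /\<^sub>R fact n) sums exp (x\<^sup>2 / 2)" by (rule exp_converges)
  have "x ^ (2 * n) /\<^sub>R fact (2 * n) \<le> (x\<^sup>2 / 2) ^ n /\<^sub>R fact n" for n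
  proof -
    have "x ^ (2 * n) / fact (2 * n) \<le> x ^ (2 * n) / (2 ^ n * fact n)"
      using two_power_fact_le[of n] by (intro divide_left_mono) (auto simp: power_mult)
    also have "\<dots> = (x\<^sup>2 / 2) ^ n / fact n" by (simp add: power_divide power_mult[symmetric])
    finally show ?thesis by (simp only: real_scaleR_def divide_inverse mult.commute)
  qed
  then have "cosh x \<le> exp (x\<^sup>2 / 2)" by (rule sums_le[OF _ 1 2])
  then show ?thesis by (simp add: cosh_field_def)
qed

text \<open>Expanding the product decides for each element whether it belongs to \<open>E\<close>.
  In counting form, this is the independence of the elements of a uniformly random subset.\<close>

lemma sum_Pow_prod:
  fixes f g :: "'a \<Rightarrow> 'b :: comm_semiring_1"
  assumes "finite X"
  shows "(\<Sum>E\<in>Pow X. \<Prod>e\<in>X. if e \<in> E then f e else g e) = (\<Prod>e\<in>X. f e + g e)"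
  using assms
proof (induction X)
  case (insert x X)
  have inj: "inj_on (insert x) (Pow X)" using insert.hyps by (auto simp: inj_on_def)
  let ?P = "\<lambda>E Y. \<Prod>e\<in>Y. if e \<in> E then f e else g e"
  have "?P E (insert x X) = g x * ?P E X" "?P (insert x E) (insert x X) = f x * ?P E X" if "E \<in> Pow X" for E
  proof -
    have "x \<notin> E" using that insert.hyps by auto
    then show "?P E (insert x X) = g x * ?P E X" using insert.hyps by simp
    have "?P (insert x E) X = ?P E X" using insert.hyps by (intro prod.cong) auto
    then show "?P (insert x E) (insert x X) = f x * ?P E X" using insert.hyps by simp
  qed
  moreover have "Pow X \<inter> insert x ` Pow X = {}" using insert.hyps by auto
  then have "(\<Sum>E\<in>Pow (insert x X). ?P E (insert x X)) =
      (\<Sum>E\<in>Pow X. ?P E (insert x X)) + (\<Sum>E\<in>Pow X. ?P (insert x E) (insert x X))"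
    unfolding Pow_insert using insert.hyps by (subst sum.union_disjoint) (auto simp: sum.reindex[OF inj])
  ultimately show ?case
    using insert by (simp add: sum_distrib_left[symmetric] distrib_right add.commute)
qed simp

text \<open>The sub-Gaussian bound for a sum of independent signs, not normalised: the sum
  factorises over the edges \<open>g i\<close>, which are distinct by injectivity.\<close>

lemma rademacher_mgf:
  assumes "finite R" and "inj_on g R"
  shows "(\<Sum>E\<in>Pow (g ` R). exp (\<Sum>i\<in>R. c i * edge_val E (g i))) \<le> 2 ^ card R * exp (\<Sum>i\<in>R. (c i)\<^sup>2 / 2)"
proof -
  define d where "d e = c (inv_into R g e)" for e
  have d: "d (g i) = c i" if "i \<in> R" for i using that assms by (simp add: d_def)
  have "exp (\<Sum>i\<in>R. c i * edge_val E (g i)) = (\<Prod>e\<in>g ` R. if e \<in> E then exp (d e) else exp (- d e))" for E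
    using assms by (auto simp: prod.reindex exp_sum d edge_val_def intro!: prod.cong)
  then have "(\<Sum>E\<in>Pow (g ` R). exp (\<Sum>i\<in>R. c i * edge_val E (g i))) = (\<Prod>e\<in>g ` R. exp (d e) + exp (- d e))"
    using assms by (simp add: sum_Pow_prod)
  also have "\<dots> = (\<Prod>i\<in>R. exp (c i) + exp (- c i))"
    using assms by (simp add: prod.reindex d)
  also have "\<dots> \<le> (\<Prod>i\<in>R. 2 * exp ((c i)\<^sup>2 / 2))"
    by (intro prod_mono conjI cosh_le_exp_half_square add_nonneg_nonneg) auto
  also have "\<dots> = 2 ^ card R * exp (\<Sum>i\<in>R. (c i)\<^sup>2 / 2)"
    using assms by (simp add: prod.distrib exp_sum)
  finally show ?thesis .
qed

lemma sum_Pow_Un: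
  assumes "X \<inter> D = {}"
  shows "(\<Sum>E\<in>Pow (X \<union> D). f E) = (\<Sum>E\<in>Pow X. \<Sum>F\<in>Pow D. f (E \<union> F))"
proof -
  have "(\<Sum>E\<in>Pow X. \<Sum>F\<in>Pow D. f (E \<union> F)) = (\<Sum>(E, F)\<in>Pow X \<times> Pow D. f (E \<union> F))"
    by (rule sum.cartesian_product)
  also have "\<dots> = (\<Sum>E\<in>Pow (X \<union> D). f E)"
    by (rule sum.reindex_bij_witness[of _ "\<lambda>E. (E \<inter> X, E \<inter> D)" "\<lambda>(E, F). E \<union> F"])
      (use assms in auto)
  finally show ?thesis ..
qed

text \<open>Averaging over the edges at one vertex \<open>t\<close> of \<open>T\<close> replaces \<open>\<theta>\<close> by \<open>\<theta> (1 + 2 \<theta> (z t)\<^sup>2)\<close>, since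
  \<open>cosh x \<le> exp (x\<^sup>2 / 2)\<close>; the error term \<open>2 (\<theta> U)\<^sup>2\<close> absorbs the growth of \<open>\<theta>\<close>, for both signs.\<close>

lemma square_mgf:
  fixes z :: "'a \<Rightarrow> real"
  assumes "finite T" and "finite R" and "finite X" and "T \<inter> R = {}"
    and "\<And>i j. i \<in> R \<Longrightarrow> j \<in> T \<Longrightarrow> {i, j} \<in> X"
    and "\<bar>\<theta>\<bar> * (\<Sum>j\<in>T. (z j)\<^sup>2) \<le> 1 / 8"
  shows "(\<Sum>E\<in>Pow X. exp (\<theta> * (\<Sum>i\<in>R. (\<Sum>j\<in>T. edge_val E {i, j} * z j)\<^sup>2))) \<le>
    2 ^ card X * exp (card R * (\<theta> * (\<Sum>j\<in>T. (z j)\<^sup>2) + 2 * (\<theta> * (\<Sum>j\<in>T. (z j)\<^sup>2))\<^sup>2))"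
  using assms
proof (induction T arbitrary: \<theta> X)
  case empty
  then show ?case using card_Pow[OF empty.prems(2)] by simp
next
  case (insert t T)
  \<comment> \<open>\<open>D\<close> consists of the edges between \<open>R\<close> and
    \<open>t\<close>. They are distinct and do not occur in the sums over \<open>T\<close>, so they
    can be averaged first, with the others fixed.\<close>
  define D where "D = (\<lambda>i. {i, t}) ` R"
  define X' where "X' = X - D"
  define U where "U = (\<Sum>j\<in>T. (z j)\<^sup>2)"
  define u where "u = z t"
  define \<mu> where "\<mu> = \<theta> * (1 + 2 * \<theta> * u\<^sup>2)"
  have U: "0 \<le> U" by (simp add: U_def sum_nonneg)
  have sumU: "(\<Sum>j\<in>insert t T. (z j)\<^sup>2) = u\<^sup>2 + U" using insert.hyps by (simp add: U_def u_def)
  have small: "\<bar>\<theta>\<bar> * (u\<^sup>2 + U) \<le> 1 / 8" using insert.prems(5) unfolding sumU .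
  have inj: "inj_on (\<lambda>i. {i, t}) R" using insert.prems(3) by (auto simp: inj_on_def doubleton_eq_iff)
  have D: "D \<subseteq> X" using insert.prems(4) by (auto simp: D_def)
  have X: "X = X' \<union> D" "X' \<inter> D = {}" using D by (auto simp: X'_def)
  have cardX: "card X = card X' + card R"
  proof -
    have "card D = card R" unfolding D_def by (rule card_image[OF inj])
    moreover have "finite X'" "finite D" using insert.prems by (auto simp: X'_def D_def)
    ultimately show ?thesis using X by (simp add: card_Un_disjoint)
  qed
  have notD: "{i, j} \<notin> D" if "i \<in> R" "j \<in> T" for i j
    using that insert.prems(3) insert.hyps by (auto simp: D_def doubleton_eq_iff)
  define Y where "Y E i = (\<Sum>j\<in>T. edge_val E {i, j} * z j)" for E i
  have Y: "(\<Sum>j\<in>insert t T. edge_val (E \<union> F) {i, j} * z j) = Y E i + edge_val F {i, t} * u"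
    if "E \<subseteq> X'" "F \<subseteq> D" "i \<in> R" for E F i
  proof -
    have "(\<Sum>j\<in>T. edge_val (E \<union> F) {i, j} * z j) = Y E i"
      unfolding Y_def using that notD by (intro sum.cong) (auto simp: edge_val_def)
    moreover have "{i, t} \<in> D" using that by (auto simp: D_def)
    then have "edge_val (E \<union> F) {i, t} = edge_val F {i, t}"
      using that by (auto simp: edge_val_def X'_def)
    ultimately show ?thesis using insert.hyps by (simp add: u_def)
  qed
  have inner: "(\<Sum>F\<in>Pow D. exp (\<theta> * (\<Sum>i\<in>R. (Y E i + edge_val F {i, t} * u)\<^sup>2))) \<le>
      2 ^ card R * (exp (card R * (\<theta> * u\<^sup>2)) * exp (\<mu> * (\<Sum>i\<in>R. (Y E i)\<^sup>2)))" for E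
  proof -
    have "(edge_val F {i, t})\<^sup>2 = 1" for F i by (simp add: edge_val_def)
    \<comment> \<open>Since signs square to 1, expanding leaves a constant, the sum for
      \<open>T\<close>, and a term linear in the fresh signs, to which \<open>rademacher_mgf\<close>
      applies.\<close>
    then have "\<theta> * (\<Sum>i\<in>R. (Y E i + edge_val F {i, t} * u)\<^sup>2) =
        card R * (\<theta> * u\<^sup>2) + \<theta> * (\<Sum>i\<in>R. (Y E i)\<^sup>2) + (\<Sum>i\<in>R. 2 * \<theta> * Y E i * u * edge_val F {i, t})" for F
      by (simp add: power2_sum power_mult_distrib sum.distrib sum_distrib_left distrib_left mult_ac)
    then have "(\<Sum>F\<in>Pow D. exp (\<theta> * (\<Sum>i\<in>R. (Y E i + edge_val F {i, t} * u)\<^sup>2))) =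
        exp (card R * (\<theta> * u\<^sup>2) + \<theta> * (\<Sum>i\<in>R. (Y E i)\<^sup>2)) *
        (\<Sum>F\<in>Pow D. exp (\<Sum>i\<in>R. 2 * \<theta> * Y E i * u * edge_val F {i, t}))"
      by (simp add: exp_add sum_distrib_left)
    also have "\<dots> \<le> exp (card R * (\<theta> * u\<^sup>2) + \<theta> * (\<Sum>i\<in>R. (Y E i)\<^sup>2)) *
        (2 ^ card R * exp (\<Sum>i\<in>R. (2 * \<theta> * Y E i * u)\<^sup>2 / 2))"
      unfolding D_def using insert.prems(1) by (intro mult_left_mono rademacher_mgf inj) auto
    also have "(\<Sum>i\<in>R. (2 * \<theta> * Y E i * u)\<^sup>2 / 2) = 2 * \<theta>\<^sup>2 * u\<^sup>2 * (\<Sum>i\<in>R. (Y E i)\<^sup>2)"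
      by (simp add: power_mult_distrib sum_distrib_left mult_ac)
    finally show ?thesis
      by (simp add: \<mu>_def exp_add[symmetric] algebra_simps power2_eq_square)
  qed
  have parts: "0 \<le> \<bar>\<theta>\<bar> * u\<^sup>2" "0 \<le> \<bar>\<theta>\<bar> * U" "\<bar>\<theta>\<bar> * u\<^sup>2 + \<bar>\<theta>\<bar> * U \<le> 1 / 8"
    using small U by (simp_all add: distrib_left)
  then have bu: "\<bar>\<theta>\<bar> * u\<^sup>2 \<le> 1 / 8" and bU: "\<bar>\<theta>\<bar> * U \<le> 1 / 8" by linarith+
  have \<mu>: "\<bar>\<mu>\<bar> * U \<le> 1 / 8"
  proof -
    have "\<bar>\<mu>\<bar> * U \<le> \<bar>\<theta>\<bar> * (1 + 2 * (\<bar>\<theta>\<bar> * u\<^sup>2)) * U"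
      unfolding \<mu>_def abs_mult using U
      by (intro mult_right_mono mult_left_mono order_trans[OF abs_triangle_ineq]) (auto simp: abs_mult)
    also have "\<dots> = \<bar>\<theta>\<bar> * U + 2 * (\<bar>\<theta>\<bar> * U) * (\<bar>\<theta>\<bar> * u\<^sup>2)" by (simp add: algebra_simps)
    also have "\<dots> \<le> \<bar>\<theta>\<bar> * U + 2 * (1 / 8) * (\<bar>\<theta>\<bar> * u\<^sup>2)"
      using parts(1) bU by (intro add_left_mono mult_right_mono mult_left_mono) auto
    finally show ?thesis using parts by linarith
  qed
  have "(\<Sum>E\<in>Pow X. exp (\<theta> * (\<Sum>i\<in>R. (\<Sum>j\<in>insert t T. edge_val E {i, j} * z j)\<^sup>2))) =
      (\<Sum>E\<in>Pow X'. \<Sum>F\<in>Pow D. exp (\<theta> * (\<Sum>i\<in>R. (Y E i + edge_val F {i, t} * u)\<^sup>2)))"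
    unfolding X(1) sum_Pow_Un[OF X(2)]
  proof (intro sum.cong refl)
    fix E F assume "E \<in> Pow X'" "F \<in> Pow D"
    then have "(\<Sum>i\<in>R. (\<Sum>j\<in>insert t T. edge_val (E \<union> F) {i, j} * z j)\<^sup>2) =
        (\<Sum>i\<in>R. (Y E i + edge_val F {i, t} * u)\<^sup>2)"
      by (intro sum.cong refl) (simp only: Y PowD)
    then show "exp (\<theta> * (\<Sum>i\<in>R. (\<Sum>j\<in>insert t T. edge_val (E \<union> F) {i, j} * z j)\<^sup>2)) =
        exp (\<theta> * (\<Sum>i\<in>R. (Y E i + edge_val F {i, t} * u)\<^sup>2))" by (simp only:)
  qed
  also have "\<dots> \<le> (\<Sum>E\<in>Pow X'. 2 ^ card R * (exp (card R * (\<theta> * u\<^sup>2)) * exp (\<mu> * (\<Sum>i\<in>R. (Y E i)\<^sup>2))))"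
    by (intro sum_mono inner)
  also have "\<dots> = 2 ^ card R * exp (card R * (\<theta> * u\<^sup>2)) * (\<Sum>E\<in>Pow X'. exp (\<mu> * (\<Sum>i\<in>R. (Y E i)\<^sup>2)))"
    by (simp add: sum_distrib_left mult.assoc)
  also have "\<dots> \<le> 2 ^ card R * exp (card R * (\<theta> * u\<^sup>2)) *
      (2 ^ card X' * exp (card R * (\<mu> * U + 2 * (\<mu> * U)\<^sup>2)))"
    unfolding Y_def U_def
  proof (intro mult_left_mono insert.IH)
    show "{i, j} \<in> X'" if "i \<in> R" "j \<in> T" for i j
      using that notD[OF that] insert.prems(4) by (auto simp: X'_def)
  qed (use insert.prems \<mu> in \<open>auto simp: X'_def U_def\<close>)
  also have "\<dots> = 2 ^ card X * exp (card R * (\<theta> * u\<^sup>2 + \<mu> * U + 2 * (\<mu> * U)\<^sup>2))"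
    by (simp add: cardX power_add exp_add[symmetric] algebra_simps)
  also have "\<theta> * u\<^sup>2 + \<mu> * U + 2 * (\<mu> * U)\<^sup>2 \<le> \<theta> * (u\<^sup>2 + U) + 2 * (\<theta> * (u\<^sup>2 + U))\<^sup>2"
  proof -
    define a b where "a = \<theta> * U" and "b = \<theta> * u\<^sup>2"
    have ab: "\<mu> * U = a * (1 + 2 * b)" "\<theta> * (u\<^sup>2 + U) = b + a"
      by (simp_all add: \<mu>_def a_def b_def algebra_simps)
    \<comment> \<open>This is half of what remains after expanding both sides of the claim. For
      nonnegative \<open>\<theta>\<close>, smallness bounds the left side by \<open>a * b\<close>;
      for negative \<open>\<theta>\<close>, the left side is at most 0 because
      \<open>-1 \<le> b \<le> 0\<close>.\<close>
    have key: "4 * a\<^sup>2 * b * (1 + b) \<le> a * b + b\<^sup>2"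
    proof (cases "0 \<le> \<theta>")
      case True
      then have pos: "0 \<le> a" "0 \<le> b" "a + b \<le> 1 / 8"
        using U small by (auto simp: a_def b_def algebra_simps)
      have "4 * a * (1 + b) \<le> 4 * (1 / 8) * (1 + 1)" using pos by (intro mult_mono) auto
      then have "(4 * a * (1 + b)) * (a * b) \<le> 1 * (a * b)" using pos by (intro mult_right_mono) auto
      moreover have "0 \<le> b\<^sup>2" by simp
      moreover have "4 * a\<^sup>2 * b * (1 + b) = (4 * a * (1 + b)) * (a * b)"
        by (simp add: power2_eq_square)
      ultimately show ?thesis by linarith
    next
      case False
      then have neg: "a \<le> 0" "b \<le> 0" "- b \<le> 1"
        using U bu by (auto simp: a_def b_def mult_nonpos_nonneg)
      have "a\<^sup>2 * (b * (1 + b)) \<le> 0" using neg by (intro mult_nonneg_nonpos mult_nonpos_nonneg) auto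
      moreover have "0 \<le> a * b" using neg by (simp add: mult_nonpos_nonpos)
      moreover have "0 \<le> b\<^sup>2" by simp
      moreover have "4 * a\<^sup>2 * b * (1 + b) = 4 * (a\<^sup>2 * (b * (1 + b)))" by simp
      ultimately show ?thesis by linarith
    qed
    then have "b + a * (1 + 2 * b) + 2 * (a * (1 + 2 * b))\<^sup>2 \<le> b + a + 2 * (b + a)\<^sup>2"
      by (simp add: power2_eq_square algebra_simps)
    then show ?thesis unfolding ab b_def[symmetric] .
  qed
  finally show ?case unfolding sumU by (simp add: mult_left_mono)
qed

text \<open>Markov's inequality for exp f, in counting form.\<close>

lemma card_exp_bound:
  assumes "finite A"
  shows "real (card {x \<in> A. t \<le> f x}) \<le> (\<Sum>x\<in>A. exp (f x)) * exp (- t)"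
proof -
  have "real (card {x \<in> A. t \<le> f x}) = (\<Sum>x\<in>{x \<in> A. t \<le> f x}. 1)" by simp
  also have "\<dots> \<le> (\<Sum>x\<in>{x \<in> A. t \<le> f x}. exp (f x - t))" by (intro sum_mono) auto
  also have "\<dots> \<le> (\<Sum>x\<in>A. exp (f x - t))" using assms by (intro sum_mono2) auto
  also have "\<dots> = (\<Sum>x\<in>A. exp (f x)) * exp (- t)" by (simp add: sum_distrib_right exp_add[symmetric])
  finally show ?thesis .
qed

section \<open>Tail bounds at a fixed vector\<close>

definition edges :: "nat \<Rightarrow> nat set set" where
  "edges n = {{u, v} | u v. u < n \<and> v < n \<and> u \<noteq> v}"

lemma graphs_eq_Pow: "graphs n = Pow (edges n)"
  by (simp add: graphs_def edges_def)

lemma finite_edges: "finite (edges n)"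
  using finite_graphs[of n] by (simp add: graphs_eq_Pow)

definition quad :: "nat \<Rightarrow> nat set set \<Rightarrow> (nat \<Rightarrow> real) \<Rightarrow> (nat \<Rightarrow> real) \<Rightarrow> real" where
  "quad n E u v = (\<Sum>i<n. \<Sum>j<n. edge_val E {i, j} * (u i * v j))"

definition row_val :: "nat \<Rightarrow> nat set set \<Rightarrow> (nat \<Rightarrow> real) \<Rightarrow> nat \<Rightarrow> real" where
  "row_val n E u i = (\<Sum>j<n. edge_val E {i, j} * u j)"

definition nsq :: "nat \<Rightarrow> (nat \<Rightarrow> real) \<Rightarrow> real" where
  "nsq n u = (\<Sum>i<n. (u i)\<^sup>2)"

definition supp :: "nat \<Rightarrow> (nat \<Rightarrow> real) \<Rightarrow> nat set" where
  "supp n u = {i. i < n \<and> u i \<noteq> 0}"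

lemma finite_supp: "finite (supp n u)"
  by (simp add: supp_def)

lemma supp_less: "i \<in> supp n u \<Longrightarrow> i < n"
  by (simp add: supp_def)

lemma nsq_nonneg: "0 \<le> nsq n u"
  by (simp add: nsq_def sum_nonneg)

lemma nsq_eq_0: "nsq n u = 0 \<Longrightarrow> i < n \<Longrightarrow> u i = 0"
  by (auto simp: nsq_def sum_nonneg_eq_0_iff)

lemma sum_supp: "(\<Sum>i\<in>supp n u. (u i)\<^sup>2) = nsq n u"
  unfolding nsq_def by (rule sum.mono_neutral_left) (auto simp: supp_def)

lemma row_val_supp: "row_val n E u i = (\<Sum>j\<in>supp n u. edge_val E {i, j} * u j)"
  unfolding row_val_def by (rule sum.mono_neutral_right) (auto simp: supp_def)

lemma quad_row_val: "quad n E u v = (\<Sum>i<n. u i * row_val n E v i)"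
  unfolding quad_def row_val_def by (simp add: sum_distrib_left mult_ac)

lemma quad_commute: "quad n E v u = quad n E u v"
  unfolding quad_def by (subst sum.swap) (simp add: insert_commute mult_ac)

lemma sum_symmetric:
  fixes h :: "nat \<Rightarrow> nat \<Rightarrow> real"
  assumes "\<And>i j. h i j = h j i"
  shows "(\<Sum>i<n. \<Sum>j<n. h i j) = (\<Sum>i<n. h i i) + 2 * (\<Sum>(j, i)\<in>(SIGMA j:{..<n}. {..<j}). h i j)"
proof (induction n)
  case (Suc n)
  have "(\<Sum>(j, i)\<in>(SIGMA j:{..<m}. {..<j}). h i j) = (\<Sum>j<m. \<Sum>i<j. h i j)" for m
    by (simp add: sum.Sigma)
  moreover have "(\<Sum>j<n. h n j) = (\<Sum>i<n. h i n)" using assms by simp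
  ultimately show ?case using Suc by (simp add: sum.distrib)
qed simp

text \<open>The pairs below the diagonal list every edge exactly once, which is what makes their
  signs independent.\<close>

lemma edges_image:
  "inj_on (\<lambda>(j, i). {i, j}) (SIGMA j:{..<n}. {..<j :: nat})"
  "(\<lambda>(j, i). {i, j}) ` (SIGMA j:{..<n}. {..<j}) = edges n"
proof -
  show "inj_on (\<lambda>(j, i). {i, j}) (SIGMA j:{..<n}. {..<j :: nat})"
    by (auto simp: inj_on_def doubleton_eq_iff)
  show "(\<lambda>(j, i). {i, j}) ` (SIGMA j:{..<n}. {..<j}) = edges n"
  proof (intro equalityI subsetI)
    fix e assume "e \<in> edges n"
    then obtain i j where "e = {i, j}" "i < n" "j < n" "i \<noteq> j" by (auto simp: edges_def)
    then have "(e = {i, j} \<and> (j, i) \<in> (SIGMA j:{..<n}. {..<j})) \<or>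
        (e = {j, i} \<and> (i, j) \<in> (SIGMA j:{..<n}. {..<j}))"
      by (auto simp: insert_commute)
    then show "e \<in> (\<lambda>(j, i). {i, j}) ` (SIGMA j:{..<n}. {..<j})" by force
  qed (fastforce simp: edges_def)
qed

definition offdiag :: "nat \<Rightarrow> nat set set \<Rightarrow> (nat \<Rightarrow> real) \<Rightarrow> real" where
  "offdiag n E z = (\<Sum>(j, i)\<in>(SIGMA j:{..<n}. {..<j}). edge_val E {i, j} * (z i * z j))"

lemma quad_offdiag:
  assumes "E \<in> graphs n"
  shows "quad n E z z = 2 * offdiag n E z - nsq n z"
proof -
  \<comment> \<open>The set \<open>{i, i}\<close> is a singleton and never an edge, so the diagonal
    is deterministic and contributes \<open>- nsq n z\<close>.\<close>
  have "edge_val E {i, i} = -1" if "i < n" for i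
    using assms that by (auto simp: graphs_eq_Pow edges_def edge_val_def)
  then have "(\<Sum>i<n. edge_val E {i, i} * (z i * z i)) = - nsq n z"
    by (simp add: nsq_def power2_eq_square sum_negf)
  then show ?thesis
    unfolding quad_def offdiag_def
    by (subst sum_symmetric) (simp_all add: insert_commute mult_ac)
qed

text \<open>The variance term is \<open>2 * x\<^sup>2\<close> times the sum of
  \<open>(z i * z j)\<^sup>2\<close> over pairs i < j, and twice that sum is at most
  \<open>(nsq n z)\<^sup>2\<close>.\<close>

lemma offdiag_mgf:
  "(\<Sum>E\<in>graphs n. exp (x * (2 * offdiag n E z))) \<le> 2 ^ card (edges n) * exp ((x * nsq n z)\<^sup>2)"
proof -
  define P where "P = (SIGMA j:{..<n}. {..<j :: nat})"
  define c where "c = (\<lambda>(j, i). 2 * x * (z i * z j))"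
  have fin: "finite P" by (simp add: P_def)
  have "x * (2 * offdiag n E z) = (\<Sum>p\<in>P. c p * edge_val E (case p of (j, i) \<Rightarrow> {i, j}))" for E
    unfolding offdiag_def P_def c_def sum_distrib_left by (intro sum.cong) auto
  then have "(\<Sum>E\<in>graphs n. exp (x * (2 * offdiag n E z))) \<le> 2 ^ card P * exp (\<Sum>p\<in>P. (c p)\<^sup>2 / 2)"
    using rademacher_mgf[OF fin edges_image(1)[of n, folded P_def], of c] edges_image(2)[of n, folded P_def]
    by (simp add: graphs_eq_Pow case_prod_beta)
  also have "card P = card (edges n)"
    using card_image[OF edges_image(1)[of n]] by (simp add: P_def edges_image(2))
  also have "(\<Sum>p\<in>P. (c p)\<^sup>2 / 2) \<le> (x * nsq n z)\<^sup>2"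
  proof -
    have "(nsq n z)\<^sup>2 = (\<Sum>i<n. \<Sum>j<n. (z i)\<^sup>2 * (z j)\<^sup>2)"
      by (simp add: nsq_def power2_eq_square sum_product)
    also have "\<dots> = (\<Sum>i<n. (z i)\<^sup>2 * (z i)\<^sup>2) + 2 * (\<Sum>(j, i)\<in>P. (z i)\<^sup>2 * (z j)\<^sup>2)"
      unfolding P_def by (rule sum_symmetric) simp
    finally have "2 * (\<Sum>(j, i)\<in>P. (z i)\<^sup>2 * (z j)\<^sup>2) \<le> (nsq n z)\<^sup>2"
      by (simp add: sum_nonneg)
    then have "x\<^sup>2 * (2 * (\<Sum>(j, i)\<in>P. (z i)\<^sup>2 * (z j)\<^sup>2)) \<le> x\<^sup>2 * (nsq n z)\<^sup>2"
      by (intro mult_left_mono) auto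
    moreover have "(\<Sum>p\<in>P. (c p)\<^sup>2 / 2) = x\<^sup>2 * (2 * (\<Sum>(j, i)\<in>P. (z i)\<^sup>2 * (z j)\<^sup>2))"
      unfolding c_def sum_distrib_left by (intro sum.cong) (auto simp: power_mult_distrib)
    ultimately show ?thesis by (simp add: power_mult_distrib)
  qed
  finally show ?thesis by (simp add: mult_left_mono)
qed

text \<open>The 1 in \<open>1 + t\<close> pays for the diagonal. With Z for \<open>nsq n z\<close>,
  the exponent \<open>(x * Z)\<^sup>2 - x * t * Z\<close> is least at
  \<open>x = t / (2 * Z)\<close>, where it equals \<open>- t\<^sup>2 / 4\<close>; the opposite x
  serves the lower tail.\<close>

lemma quad_tail:
  assumes "0 \<le> t"
  shows "real (card {E \<in> graphs n. (1 + t) * nsq n z < \<bar>quad n E z z\<bar>}) \<le>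
    2 * (2 ^ card (edges n) * exp (- t\<^sup>2 / 4))"
proof (cases "nsq n z = 0")
  case True
  then have "quad n E z z = 0" for E
    unfolding quad_def using nsq_eq_0[OF True] by (intro sum.neutral ballI) auto
  then show ?thesis using True by simp
next
  case False
  define Z where "Z = nsq n z"
  have Z: "0 < Z" using False nsq_nonneg[of n z] by (simp add: Z_def)
  define A where "A x = {E \<in> graphs n. t\<^sup>2 / 2 \<le> x * (2 * offdiag n E z)}" for x
  have A: "real (card (A x)) \<le> 2 ^ card (edges n) * exp (- t\<^sup>2 / 4)" if "(x * Z)\<^sup>2 = t\<^sup>2 / 4" for x
  proof -
    have "real (card (A x)) \<le> (\<Sum>E\<in>graphs n. exp (x * (2 * offdiag n E z))) * exp (- (t\<^sup>2 / 2))"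
      unfolding A_def by (rule card_exp_bound[OF finite_graphs])
    also have "\<dots> \<le> 2 ^ card (edges n) * exp (t\<^sup>2 / 4) * exp (- (t\<^sup>2 / 2))"
      using offdiag_mgf[of x n z] unfolding that[unfolded Z_def] by simp
    also have "\<dots> = 2 ^ card (edges n) * exp (- t\<^sup>2 / 4)"
      by (simp add: exp_add[symmetric] mult.assoc)
    finally show ?thesis .
  qed
  have "{E \<in> graphs n. (1 + t) * nsq n z < \<bar>quad n E z z\<bar>} \<subseteq> A (t / (2 * Z)) \<union> A (- (t / (2 * Z)))"
  proof
    fix E assume E: "E \<in> {E \<in> graphs n. (1 + t) * nsq n z < \<bar>quad n E z z\<bar>}"
    then have "(1 + t) * Z < \<bar>2 * offdiag n E z - Z\<bar>" by (auto simp: quad_offdiag Z_def)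
    then have "t * Z \<le> \<bar>2 * offdiag n E z\<bar>" using Z by (simp add: algebra_simps abs_if split: if_splits)
    then have "t / (2 * Z) * (t * Z) \<le> t / (2 * Z) * \<bar>2 * offdiag n E z\<bar>"
      using assms Z by (intro mult_left_mono) auto
    moreover have "t / (2 * Z) * (t * Z) = t\<^sup>2 / 2" using Z by (simp add: power2_eq_square field_simps)
    ultimately have "t\<^sup>2 / 2 \<le> t / (2 * Z) * \<bar>2 * offdiag n E z\<bar>" by (simp only:)
    moreover have "t / (2 * Z) * \<bar>2 * offdiag n E z\<bar> = t / (2 * Z) * (2 * offdiag n E z) \<or>
        t / (2 * Z) * \<bar>2 * offdiag n E z\<bar> = - (t / (2 * Z)) * (2 * offdiag n E z)"
      by (cases "0 \<le> offdiag n E z") simp_all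
    ultimately show "E \<in> A (t / (2 * Z)) \<union> A (- (t / (2 * Z)))"
      using E unfolding A_def by (metis (no_types, lifting) UnCI mem_Collect_eq)
  qed
  then have "card {E \<in> graphs n. (1 + t) * nsq n z < \<bar>quad n E z z\<bar>} \<le>
      card (A (t / (2 * Z))) + card (A (- (t / (2 * Z))))"
    by (intro order_trans[OF card_mono card_Un_le]) (auto simp: A_def finite_graphs)
  moreover have "(t / (2 * Z) * Z)\<^sup>2 = t\<^sup>2 / 4" "(- (t / (2 * Z)) * Z)\<^sup>2 = t\<^sup>2 / 4"
    using Z by (simp_all add: power_divide)
  ultimately show ?thesis using A[of "t / (2 * Z)"] A[of "- (t / (2 * Z))"] by linarith
qed

text \<open>Each square is centred: its mean over the random signs is
  \<open>nsq n z\<close>.\<close>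

definition outer_rows :: "nat \<Rightarrow> nat set set \<Rightarrow> (nat \<Rightarrow> real) \<Rightarrow> real" where
  "outer_rows n E z = (\<Sum>i\<in>{..<n} - supp n z. (row_val n E z i)\<^sup>2 - nsq n z)"

text \<open>Apply \<open>square_mgf\<close> with the support as \<open>T\<close> and its complement
  as \<open>R\<close>. The centring removes the linear term, leaving
  \<open>2 * (x * nsq n z)\<^sup>2\<close> per row.\<close>

lemma outer_rows_mgf:
  assumes "\<bar>x\<bar> * nsq n z \<le> 1 / 8"
  shows "(\<Sum>E\<in>graphs n. exp (x * outer_rows n E z)) \<le> 2 ^ card (edges n) * exp (2 * n * (x * nsq n z)\<^sup>2)"
proof -
  define R where "R = {..<n} - supp n z"
  define S where "S E = (\<Sum>i\<in>R. (\<Sum>j\<in>supp n z. edge_val E {i, j} * z j)\<^sup>2)" for E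
  have "card R \<le> card {..<n}" by (intro card_mono) (auto simp: R_def)
  then have R: "card R \<le> n" by simp
  have "(\<Sum>E\<in>graphs n. exp (x * outer_rows n E z)) = (\<Sum>E\<in>graphs n. exp (x * S E)) * exp (- (card R * (x * nsq n z)))"
    by (simp add: outer_rows_def row_val_supp R_def[symmetric] S_def sum_subtractf
        right_diff_distrib exp_diff exp_minus sum_distrib_right sum_distrib_left divide_inverse mult_ac)
  also have "\<dots> \<le> 2 ^ card (edges n) * exp (card R * (x * nsq n z + 2 * (x * nsq n z)\<^sup>2)) *
      exp (- (card R * (x * nsq n z)))"
    unfolding graphs_eq_Pow S_def sum_supp[symmetric]
    by (intro mult_right_mono square_mgf)
      (use assms[folded sum_supp] finite_supp finite_edges in \<open>auto simp: R_def edges_def dest: supp_less\<close>)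
  also have "\<dots> = 2 ^ card (edges n) * exp (card R * (2 * (x * nsq n z)\<^sup>2))"
    by (simp add: mult.assoc exp_add[symmetric] algebra_simps)
  also have "\<dots> \<le> 2 ^ card (edges n) * exp (n * (2 * (x * nsq n z)\<^sup>2))"
    using R by (simp add: mult_right_mono)
  finally show ?thesis by (simp add: mult_ac)
qed

text \<open>The exponent \<open>2 * n * \<tau>\<^sup>2 - \<tau> * t\<close> is least at
  \<open>\<tau> = t / (4 * n)\<close>. The assumption \<open>t \<le> n / 2\<close> is the smallness
  \<open>\<tau> \<le> 1 / 8\<close> required by \<open>outer_rows_mgf\<close>.\<close>

lemma outer_rows_tail:
  assumes "0 \<le> t" "t \<le> n / 2"
  shows "real (card {E \<in> graphs n. t * nsq n z < \<bar>outer_rows n E z\<bar>}) \<le>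
    2 * (2 ^ card (edges n) * exp (- t\<^sup>2 / (8 * real n)))"
proof (cases "nsq n z = 0")
  case True
  then have "row_val n E z i = 0" for E i
    unfolding row_val_def using nsq_eq_0[OF True] by (intro sum.neutral ballI) auto
  then show ?thesis using True by (simp add: outer_rows_def)
next
  case False
  define Z where "Z = nsq n z"
  have Z: "0 < Z" using False nsq_nonneg[of n z] by (simp add: Z_def)
  have n: "0 < n" using False by (cases n) (auto simp: nsq_def)
  define \<tau> where "\<tau> = t / (4 * n)"
  have \<tau>: "0 \<le> \<tau>" "\<tau> \<le> 1 / 8" using assms n by (auto simp: \<tau>_def field_simps)
  define A where "A x = {E \<in> graphs n. \<tau> * t \<le> x * outer_rows n E z}" for x
  have A: "real (card (A x)) \<le> 2 ^ card (edges n) * exp (- t\<^sup>2 / (8 * real n))" if "\<bar>x\<bar> * Z = \<tau>" for x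
  proof -
    have "(x * Z)\<^sup>2 = (\<bar>x\<bar> * Z)\<^sup>2" by (simp add: power_mult_distrib)
    then have sq: "(x * nsq n z)\<^sup>2 = \<tau>\<^sup>2" using that by (simp add: Z_def)
    have "real (card (A x)) \<le> (\<Sum>E\<in>graphs n. exp (x * outer_rows n E z)) * exp (- (\<tau> * t))"
      unfolding A_def by (rule card_exp_bound[OF finite_graphs])
    also have "\<dots> \<le> 2 ^ card (edges n) * exp (2 * n * \<tau>\<^sup>2) * exp (- (\<tau> * t))"
      using outer_rows_mgf[of x n z] that \<tau> unfolding sq by (intro mult_right_mono) (auto simp: Z_def)
    also have "\<dots> = 2 ^ card (edges n) * exp (2 * n * \<tau>\<^sup>2 - \<tau> * t)"
      by (simp add: exp_diff exp_minus divide_inverse)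
    also have "2 * n * \<tau>\<^sup>2 - \<tau> * t = - t\<^sup>2 / (8 * real n)"
      using n by (simp add: \<tau>_def power2_eq_square field_simps)
    finally show ?thesis .
  qed
  have "{E \<in> graphs n. t * nsq n z < \<bar>outer_rows n E z\<bar>} \<subseteq> A (\<tau> / Z) \<union> A (- (\<tau> / Z))"
  proof
    fix E assume E: "E \<in> {E \<in> graphs n. t * nsq n z < \<bar>outer_rows n E z\<bar>}"
    then have "\<tau> / Z * (t * Z) \<le> \<tau> / Z * \<bar>outer_rows n E z\<bar>"
      using \<tau> Z by (intro mult_left_mono) (auto simp: Z_def)
    moreover have "\<tau> / Z * (t * Z) = \<tau> * t" using Z by simp
    ultimately show "E \<in> A (\<tau> / Z) \<union> A (- (\<tau> / Z))"
      using E by (auto simp: A_def abs_if split: if_splits)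
  qed
  then have "card {E \<in> graphs n. t * nsq n z < \<bar>outer_rows n E z\<bar>} \<le> card (A (\<tau> / Z)) + card (A (- (\<tau> / Z)))"
    by (intro order_trans[OF card_mono card_Un_le]) (auto simp: A_def finite_graphs)
  moreover have "\<bar>\<tau> / Z\<bar> * Z = \<tau>" "\<bar>- (\<tau> / Z)\<bar> * Z = \<tau>" using Z \<tau> by simp_all
  ultimately show ?thesis using A[of "\<tau> / Z"] A[of "- (\<tau> / Z)"] by linarith
qed

text \<open>The indexing of sparse integer vectors by \<open>k\<close> positions with values is redundant, but makes them
  easy to count.\<close>

definition grid :: "nat \<Rightarrow> nat \<Rightarrow> nat \<Rightarrow> (nat \<Rightarrow> nat \<times> int) set" where
  "grid k n M = {..<k} \<rightarrow>\<^sub>E ({..<n} \<times> {- int M..int M})"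

definition grid_vec :: "nat \<Rightarrow> (nat \<Rightarrow> nat \<times> int) \<Rightarrow> nat \<Rightarrow> real" where
  "grid_vec k f i = (\<Sum>l<k. if fst (f l) = i then of_int (snd (f l)) else 0)"

lemma finite_grid: "finite (grid k n M)"
  unfolding grid_def by (intro finite_PiE) auto

lemma card_grid: "card (grid k n M) = (n * (2 * M + 1)) ^ k"
proof -
  have "card {- int M..int M} = 2 * M + 1" by simp
  then show ?thesis by (simp add: grid_def card_PiE card_cartesian_product)
qed

lemma grid_vec_surj:
  assumes "card (supp n u) \<le> k" and "0 < n"
    and "\<And>i. i < n \<Longrightarrow> u i = of_int (w i)" and "\<And>i. i < n \<Longrightarrow> \<bar>w i\<bar> \<le> int M"
  shows "\<exists>f\<in>grid k n M. \<forall>i<n. grid_vec k f i = u i"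
proof -
  obtain h where h: "bij_betw h {..<card (supp n u)} (supp n u)"
    using ex_bij_betw_nat_finite[OF finite_supp] by (auto simp: atLeast0LessThan)
  define c where "c = card (supp n u)"
  \<comment> \<open>Slots beyond the support carry \<open>(0, 0)\<close>: position 0 is legal as n
    is positive, and the value 0 adds nothing.\<close>
  define f where "f = (\<lambda>l\<in>{..<k}. if l < c then (h l, w (h l)) else (0, 0))"
  have hl: "h l < n" if "l < c" for l
    using h that by (auto simp: bij_betw_def c_def supp_def)
  have "f \<in> grid k n M"
    unfolding grid_def f_def using hl assms(2,4) by (auto simp: abs_le_iff minus_le_iff)
  moreover have "grid_vec k f i = u i" if "i < n" for i
  proof -
    have "grid_vec k f i = (\<Sum>l<k. if l < c then (if h l = i then of_int (w (h l)) else 0) else 0)"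
      unfolding grid_vec_def f_def by (intro sum.cong) auto
    also have "\<dots> = (\<Sum>l<c. if h l = i then of_int (w (h l)) else 0)"
      using assms(1) by (intro sum.mono_neutral_cong_right) (auto simp: c_def)
    also have "\<dots> = (\<Sum>l<c. if h l = i then u (h l) else 0)"
      using hl assms(3) by (intro sum.cong) auto
    also have "\<dots> = (\<Sum>j\<in>supp n u. if j = i then u j else 0)"
      using h by (intro sum.reindex_bij_betw) (simp add: c_def)
    also have "\<dots> = u i" using that by (simp add: finite_supp) (simp add: supp_def)
    finally show ?thesis .
  qed
  ultimately show ?thesis by blast
qed

text \<open>Scale \<open>u\<close> to a unit vector and round it to multiples of
  \<open>1 / M\<close>. Each coordinate moves by at most \<open>1 / M\<close>, so each of the
  \<open>n\<^sup>2\<close> terms changes by at most \<open>2 * C / M\<close>. The grid bound is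
  homogeneous, hence can be assumed for integer vectors.\<close>

lemma grid_transfer:
  fixes c :: "nat \<Rightarrow> nat \<Rightarrow> real"
  assumes "0 < n" and "0 < M" and c: "\<And>i j. i < n \<Longrightarrow> j < n \<Longrightarrow> \<bar>c i j\<bar> \<le> C" and "0 \<le> K"
    and grid: "\<And>f. f \<in> grid k n M \<Longrightarrow>
      \<bar>\<Sum>i<n. \<Sum>j<n. c i j * (grid_vec k f i * grid_vec k f j)\<bar> \<le> K * nsq n (grid_vec k f)"
    and sparse: "card (supp n u) \<le> k"
  shows "\<bar>\<Sum>i<n. \<Sum>j<n. c i j * (u i * u j)\<bar> \<le> (K + 2 * C * (real n)\<^sup>2 / real M) * nsq n u"
proof (cases "nsq n u = 0")
  case True
  then have "(\<Sum>i<n. \<Sum>j<n. c i j * (u i * u j)) = 0"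
    using nsq_eq_0[OF True] by (intro sum.neutral ballI) auto
  then show ?thesis using True by simp
next
  case False
  then have pos: "0 < nsq n u" using nsq_nonneg[of n u] by simp
  define r where "r = sqrt (nsq n u)"
  have r: "0 < r" "r\<^sup>2 = nsq n u" using pos by (auto simp: r_def)
  define v where "v i = u i / r" for i
  have nv: "nsq n v = 1" using r pos by (simp add: nsq_def v_def power_divide sum_divide_distrib[symmetric])
  have v1: "\<bar>v i\<bar> \<le> 1" if "i < n" for i
  proof -
    have "(v i)\<^sup>2 \<le> nsq n v" unfolding nsq_def using that by (intro member_le_sum) auto
    then show ?thesis using nv by (simp add: abs_square_le_1)
  qed
  \<comment> \<open>Rounding towards zero enlarges neither the support nor any absolute value; the
    floor of a negative coordinate could increase the norm.\<close>
  define w where "w i = (if 0 \<le> v i then \<lfloor>M * v i\<rfloor> else \<lceil>M * v i\<rceil>)" for i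
  define y where "y i = of_int (w i) / M" for i
  have w: "\<bar>of_int (w i)\<bar> \<le> M * \<bar>v i\<bar>" "\<bar>M * v i - of_int (w i)\<bar> \<le> 1" for i
  proof -
    show "\<bar>of_int (w i)\<bar> \<le> M * \<bar>v i\<bar>"
    proof (cases "0 \<le> v i")
      case True
      then have "0 \<le> M * v i" by simp
      then have "0 \<le> \<lfloor>M * v i\<rfloor>" by simp
      then show ?thesis using True by (simp add: w_def)
    next
      case F: False
      then have "M * v i \<le> 0" by (simp add: mult_nonneg_nonpos)
      then have "\<lceil>M * v i\<rceil> \<le> 0" by (simp add: ceiling_le_iff)
      then have "\<bar>real_of_int \<lceil>M * v i\<rceil>\<bar> = - of_int \<lceil>M * v i\<rceil>" by simp
      then show ?thesis using F le_of_int_ceiling[of "M * v i"] by (simp add: w_def)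
    qed
    show "\<bar>M * v i - of_int (w i)\<bar> \<le> 1"
      unfolding w_def by (simp add: abs_le_iff) linarith
  qed
  have y: "\<bar>y i\<bar> \<le> \<bar>v i\<bar>" "\<bar>v i - y i\<bar> \<le> 1 / M" for i
  proof -
    show "\<bar>y i\<bar> \<le> \<bar>v i\<bar>" using w(1)[of i] assms(2) by (simp add: y_def field_simps)
    have "v i - y i = (M * v i - of_int (w i)) / M"
      using assms(2) by (simp add: y_def diff_divide_distrib)
    then have "\<bar>v i - y i\<bar> = \<bar>M * v i - of_int (w i)\<bar> / M" by (simp add: abs_divide)
    also have "\<dots> \<le> 1 / M" using w(2)[of i] by (intro divide_right_mono) auto
    finally show "\<bar>v i - y i\<bar> \<le> 1 / M" .
  qed
  have "\<exists>f\<in>grid k n M. \<forall>i<n. grid_vec k f i = real_of_int (w i)"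
  proof (rule grid_vec_surj)
    have "supp n (\<lambda>i. real_of_int (w i)) \<subseteq> supp n u"
      by (auto simp: supp_def w_def v_def)
    then show "card (supp n (\<lambda>i. real_of_int (w i))) \<le> k"
      using sparse card_mono[OF finite_supp] order_trans by blast
    fix i assume "i < n"
    then have "real M * \<bar>v i\<bar> \<le> real M * 1" using v1 by (intro mult_left_mono) auto
    then have "\<bar>real_of_int (w i)\<bar> \<le> M" using w(1)[of i] by simp
    then show "\<bar>w i\<bar> \<le> int M" by linarith
  qed (use assms(1) in auto)
  then obtain f where f: "f \<in> grid k n M" "\<And>i. i < n \<Longrightarrow> grid_vec k f i = M * y i"
    using assms(2) by (auto simp: y_def)
  have "(\<Sum>i<n. \<Sum>j<n. c i j * (grid_vec k f i * grid_vec k f j)) = M\<^sup>2 * (\<Sum>i<n. \<Sum>j<n. c i j * (y i * y j))"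
    using f(2) by (simp add: sum_distrib_left power2_eq_square mult_ac)
  moreover have "nsq n (grid_vec k f) = M\<^sup>2 * nsq n y"
    using f(2) by (simp add: nsq_def sum_distrib_left power_mult_distrib)
  ultimately have "M\<^sup>2 * \<bar>\<Sum>i<n. \<Sum>j<n. c i j * (y i * y j)\<bar> \<le> M\<^sup>2 * (K * nsq n y)"
    using grid[OF f(1)] by (simp add: abs_mult mult_ac)
  then have "\<bar>\<Sum>i<n. \<Sum>j<n. c i j * (y i * y j)\<bar> \<le> K * nsq n y"
    using assms(2) by (simp add: mult_le_cancel_left)
  also have "\<dots> \<le> K * 1"
  proof (intro mult_left_mono assms(4))
    have "nsq n y \<le> nsq n v" unfolding nsq_def using y(1) by (intro sum_mono) (simp add: abs_le_square_iff[symmetric])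
    then show "nsq n y \<le> 1" using nv by simp
  qed
  finally have Ky: "\<bar>\<Sum>i<n. \<Sum>j<n. c i j * (y i * y j)\<bar> \<le> K" by simp
  have "\<bar>(\<Sum>i<n. \<Sum>j<n. c i j * (v i * v j)) - (\<Sum>i<n. \<Sum>j<n. c i j * (y i * y j))\<bar> =
      \<bar>\<Sum>i<n. \<Sum>j<n. c i j * (v i * v j - y i * y j)\<bar>"
    by (simp add: sum_subtractf right_diff_distrib)
  also have "\<dots> \<le> (\<Sum>i<n. \<Sum>j<n. C * (2 / M))"
  proof (intro order_trans[OF sum_abs] sum_mono)
    fix i j assume ij: "i \<in> {..<n}" "j \<in> {..<n}"
    have "v i * v j - y i * y j = v i * (v j - y j) + y j * (v i - y i)" by (simp add: algebra_simps)
    then have "\<bar>v i * v j - y i * y j\<bar> \<le> \<bar>v i\<bar> * \<bar>v j - y j\<bar> + \<bar>y j\<bar> * \<bar>v i - y i\<bar>"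
      by (metis abs_mult abs_triangle_ineq)
    also have "\<dots> \<le> 1 * (1 / M) + 1 * (1 / M)"
      using ij v1[of i] v1[of j] y[of i] y[of j] by (intro add_mono mult_mono) auto
    finally have "\<bar>v i * v j - y i * y j\<bar> \<le> 2 / M" by simp
    then show "\<bar>c i j * (v i * v j - y i * y j)\<bar> \<le> C * (2 / M)"
      unfolding abs_mult using c[of i j] ij by (intro mult_mono) auto
  qed
  also have "\<dots> = 2 * C * (real n)\<^sup>2 / real M" by (simp add: power2_eq_square)
  finally have "\<bar>\<Sum>i<n. \<Sum>j<n. c i j * (v i * v j)\<bar> \<le> K + 2 * C * (real n)\<^sup>2 / real M" using Ky by linarith
  then have "r\<^sup>2 * \<bar>\<Sum>i<n. \<Sum>j<n. c i j * (v i * v j)\<bar> \<le> r\<^sup>2 * (K + 2 * C * (real n)\<^sup>2 / real M)"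
    by (intro mult_left_mono) auto
  moreover have "(\<Sum>i<n. \<Sum>j<n. c i j * (u i * u j)) = r\<^sup>2 * (\<Sum>i<n. \<Sum>j<n. c i j * (v i * v j))"
    using r(1) by (simp add: v_def sum_distrib_left power2_eq_square)
  ultimately show ?thesis by (simp add: abs_mult r(2) mult_ac nsq_nonneg)
qed

text \<open>Four times the bilinear form is the difference of the quadratic form at
  \<open>u + v\<close> and \<open>u - v\<close>; the parallelogram law adds up their squared norms.
  Both vectors are supported in the union of the supports.\<close>

lemma quad_polarization:
  assumes quad: "\<And>x. card (supp n x) \<le> k \<Longrightarrow> \<bar>quad n E x x\<bar> \<le> c * nsq n x"
    and "card (supp n u \<union> supp n v) \<le> k"
  shows "\<bar>quad n E u v\<bar> \<le> c * (nsq n u + nsq n v) / 2"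
proof -
  have "supp n (\<lambda>i. u i + v i) \<subseteq> supp n u \<union> supp n v" "supp n (\<lambda>i. u i - v i) \<subseteq> supp n u \<union> supp n v"
    by (auto simp: supp_def)
  then have "card (supp n (\<lambda>i. u i + v i)) \<le> k" "card (supp n (\<lambda>i. u i - v i)) \<le> k"
    using assms(2) card_mono finite_UnI[OF finite_supp finite_supp] order_trans by metis+
  note bounds = this[THEN quad]
  have "quad n E v u = quad n E u v" by (rule quad_commute)
  then have "4 * quad n E u v = quad n E (\<lambda>i. u i + v i) (\<lambda>i. u i + v i) - quad n E (\<lambda>i. u i - v i) (\<lambda>i. u i - v i)"
    by (simp add: quad_def algebra_simps sum.distrib sum_subtractf)
  moreover have "nsq n (\<lambda>i. u i + v i) + nsq n (\<lambda>i. u i - v i) = 2 * (nsq n u + nsq n v)"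
    by (simp add: nsq_def power2_eq_square algebra_simps sum.distrib sum_subtractf)
  then have "c * nsq n (\<lambda>i. u i + v i) + c * nsq n (\<lambda>i. u i - v i) = c * (2 * (nsq n u + nsq n v))"
    by (simp only: distrib_left[symmetric])
  ultimately show ?thesis using bounds by linarith
qed

text \<open>Let V be the left side and Z the squared norm of \<open>z\<close>. Testing A z against
  its own restriction to the support of \<open>z\<close>, divided by c, gives V / c <= (V / c + c Z)
  / 2 by polarization, hence V <= c^2 Z. No support larger than that of \<open>z\<close> is
  involved.\<close>

lemma inner_rows_bound:
  assumes quad: "\<And>x. card (supp n x) \<le> k \<Longrightarrow> \<bar>quad n E x x\<bar> \<le> c * nsq n x"
    and "0 < c" and "card (supp n z) \<le> k"
  shows "(\<Sum>i\<in>supp n z. (row_val n E z i)\<^sup>2) \<le> c\<^sup>2 * nsq n z"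
proof -
  define v where "v i = (if i \<in> supp n z then row_val n E z i / c else 0)" for i
  define V where "V = (\<Sum>i\<in>supp n z. (row_val n E z i)\<^sup>2)"
  have "supp n v \<union> supp n z = supp n z" by (auto simp: supp_def v_def)
  then have "quad n E v z \<le> c * (nsq n v + nsq n z) / 2"
    using assms(3) by (intro abs_le_D1[OF quad_polarization[of n k]]) (auto intro: quad)
  moreover have "quad n E v z = (\<Sum>i\<in>supp n z. (row_val n E z i)\<^sup>2 / c)"
    unfolding quad_row_val by (rule sum.mono_neutral_cong_right) (auto simp: v_def supp_def power2_eq_square)
  then have "quad n E v z = V / c" by (simp add: V_def sum_divide_distrib)
  moreover have "nsq n v = (\<Sum>i\<in>supp n z. (row_val n E z i)\<^sup>2 / c\<^sup>2)"
    unfolding nsq_def by (rule sum.mono_neutral_cong_right) (auto simp: v_def supp_def power_divide)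
  then have "nsq n v = V / c\<^sup>2" by (simp add: V_def sum_divide_distrib)
  ultimately have "V / c \<le> c * (V / c\<^sup>2 + nsq n z) / 2" by (simp only:)
  then show ?thesis unfolding V_def[symmetric]
    using assms(2) by (simp add: field_simps power2_eq_square)
qed

definition concentrated :: "nat \<Rightarrow> nat \<Rightarrow> nat set set \<Rightarrow> real \<Rightarrow> bool" where
  "concentrated n k E \<eta> \<longleftrightarrow> (\<forall>u. card (supp n u) \<le> k \<longrightarrow>
     \<bar>quad n E u u\<bar> \<le> (\<eta> * sqrt n + 3) * nsq n u \<and>
     \<bar>(\<Sum>i<n. (row_val n E u i)\<^sup>2) - n * nsq n u\<bar> \<le> (\<eta> * n + k + (\<eta> * sqrt n + 3)\<^sup>2 + 4) * nsq n u)"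

lemma concentrated_if_grid:
  assumes n: "0 < n" and \<eta>: "0 \<le> \<eta>"
    and quad: "\<And>f. f \<in> grid k n (n ^ 3) \<Longrightarrow>
      \<bar>quad n E (grid_vec k f) (grid_vec k f)\<bar> \<le> (1 + \<eta> * sqrt n) * nsq n (grid_vec k f)"
    and outer: "\<And>f. f \<in> grid k n (n ^ 3) \<Longrightarrow>
      \<bar>outer_rows n E (grid_vec k f)\<bar> \<le> \<eta> * n * nsq n (grid_vec k f)"
  shows "concentrated n k E \<eta>"
proof -
  \<comment> \<open>The grid width \<open>n ^ 3\<close> is chosen for this: the rounding errors 2
    and 4 are constants, for coefficients bounded by 1 and by \<open>2 * n\<close>. In
    \<open>concentrated\<close>, the 3 is this 2 plus 1 for the diagonal.\<close>
  have M: "2 * 1 * (real n)\<^sup>2 / real (n ^ 3) \<le> 2" "2 * (2 * real n) * (real n)\<^sup>2 / real (n ^ 3) \<le> 4"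
    using n by (simp_all add: power2_eq_square power3_eq_cube divide_le_eq)
  define c where "c = \<eta> * sqrt n + 3"
  have c: "0 < c" using \<eta> by (simp add: c_def add_nonneg_pos)
  have quad': "\<bar>quad n E u u\<bar> \<le> c * nsq n u" if "card (supp n u) \<le> k" for u
  proof -
    have "\<bar>quad n E u u\<bar> \<le> ((1 + \<eta> * sqrt n) + 2 * 1 * (real n)\<^sup>2 / real (n ^ 3)) * nsq n u"
      unfolding quad_def
      by (rule grid_transfer[OF n]) (use n \<eta> quad that in \<open>auto simp: quad_def edge_val_def\<close>)
    also have "\<dots> \<le> c * nsq n u"
      using M(1) by (intro mult_right_mono nsq_nonneg) (simp add: c_def)
    finally show ?thesis .
  qed
  \<comment> \<open>The entries of A^T A - n I, so that \<open>grid_transfer\<close> also covers the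
    squared norm of A u.\<close>
  define d where "d j l = (\<Sum>i<n. edge_val E {i, j} * edge_val E {i, l}) - (if j = l then real n else 0)" for j l
  have "(\<Sum>j<n. \<Sum>l<n. d j l * (u j * u l)) = (\<Sum>i<n. (row_val n E u i)\<^sup>2) - n * nsq n u" for u
  proof -
    have "(\<Sum>i<n. (row_val n E u i)\<^sup>2) =
        (\<Sum>i<n. \<Sum>j<n. \<Sum>l<n. edge_val E {i, j} * edge_val E {i, l} * (u j * u l))"
      by (simp add: row_val_def power2_eq_square sum_product mult_ac)
    also have "\<dots> = (\<Sum>j<n. \<Sum>i<n. \<Sum>l<n. edge_val E {i, j} * edge_val E {i, l} * (u j * u l))"
      by (rule sum.swap)
    also have "\<dots> = (\<Sum>j<n. \<Sum>l<n. \<Sum>i<n. edge_val E {i, j} * edge_val E {i, l} * (u j * u l))"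
      by (rule sum.cong[OF refl sum.swap])
    finally have "(\<Sum>i<n. (row_val n E u i)\<^sup>2) =
        (\<Sum>j<n. \<Sum>l<n. (\<Sum>i<n. edge_val E {i, j} * edge_val E {i, l}) * (u j * u l))"
      by (simp add: sum_distrib_right)
    moreover have "(\<Sum>j<n. \<Sum>l<n. (if j = l then real n else 0) * (u j * u l)) = n * nsq n u"
      by (simp add: nsq_def if_distrib[of "\<lambda>x. x * _"] power2_eq_square sum_distrib_left cong: if_cong)
    ultimately show ?thesis by (simp add: d_def left_diff_distrib sum_subtractf)
  qed
  note rows_quad = this
  have d: "\<bar>d j l\<bar> \<le> 2 * real n" for j l
  proof -
    have "\<bar>\<Sum>i<n. edge_val E {i, j} * edge_val E {i, l}\<bar> \<le> (\<Sum>i<n. 1)"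
      by (intro order_trans[OF sum_abs] sum_mono) (simp add: edge_val_def)
    then show ?thesis by (auto simp: d_def abs_le_iff)
  qed
  have rows: "\<bar>(\<Sum>i<n. (row_val n E u i)\<^sup>2) - n * nsq n u\<bar> \<le> (\<eta> * n + k + c\<^sup>2 + 4) * nsq n u"
    if "card (supp n u) \<le> k" for u
  proof -
    have "\<bar>\<Sum>j<n. \<Sum>l<n. d j l * (u j * u l)\<bar> \<le>
        ((\<eta> * n + k + c\<^sup>2) + 2 * (2 * real n) * (real n)\<^sup>2 / real (n ^ 3)) * nsq n u"
    proof (rule grid_transfer[where c = d and C = "2 * real n", OF n _ d _ _ that])
      fix f assume f: "f \<in> grid k n (n ^ 3)"
      define z where "z = grid_vec k f"
      have supp: "supp n z \<subseteq> fst ` f ` {..<k}"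
      proof
        fix i assume "i \<in> supp n z"
        then have nz: "grid_vec k f i \<noteq> 0" by (simp add: supp_def z_def)
        have "\<exists>l<k. fst (f l) = i"
        proof (rule ccontr)
          assume "\<not> (\<exists>l<k. fst (f l) = i)"
          then have "grid_vec k f i = 0" unfolding grid_vec_def by (intro sum.neutral) auto
          then show False using nz by simp
        qed
        then show "i \<in> fst ` f ` {..<k}" by (auto simp: image_image)
      qed
      have kz: "card (supp n z) \<le> k"
        using card_mono[OF _ supp] card_image_le[of "{..<k}" "\<lambda>i. fst (f i)"] by (simp add: image_image)
      have "{..<n} = ({..<n} - supp n z) \<union> supp n z" by (auto simp: supp_def)
      then have "(\<Sum>i<n. (row_val n E z i)\<^sup>2 - nsq n z) =
          outer_rows n E z + (\<Sum>i\<in>supp n z. (row_val n E z i)\<^sup>2 - nsq n z)"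
        unfolding outer_rows_def
        by (subst sum.union_disjoint[symmetric]) (auto simp: finite_supp)
      \<comment> \<open>The inner rows lie between 0 and \<open>c\<^sup>2 * nsq n z\<close>, and the
        at most k centring terms among them account for the summand \<open>k\<close> of the
        bound.\<close>
      then have split: "(\<Sum>i<n. (row_val n E z i)\<^sup>2) - n * nsq n z =
          outer_rows n E z + ((\<Sum>i\<in>supp n z. (row_val n E z i)\<^sup>2) - card (supp n z) * nsq n z)"
        by (simp add: sum_subtractf)
      have "(\<Sum>i\<in>supp n z. (row_val n E z i)\<^sup>2) \<le> c\<^sup>2 * nsq n z"
        by (rule inner_rows_bound[OF quad' c kz])
      moreover have "0 \<le> (\<Sum>i\<in>supp n z. (row_val n E z i)\<^sup>2)" by (simp add: sum_nonneg)
      moreover have "card (supp n z) * nsq n z \<le> k * nsq n z"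
        using kz by (intro mult_right_mono nsq_nonneg) simp
      moreover have "0 \<le> card (supp n z) * nsq n z" using nsq_nonneg by simp
      ultimately show "\<bar>\<Sum>i<n. \<Sum>j<n. d i j * (grid_vec k f i * grid_vec k f j)\<bar> \<le>
          (\<eta> * n + k + c\<^sup>2) * nsq n (grid_vec k f)"
        using outer[OF f] unfolding rows_quad z_def[symmetric] split distrib_right by linarith
    qed (use n \<eta> in auto)
    also have "\<dots> \<le> (\<eta> * n + k + c\<^sup>2 + 4) * nsq n u"
      using M(2) by (intro mult_right_mono nsq_nonneg) simp
    finally show ?thesis unfolding rows_quad .
  qed
  show ?thesis unfolding concentrated_def using quad' rows by (simp add: c_def)
qed

text \<open>The tail bounds at \<open>t = \<eta> * sqrt n\<close> and \<open>t = \<eta> * n\<close>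
  give exponents \<open>- \<eta>\<^sup>2 * n / 4\<close> and
  \<open>- \<eta>\<^sup>2 * n / 8\<close>; the weaker one is kept. The factor 4 counts two events
  with two tails each, the power counts the grid, and \<open>\<eta> \<le> 1 / 2\<close> is the range
  of \<open>outer_rows_tail\<close>.\<close>

theorem concentrated_probability:
  assumes n: "0 < n" and \<eta>: "0 \<le> \<eta>" "\<eta> \<le> 1 / 2"
  shows "measure_pmf.prob (uniform_graph n) {E. \<not> concentrated n k E \<eta>} \<le>
    4 * real (n * (2 * n ^ 3 + 1)) ^ k * exp (- (\<eta>\<^sup>2 * n / 8))"
proof -
  define A where "A f = {E \<in> graphs n. (1 + \<eta> * sqrt n) * nsq n (grid_vec k f) < \<bar>quad n E (grid_vec k f) (grid_vec k f)\<bar>}" for f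
  define B where "B f = {E \<in> graphs n. \<eta> * n * nsq n (grid_vec k f) < \<bar>outer_rows n E (grid_vec k f)\<bar>}" for f
  define e where "e = 2 ^ card (edges n) * exp (- (\<eta>\<^sup>2 * n / 8))"
  have A: "real (card (A f)) \<le> 2 * e" for f
  proof -
    have "real (card (A f)) \<le> 2 * (2 ^ card (edges n) * exp (- (\<eta> * sqrt n)\<^sup>2 / 4))"
      unfolding A_def using \<eta> by (intro quad_tail) auto
    also have "\<dots> \<le> 2 * e" by (simp add: e_def power_mult_distrib)
    finally show ?thesis .
  qed
  have B: "real (card (B f)) \<le> 2 * e" for f
  proof -
    have "real (card (B f)) \<le> 2 * (2 ^ card (edges n) * exp (- (\<eta> * n)\<^sup>2 / (8 * real n)))"
      unfolding B_def using \<eta> mult_right_mono[OF \<eta>(2), of n] by (intro outer_rows_tail) auto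
    also have "\<dots> = 2 * e" using n by (simp add: e_def power_mult_distrib power2_eq_square)
    finally show ?thesis .
  qed
  have "card {E \<in> graphs n. \<not> concentrated n k E \<eta>} \<le> card (\<Union>f\<in>grid k n (n ^ 3). A f \<union> B f)"
    using concentrated_if_grid[OF n \<eta>(1), of k]
    by (intro card_mono) (fastforce simp: A_def B_def finite_graphs finite_grid not_less)+
  also have "\<dots> \<le> (\<Sum>f\<in>grid k n (n ^ 3). card (A f \<union> B f))" by (rule card_UN_le[OF finite_grid])
  finally have "real (card {E \<in> graphs n. \<not> concentrated n k E \<eta>}) \<le> (\<Sum>f\<in>grid k n (n ^ 3). real (card (A f \<union> B f)))"
    by (simp add: of_nat_sum[symmetric] del: of_nat_sum)
  also have "\<dots> \<le> (\<Sum>f\<in>grid k n (n ^ 3). 4 * e)"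
  proof (rule sum_mono)
    fix f
    have "real (card (A f \<union> B f)) \<le> real (card (A f)) + real (card (B f))"
      using card_Un_le[of "A f" "B f"] by linarith
    then show "real (card (A f \<union> B f)) \<le> 4 * e" using A[of f] B[of f] by linarith
  qed
  also have "\<dots> = real (n * (2 * n ^ 3 + 1)) ^ k * (4 * e)" by (simp add: card_grid)
  finally have bad: "real (card {E \<in> graphs n. \<not> concentrated n k E \<eta>}) \<le> real (n * (2 * n ^ 3 + 1)) ^ k * (4 * e)" .
  have "measure_pmf.prob (uniform_graph n) {E. \<not> concentrated n k E \<eta>} =
      real (card {E \<in> graphs n. \<not> concentrated n k E \<eta>}) / 2 ^ card (edges n)"
    unfolding uniform_graph_def
    by (simp add: measure_pmf_of_set[OF graphs_nonempty finite_graphs] Int_def)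
      (simp add: graphs_eq_Pow card_Pow finite_edges)
  also have "\<dots> \<le> real (n * (2 * n ^ 3 + 1)) ^ k * (4 * e) / 2 ^ card (edges n)"
    by (intro divide_right_mono bad) simp
  also have "\<dots> = 4 * real (n * (2 * n ^ 3 + 1)) ^ k * exp (- (\<eta>\<^sup>2 * n / 8))"
    by (simp add: e_def)
  finally show ?thesis .
qed

section \<open>The RIP parameter of the constructed matrix\<close>

lemma sum_lessThan_add:
  fixes f :: "nat \<Rightarrow> 'a :: comm_monoid_add"
  shows "(\<Sum>i<m + n. f i) = (\<Sum>i<m. f i) + (\<Sum>i<n. f (m + i))"
  by (induction n) (auto simp: add_ac)

abbreviation real_graph_mat :: "nat \<Rightarrow> nat set set \<Rightarrow> nat \<Rightarrow> real Matrix.mat" where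
  "real_graph_mat n E s \<equiv> map_mat of_rat (graph_mat n E s)"

lemma edge_val_edge_sign: "edge_val E {i, j} = of_int (edge_sign E i j)"
  by (simp add: edge_val_def edge_sign_def)

lemma real_graph_mat_mult_vec:
  assumes x: "x \<in> carrier_vec (2 * n)" and i: "i < n"
  defines "u \<equiv> \<lambda>i. vec_index x i" and "v \<equiv> \<lambda>i. vec_index x (n + i)"
  shows "vec_index (real_graph_mat n E s *\<^sub>v x) i = 3 / 5 * u i + 4 / (5 * real s) * row_val n E v i" (is ?A)
    and "vec_index (real_graph_mat n E s *\<^sub>v x) (n + i) = 4 / (5 * real s) * row_val n E u i + 3 / 5 * v i" (is ?B)
proof -
  define e where "e i j = real_of_int (entry_num n E i j) / real_of_int (entry_den n s i j)" for i j
  have "vec_index (real_graph_mat n E s *\<^sub>v x) a = (\<Sum>j<n + n. e a j * vec_index x j)" if "a < 2 * n" for a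
    using that x by (simp add: graph_mat_def scalar_prod_def e_def of_rat_divide mult_2 atLeast0LessThan)
  then have mult: "vec_index (real_graph_mat n E s *\<^sub>v x) a =
      (\<Sum>j<n. e a j * u j) + (\<Sum>j<n. e a (n + j) * v j)" if "a < 2 * n" for a
    using that by (simp add: sum_lessThan_add u_def v_def)
  have e: "e i j = (if i = j then 3 / 5 else 0)" "e (n + i) (n + j) = (if i = j then 3 / 5 else 0)"
    "e i (n + j) = 4 / (5 * real s) * edge_val E {i, j}" "e (n + i) j = 4 / (5 * real s) * edge_val E {i, j}"
    if "j < n" for j
    using that i by (auto simp: e_def entry_num_def entry_den_def edge_val_edge_sign)
  have d: "(\<Sum>j<n. (if i = j then 3 / 5 else 0) * f j) = 3 / 5 * f i" for f :: "nat \<Rightarrow> real"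
    using i by (simp add: if_distrib[of "\<lambda>x. x * _"] cong: if_cong)
  have "(\<Sum>j<n. e i j * u j) = 3 / 5 * u i" "(\<Sum>j<n. e (n + i) (n + j) * v j) = 3 / 5 * v i"
    unfolding d[symmetric] by (intro sum.cong refl; simp add: e)+
  moreover have "(\<Sum>j<n. e i (n + j) * v j) = 4 / (5 * real s) * row_val n E v i"
    "(\<Sum>j<n. e (n + i) j * u j) = 4 / (5 * real s) * row_val n E u i"
    unfolding row_val_def sum_distrib_left by (intro sum.cong refl; simp add: e)+
  ultimately show ?A ?B using mult[of i] mult[of "n + i"] i by simp_all
qed

text \<open>Each block row contributes a mixed term with coefficient 2 * 3/5 * 4/5 = 24/25; the two
  are equal by the symmetry of A.\<close>

lemma sq_norm_real_graph_mat:
  assumes x: "x \<in> carrier_vec (2 * n)" and "0 < s"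
  defines "u \<equiv> \<lambda>i. vec_index x i" and "v \<equiv> \<lambda>i. vec_index x (n + i)"
  shows "sq_norm (real_graph_mat n E s *\<^sub>v x) = 9 / 25 * (nsq n u + nsq n v) +
      16 / 25 * ((\<Sum>i<n. (row_val n E u i)\<^sup>2) + (\<Sum>i<n. (row_val n E v i)\<^sup>2)) / (real s)\<^sup>2 +
      48 / 25 * quad n E u v / real s"
    and "sq_norm x = nsq n u + nsq n v"
proof -
  show "sq_norm x = nsq n u + nsq n v"
    using x by (simp add: sq_norm_sum nsq_def u_def v_def mult_2 sum_lessThan_add)
  define y where "y = real_graph_mat n E s *\<^sub>v x"
  have "dim_vec y = n + n" by (simp add: y_def graph_mat_def)
  then have "sq_norm y = (\<Sum>i<n. (vec_index y i)\<^sup>2) + (\<Sum>i<n. (vec_index y (n + i))\<^sup>2)"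
    by (simp add: sq_norm_sum sum_lessThan_add)
  also have "\<dots> = (\<Sum>i<n. (3 / 5 * u i + 4 / (5 * real s) * row_val n E v i)\<^sup>2) +
      (\<Sum>i<n. (4 / (5 * real s) * row_val n E u i + 3 / 5 * v i)\<^sup>2)"
    using real_graph_mat_mult_vec[OF x] by (simp add: y_def u_def v_def)
  also have "\<dots> = 9 / 25 * (nsq n u + nsq n v) +
      16 / 25 * ((\<Sum>i<n. (row_val n E u i)\<^sup>2) + (\<Sum>i<n. (row_val n E v i)\<^sup>2)) / (real s)\<^sup>2 +
      24 / 25 * (quad n E u v + quad n E v u) / real s"
    unfolding nsq_def quad_row_val
    by (simp add: power2_sum power_mult_distrib sum.distrib sum_distrib_left sum_divide_distrib
        distrib_left power_divide add_divide_distrib mult_ac)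
  finally show "sq_norm (real_graph_mat n E s *\<^sub>v x) = 9 / 25 * (nsq n u + nsq n v) +
      16 / 25 * ((\<Sum>i<n. (row_val n E u i)\<^sup>2) + (\<Sum>i<n. (row_val n E v i)\<^sup>2)) / (real s)\<^sup>2 +
      48 / 25 * quad n E u v / real s"
    unfolding y_def quad_commute[of n E u v] by simp
qed

lemma card_supp_le:
  assumes x: "x \<in> carrier_vec (2 * n)" and "Defs.sparse k x"
  shows "card (supp n (\<lambda>i. vec_index x i)) + card (supp n (\<lambda>i. vec_index x (n + i))) \<le> k"
proof -
  let ?A = "supp n (\<lambda>i. vec_index x i)" and ?B = "supp n (\<lambda>i. vec_index x (n + i))"
  have "card ?A + card ?B = card (?A \<union> (+) n ` ?B)"
    by (subst card_Un_disjoint) (auto simp: finite_supp card_image supp_def)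
  also have "\<dots> \<le> card {i. i < dim_vec x \<and> vec_index x i \<noteq> 0}"
    using x by (intro card_mono) (auto simp: supp_def)
  finally show ?thesis using assms(2) by (simp add: Defs.sparse_def)
qed

text \<open>If \<open>odd_sqrt n\<close> is not 1, the preceding odd number was rejected by
  minimality, so it is below sqrt n.\<close>

lemma odd_sqrt_bounds:
  assumes "0 < n"
  shows "sqrt n \<le> odd_sqrt n" "odd_sqrt n \<le> sqrt n + 2"
proof -
  have "real n \<le> (real (odd_sqrt n))\<^sup>2" using odd_sqrt_le[of n] by (metis of_nat_le_iff of_nat_power)
  then show "sqrt n \<le> odd_sqrt n" by (simp add: real_le_lsqrt)
  show "odd_sqrt n \<le> sqrt n + 2"
  proof (cases "odd_sqrt n = 1")
    case False
    then obtain h where h: "odd_sqrt n = 2 * Suc h + 1" using odd_odd_sqrt[of n] by (elim oddE) (metis One_nat_def add_cancel_right_left mult_0_right not0_implies_Suc)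
    then have "(2 * h + 1)\<^sup>2 < n" by (intro odd_sqrt_minimal) simp
    then have "(real (2 * h + 1))\<^sup>2 < real n" by (metis of_nat_less_iff of_nat_power)
    then have "real (2 * h + 1) \<le> sqrt n" by (intro real_le_rsqrt) simp
    then show ?thesis using h by simp
  qed simp
qed

text \<open>As 9/25 + 16/25 = 1, the main terms reproduce the squared norm. What remains is the
  deviation of the rows and the bilinear form, with weights 16/25 and 24/25, which are rounded up to
  1.\<close>

lemma RIP_if_concentrated:
  assumes n: "0 < n" and conc: "concentrated n k E \<eta>" and \<eta>: "0 \<le> \<eta>"
    and \<delta>: "\<eta> + k / n + (\<eta> * sqrt n + 3)\<^sup>2 / n + 4 / n + 8 / sqrt n + \<eta> + 3 / sqrt n \<le> \<delta>"
  shows "RIP (real_graph_mat n E (odd_sqrt n)) k \<delta>"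
  unfolding RIP_def
proof (intro ballI impI)
  define s where "s = real (odd_sqrt n)"
  define c where "c = \<eta> * sqrt n + 3"
  \<comment> \<open>The summand \<open>8 * sqrt n\<close> pays for replacing n by
    \<open>s\<^sup>2\<close>.\<close>
  define T where "T = \<eta> * n + k + c\<^sup>2 + 4 + 8 * sqrt n"
  have rn: "1 \<le> sqrt n" "sqrt n * sqrt n = n" using n by simp_all
  have s: "sqrt n \<le> s" "s \<le> sqrt n + 2" using odd_sqrt_bounds[OF n] by (simp_all add: s_def)
  then have s0: "0 < s" using rn by linarith
  have s2: "n \<le> s\<^sup>2" "s\<^sup>2 \<le> n + 8 * sqrt n"
  proof -
    have "sqrt n * sqrt n \<le> s * s" using s(1) s0 by (intro mult_mono) auto
    then show "n \<le> s\<^sup>2" by (simp add: power2_eq_square)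
    have "s * s \<le> (sqrt n + 2) * (sqrt n + 2)" using s s0 by (intro mult_mono) auto
    also have "\<dots> = n + 4 * sqrt n + 4" using rn(2) by (simp add: algebra_simps)
    finally show "s\<^sup>2 \<le> n + 8 * sqrt n" using rn(1) unfolding power2_eq_square by linarith
  qed
  have T: "0 \<le> T" using \<eta> by (simp add: T_def)
  have c: "0 \<le> c" using \<eta> by (simp add: c_def)
  have Tn: "T / s\<^sup>2 \<le> \<eta> + k / n + c\<^sup>2 / n + 4 / n + 8 / sqrt n"
  proof -
    have "T / s\<^sup>2 \<le> T / n" using s2(1) n T s0 by (intro divide_left_mono) auto
    also have "\<dots> = \<eta> + k / n + c\<^sup>2 / n + 4 / n + 8 * (sqrt n / n)"
      using n by (simp add: T_def add_divide_distrib)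
    also have "sqrt n / n = 1 / sqrt n" using n rn by (simp add: field_simps)
    finally show ?thesis by simp
  qed
  have cn: "c / s \<le> \<eta> + 3 / sqrt n"
  proof -
    have "c / s \<le> c / sqrt n" using s s0 n c by (intro divide_left_mono mult_pos_pos) auto
    also have "\<dots> = \<eta> + 3 / sqrt n" using n by (simp add: c_def add_divide_distrib)
    finally show ?thesis .
  qed
  have \<delta>': "16 / 25 * (T / s\<^sup>2) + 24 / 25 * (c / s) \<le> \<delta>"
  proof -
    have "0 \<le> T / s\<^sup>2" "0 \<le> c / s" using T c s0 by simp_all
    then have "16 / 25 * (T / s\<^sup>2) + 24 / 25 * (c / s) \<le> T / s\<^sup>2 + c / s" by linarith
    also have "\<dots> \<le> \<delta>" using Tn cn \<delta> unfolding c_def[symmetric] by linarith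
    finally show ?thesis .
  qed
  fix x :: "real Matrix.vec"
  assume "x \<in> carrier_vec (dim_col (real_graph_mat n E (odd_sqrt n)))" and sparse: "Defs.sparse k x"
  then have x: "x \<in> carrier_vec (2 * n)" by (simp add: graph_mat_def)
  define u v where "u = (\<lambda>i. vec_index x i)" and "v = (\<lambda>i. vec_index x (n + i))"
  have supp: "card (supp n u) + card (supp n v) \<le> k" using card_supp_le[OF x sparse] by (simp add: u_def v_def)
  have quad: "\<bar>quad n E w w\<bar> \<le> c * nsq n w" if "card (supp n w) \<le> k" for w
    using conc that unfolding concentrated_def c_def by blast
  have rows: "\<bar>(\<Sum>i<n. (row_val n E w i)\<^sup>2) / s\<^sup>2 - nsq n w\<bar> \<le> T / s\<^sup>2 * nsq n w" if "card (supp n w) \<le> k" for w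
  proof -
    have "\<bar>(\<Sum>i<n. (row_val n E w i)\<^sup>2) - n * nsq n w\<bar> \<le> (\<eta> * n + k + c\<^sup>2 + 4) * nsq n w"
      using conc that unfolding concentrated_def c_def by blast
    moreover have "n * nsq n w \<le> s\<^sup>2 * nsq n w" "s\<^sup>2 * nsq n w \<le> (n + 8 * sqrt n) * nsq n w"
      using s2 by (intro mult_right_mono nsq_nonneg; simp)+
    ultimately have "\<bar>(\<Sum>i<n. (row_val n E w i)\<^sup>2) - s\<^sup>2 * nsq n w\<bar> \<le> T * nsq n w"
      unfolding T_def by (simp add: algebra_simps abs_le_iff)
    then have "\<bar>(\<Sum>i<n. (row_val n E w i)\<^sup>2) - s\<^sup>2 * nsq n w\<bar> / s\<^sup>2 \<le> T * nsq n w / s\<^sup>2"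
      by (intro divide_right_mono) auto
    moreover have "\<bar>(\<Sum>i<n. (row_val n E w i)\<^sup>2) - s\<^sup>2 * nsq n w\<bar> / s\<^sup>2 =
        \<bar>((\<Sum>i<n. (row_val n E w i)\<^sup>2) - s\<^sup>2 * nsq n w) / s\<^sup>2\<bar>" by (simp add: abs_divide)
    moreover have "((\<Sum>i<n. (row_val n E w i)\<^sup>2) - s\<^sup>2 * nsq n w) / s\<^sup>2 = (\<Sum>i<n. (row_val n E w i)\<^sup>2) / s\<^sup>2 - nsq n w"
      using s0 by (simp add: diff_divide_distrib)
    ultimately show ?thesis by simp
  qed
  \<comment> \<open>The two halves of a sparse vector share the budget k, so polarization needs the
    form only at k-sparse vectors.\<close>
  have "card (supp n u \<union> supp n v) \<le> k" using card_Un_le[of "supp n u" "supp n v"] supp by linarith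
  then have "\<bar>quad n E u v\<bar> \<le> c * (nsq n u + nsq n v) / 2" by (intro quad_polarization[OF quad])
  then have "\<bar>quad n E u v\<bar> / s \<le> c * (nsq n u + nsq n v) / 2 / s" using s0 by (intro divide_right_mono) auto
  then have q: "\<bar>quad n E u v / s\<bar> \<le> c / s * (nsq n u + nsq n v) / 2" using s0 by (simp add: abs_divide)
  define \<Phi>x where "\<Phi>x = sq_norm (real_graph_mat n E (odd_sqrt n) *\<^sub>v x)"
  define Ru Rv where "Ru = (\<Sum>i<n. (row_val n E u i)\<^sup>2) / s\<^sup>2" and "Rv = (\<Sum>i<n. (row_val n E v i)\<^sup>2) / s\<^sup>2"
  define N where "N = nsq n u + nsq n v"
  have N: "0 \<le> N" "sq_norm x = N"
    using nsq_nonneg sq_norm_real_graph_mat(2)[OF x] s0 by (simp_all add: N_def u_def v_def s_def)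
  have "\<Phi>x = 9 / 25 * N + 16 / 25 * (Ru + Rv) + 48 / 25 * (quad n E u v / s)"
    using sq_norm_real_graph_mat(1)[OF x, of "odd_sqrt n" E] s0
    by (simp add: \<Phi>x_def N_def u_def v_def s_def Ru_def Rv_def add_divide_distrib distrib_left)
  moreover have "\<bar>Ru - nsq n u\<bar> \<le> T / s\<^sup>2 * nsq n u" "\<bar>Rv - nsq n v\<bar> \<le> T / s\<^sup>2 * nsq n v"
    using rows supp by (simp_all add: Ru_def Rv_def)
  then have "\<bar>Ru + Rv - N\<bar> \<le> T / s\<^sup>2 * N"
    unfolding N_def distrib_left by linarith
  moreover have "\<bar>9 / 25 * N + 16 / 25 * A + 48 / 25 * Z - N\<bar> \<le> 16 / 25 * X + 48 / 25 * Y"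
    if "\<bar>A - N\<bar> \<le> X" "\<bar>Z\<bar> \<le> Y" for A X Y Z :: real
    using that by linarith
  ultimately have "\<bar>\<Phi>x - N\<bar> \<le> 16 / 25 * (T / s\<^sup>2 * N) + 48 / 25 * (c / s * N / 2)"
    using q unfolding N_def[symmetric] by blast
  also have "\<dots> = (16 / 25 * (T / s\<^sup>2) + 24 / 25 * (c / s)) * N" by (simp add: algebra_simps)
  also have "\<dots> \<le> \<delta> * N" using \<delta>' N(1) by (rule mult_right_mono)
  finally have "\<bar>\<Phi>x - N\<bar> \<le> \<delta> * N" .
  then show "(1 - \<delta>) * sq_norm x \<le> sq_norm (real_graph_mat n E (odd_sqrt n) *\<^sub>v x) \<and>
      sq_norm (real_graph_mat n E (odd_sqrt n) *\<^sub>v x) \<le> (1 + \<delta>) * sq_norm x"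
    unfolding N(2) \<Phi>x_def[symmetric] left_diff_distrib distrib_right by linarith
qed

text \<open>Subtracting the lower RIP inequality at (1_S, -1_S) from the upper one at (1_S, 1_S)
  cancels the unknown \<open>r\<close> and leaves 96/25 K (K - 2) / s <= 4 K times the RIP
  parameter. The form takes the value K (K - 1) - K, the last K coming from the diagonal.\<close>

lemma RIP_param_if_clique:
  assumes E: "E \<in> graphs n" and clique: "has_clique n E K" and K: "1 \<le> K" "2 * K \<le> k" and s: "0 < s"
  shows "24 / 25 * (real K - 2) / real s \<le> RIP_param k (real_graph_mat n E s)"
proof -
  define \<delta> where "\<delta> = RIP_param k (real_graph_mat n E s)"
  obtain S where S: "S \<subseteq> {..<n}" "card S = K" "\<And>i j. i \<in> S \<Longrightarrow> j \<in> S \<Longrightarrow> i \<noteq> j \<Longrightarrow> {i, j} \<in> E"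
    using clique unfolding has_clique_def by blast
  have fin: "finite S" using S(1) finite_subset by blast
  define u :: "nat \<Rightarrow> real" where "u = indicator S"
  have nsq: "nsq n u = K"
  proof -
    have "nsq n u = (\<Sum>i\<in>S. 1)"
      unfolding nsq_def by (rule sum.mono_neutral_cong_right) (use S(1) in \<open>auto simp: u_def\<close>)
    then show ?thesis using S(2) by simp
  qed
  have quad: "quad n E u u = K * (real K - 2)"
  proof -
    have "{i} \<notin> E" for i using E by (auto simp: graphs_def)
    then have ev: "edge_val E {i, j} = (if i = j then -1 else 1)" if "i \<in> S" "j \<in> S" for i j
      using S(3)[OF that] by (auto simp: edge_val_def)
    have "quad n E u u = (\<Sum>i\<in>S. \<Sum>j\<in>S. edge_val E {i, j})"
      unfolding quad_def
    proof (rule sum.mono_neutral_cong_right)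
      show "(\<Sum>j<n. edge_val E {i, j} * (u i * u j)) = (\<Sum>j\<in>S. edge_val E {i, j})" if "i \<in> S" for i
        by (rule sum.mono_neutral_cong_right) (use S(1) that in \<open>auto simp: u_def\<close>)
    qed (use S(1) in \<open>auto simp: u_def\<close>)
    also have "\<dots> = (\<Sum>i\<in>S. \<Sum>j\<in>S. 1 - (if i = j then 2 else 0))"
      using ev by (intro sum.cong) auto
    also have "\<dots> = K * (real K - 2)"
      using fin S(2) by (simp add: sum_subtractf)
    finally show ?thesis .
  qed
  define r where "r = (\<Sum>i<n. (row_val n E u i)\<^sup>2)"
  define x where "x \<sigma> = Matrix.vec (2 * n) (\<lambda>i. if i < n then u i else \<sigma> * u (i - n))" for \<sigma>
  have x: "x \<sigma> \<in> carrier_vec (2 * n)" for \<sigma> by (simp add: x_def)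
  have ux: "nsq n (\<lambda>i. vec_index (x \<sigma>) i) = nsq n u" "quad n E (\<lambda>i. vec_index (x \<sigma>) i) w = quad n E u w"
    "(\<Sum>i<n. (row_val n E (\<lambda>i. vec_index (x \<sigma>) i) i)\<^sup>2) = r" for \<sigma> w
    by (simp_all add: x_def nsq_def quad_def row_val_def r_def)
  have vx: "nsq n (\<lambda>i. vec_index (x \<sigma>) (n + i)) = nsq n u"
    "quad n E u (\<lambda>i. vec_index (x \<sigma>) (n + i)) = \<sigma> * quad n E u u"
    "(\<Sum>i<n. (row_val n E (\<lambda>i. vec_index (x \<sigma>) (n + i)) i)\<^sup>2) = r" if "\<sigma>\<^sup>2 = 1" for \<sigma>
    using that
    by (simp_all add: x_def nsq_def quad_def row_val_def r_def sum_distrib_left power_mult_distrib mult_ac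
        flip: sum_distrib_left)
  have sq: "sq_norm (real_graph_mat n E s *\<^sub>v x \<sigma>) = 18 / 25 * K + 32 / 25 * r / (real s)\<^sup>2 +
      48 / 25 * (\<sigma> * (K * (real K - 2))) / real s" "sq_norm (x \<sigma>) = 2 * real K" if "\<sigma>\<^sup>2 = 1" for \<sigma>
    using sq_norm_real_graph_mat(1)[OF x[of \<sigma>] s, of E] sq_norm_real_graph_mat(2)[OF x[of \<sigma>] s] vx[OF that] by (simp_all add: ux nsq quad)
  have "Defs.sparse k (x \<sigma>)" for \<sigma>
  proof -
    have "{i. i < dim_vec (x \<sigma>) \<and> vec_index (x \<sigma>) i \<noteq> 0} \<subseteq> S \<union> (+) n ` S"
      by (force simp: x_def u_def indicator_def image_iff split: if_splits intro: le_add_diff_inverse[symmetric])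
    then have "card {i. i < dim_vec (x \<sigma>) \<and> vec_index (x \<sigma>) i \<noteq> 0} \<le> card (S \<union> (+) n ` S)"
      using fin by (intro card_mono) auto
    also have "\<dots> \<le> K + K"
      using card_Un_le[of S "(+) n ` S"] card_image_le[OF fin, of "(+) n"] S(2) by linarith
    finally show ?thesis using K(2) by (simp add: Defs.sparse_def)
  qed
  moreover have "RIP (real_graph_mat n E s) k \<delta>" unfolding \<delta>_def by (rule RIP_param_least)
  ultimately have "(1 - \<delta>) * sq_norm (x \<sigma>) \<le> sq_norm (real_graph_mat n E s *\<^sub>v x \<sigma>) \<and>
      sq_norm (real_graph_mat n E s *\<^sub>v x \<sigma>) \<le> (1 + \<delta>) * sq_norm (x \<sigma>)" for \<sigma>
    using x[of \<sigma>] unfolding RIP_def by (simp add: graph_mat_def)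
  note upper = this[of 1, THEN conjunct2] and lower = this[of "-1", THEN conjunct1]
  define a q where "a = 18 / 25 * K + 32 / 25 * r / (real s)\<^sup>2" and "q = K * (real K - 2) / real s"
  have vals: "sq_norm (real_graph_mat n E s *\<^sub>v x 1) = a + 48 / 25 * q"
    "sq_norm (real_graph_mat n E s *\<^sub>v x (-1)) = a - 48 / 25 * q"
    using sq(1)[of 1] sq(1)[of "-1"] by (simp_all add: a_def q_def)
  have norms: "sq_norm (x 1) = 2 * real K" "sq_norm (x (-1)) = 2 * real K"
    using sq(2)[of 1] sq(2)[of "-1"] by simp_all
  define w where "w = real K * \<delta>"
  have "96 / 25 * q \<le> 4 * w"
    using upper lower unfolding vals norms w_def by (simp add: algebra_simps)
  then have "24 / 25 * q \<le> w" by linarith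
  moreover have "real K * (24 / 25 * (real K - 2) / real s) = 24 / 25 * q" by (simp add: q_def)
  ultimately have "real K * (24 / 25 * (real K - 2) / real s) \<le> real K * \<delta>" by (simp only: w_def)
  moreover have "0 < real K" using K(1) by simp
  ultimately show ?thesis unfolding \<delta>_def by (rule mult_left_le_imp_le)
qed

section \<open>Asymptotics and hardness\<close>

text \<open>With d and p for the two exponents, the differences factor: d - \<epsilon> = \<epsilon>
  (1/2 - \<epsilon>) / 2, 1/2 - d = (1/2 - \<epsilon>) (2 - \<epsilon>) / 2, (1 - 2 d) - p =
  \<epsilon> (1/2 - \<epsilon>), and p - (1/2 - \<epsilon>) = (1 - 2 \<epsilon>) (1/2 - \<epsilon>).
  They serve, in this order, to separate the thresholds, to make 1 / sqrt n negligible, to win the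
  union bound, and to keep the clique vectors sparse.\<close>

lemma approximation_gap:
  fixes \<epsilon> :: real
  assumes "0 < \<epsilon>" "\<epsilon> < 1 / 2"
  shows "\<epsilon> < 5 * \<epsilon> / 4 - \<epsilon>\<^sup>2 / 2" "5 * \<epsilon> / 4 - \<epsilon>\<^sup>2 / 2 < 1 / 2"
    "0 < (1 - 2 * \<epsilon>) * (1 - \<epsilon>)" "(1 - 2 * \<epsilon>) * (1 - \<epsilon>) < 1 - 2 * (5 * \<epsilon> / 4 - \<epsilon>\<^sup>2 / 2)"
    "1 / 2 - \<epsilon> < (1 - 2 * \<epsilon>) * (1 - \<epsilon>)"
proof -
  have "\<epsilon> * \<epsilon> < \<epsilon> * (1 / 2)" using assms by (intro mult_strict_left_mono)
  moreover have "0 < (1 / 2 - \<epsilon>) * (2 - \<epsilon>)" using assms by (intro mult_pos_pos) auto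
  moreover have "0 < (1 - 2 * \<epsilon>) * (1 / 2 - \<epsilon>)" using assms by (intro mult_pos_pos) auto
  ultimately show "\<epsilon> < 5 * \<epsilon> / 4 - \<epsilon>\<^sup>2 / 2" "5 * \<epsilon> / 4 - \<epsilon>\<^sup>2 / 2 < 1 / 2"
    "0 < (1 - 2 * \<epsilon>) * (1 - \<epsilon>)" "(1 - 2 * \<epsilon>) * (1 - \<epsilon>) < 1 - 2 * (5 * \<epsilon> / 4 - \<epsilon>\<^sup>2 / 2)"
    "1 / 2 - \<epsilon> < (1 - 2 * \<epsilon>) * (1 - \<epsilon>)"
    using assms by (auto simp: power2_eq_square algebra_simps)
qed

lemma eventually_clique_scale:
  fixes \<epsilon> p :: real
  assumes "0 < \<epsilon>" "\<epsilon> < 1 / 2" and "1 / 2 - \<epsilon> < p"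
  shows "\<forall>\<^sub>F n in sequentially. 1 \<le> nat \<lfloor>real n powr (1 / 2 - \<epsilon>)\<rfloor> \<and>
    2 * nat \<lfloor>real n powr (1 / 2 - \<epsilon>)\<rfloor> \<le> nat \<lfloor>real (2 * n) powr p\<rfloor> \<and>
    real (2 * n) powr (- \<epsilon>) / 4 \<le> 24 / 25 * (real (nat \<lfloor>real n powr (1 / 2 - \<epsilon>)\<rfloor>) - 2) / real (odd_sqrt n)"
proof -
  define e where "e = 1 / 2 - \<epsilon>"
  have e: "0 < e" "e < p" "e < 1 / 2" "- \<epsilon> = e - 1 / 2" using assms by (auto simp: e_def)
  have 1: "\<forall>\<^sub>F n in sequentially. 2 \<le> real n powr e"
    using e by real_asymp
  have 2: "\<forall>\<^sub>F n in sequentially. 2 * real n powr e + 1 \<le> (2 * real n) powr p"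
    using e by real_asymp
  \<comment> \<open>Here \<open>sqrt n + 2\<close> stands for the upper bound on
    \<open>odd_sqrt n\<close>, and \<open>n powr e - 3\<close> for K - 2 after rounding. The room
    comes from 1/4 < 24/25.\<close>
  have 3: "\<forall>\<^sub>F n in sequentially. real n powr (e - 1 / 2) / 4 * (sqrt (real n) + 2) \<le> 24 / 25 * (real n powr e - 3)"
    using e by real_asymp
  show ?thesis
    using 1 2 3 eventually_gt_at_top[of 0]
  proof eventually_elim
    case (elim n)
    define K where "K = nat \<lfloor>real n powr e\<rfloor>"
    have K: "real n powr e - 1 \<le> real K" "real K \<le> real n powr e" "1 \<le> K"
      using elim(1) unfolding K_def by linarith+
    have "real (2 * K) \<le> (2 * real n) powr p - 1" using K(2) elim(2) by simp
    then have "2 * K \<le> nat \<lfloor>real (2 * n) powr p\<rfloor>" by simp linarith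
    moreover have "real (2 * n) powr (- \<epsilon>) / 4 \<le> 24 / 25 * (real K - 2) / real (odd_sqrt n)"
    proof -
      have "(2 * real n) powr (e - 1 / 2) / 4 * odd_sqrt n \<le> real n powr (e - 1 / 2) / 4 * (sqrt (real n) + 2)"
        using odd_sqrt_bounds(2)[OF elim(4)] e(3) elim(4)
        by (intro mult_mono divide_right_mono powr_mono2') auto
      also have "\<dots> \<le> 24 / 25 * (real n powr e - 3)" by (rule elim(3))
      also have "\<dots> \<le> 24 / 25 * (real K - 2)" using K(1) by simp
      finally show ?thesis
        using odd_odd_sqrt[of n] unfolding e(4) by (simp add: pos_le_divide_eq odd_pos)
    qed
    ultimately show ?case using K(3) unfolding K_def e_def by blast
  qed
qed

text \<open>Only the two quarters are of the order of the right side. All other terms have exponents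
  p - 1, -2 d, -d - 1/2, -1 or -1/2, each smaller than -d.\<close>

lemma eventually_RIP_scale:
  fixes d p :: real
  assumes "0 < d" "d < 1 / 2" "0 < p" "p < 1 - 2 * d"
  shows "\<forall>\<^sub>F n in sequentially.
    real (2 * n) powr (- d) / 4 + real (nat \<lfloor>real (2 * n) powr p\<rfloor>) / n +
      (real (2 * n) powr (- d) / 4 * sqrt n + 3)\<^sup>2 / n + 4 / n + 8 / sqrt n +
      real (2 * n) powr (- d) / 4 + 3 / sqrt n \<le> real (2 * n) powr (- d)"
proof -
  have dp: "p - 1 < - d" "- 2 * d < - d" "- d - 1 / 2 < - d" "- 1 < - d" "- (1 / 2) < - d" using assms by auto
  have "\<forall>\<^sub>F n in sequentially.
    (2 * real n) powr (- d) / 4 + (2 * real n) powr p / n +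
      ((2 * real n) powr (- d) / 4 * sqrt n + 3)\<^sup>2 / n + 4 / n + 8 / sqrt n +
      (2 * real n) powr (- d) / 4 + 3 / sqrt n \<le> (2 * real n) powr (- d)"
    using assms dp by real_asymp
  then show ?thesis
  proof eventually_elim
    case (elim n)
    have "real (nat \<lfloor>real (2 * n) powr p\<rfloor>) / n \<le> (2 * real n) powr p / n"
      by (intro divide_right_mono) auto
    then show ?case using elim by simp
  qed
qed

text \<open>The power with a rounded exponent is bounded by the exponential of a smooth expression,
  in which \<open>n powr p * ln n\<close> loses against \<open>n powr (1 - 2 * d)\<close>, up to
  constants.\<close>

lemma failure_probability_tendsto_0:
  fixes d p :: real
  assumes "0 < d" "d < 1 / 2" "0 < p" "p < 1 - 2 * d"
  shows "(\<lambda>n. 4 * real (n * (2 * n ^ 3 + 1)) ^ nat \<lfloor>real (2 * n) powr p\<rfloor> *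
    exp (- ((real (2 * n) powr (- d) / 4)\<^sup>2 * n / 8))) \<longlonglongrightarrow> 0"
proof (rule tendsto_sandwich[of "\<lambda>_. 0" _ _ "\<lambda>n. 4 * exp ((2 * real n) powr p * ln (real n * (2 * real n ^ 3 + 1)) -
    ((2 * real n) powr (- d) / 4)\<^sup>2 * real n / 8)"])
  show "\<forall>\<^sub>F n in sequentially. 4 * real (n * (2 * n ^ 3 + 1)) ^ nat \<lfloor>real (2 * n) powr p\<rfloor> *
      exp (- ((real (2 * n) powr (- d) / 4)\<^sup>2 * n / 8)) \<le>
    4 * exp ((2 * real n) powr p * ln (real n * (2 * real n ^ 3 + 1)) - ((2 * real n) powr (- d) / 4)\<^sup>2 * real n / 8)"
    using eventually_gt_at_top[of 0]
  proof eventually_elim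
    case (elim n)
    define x where "x = real n * (2 * real n ^ 3 + 1)"
    have "1 * 1 \<le> real n * (2 * real n ^ 3 + 1)" using elim by (intro mult_mono) auto
    then have x: "1 \<le> x" by (simp add: x_def)
    define k where "k = nat \<lfloor>real (2 * n) powr p\<rfloor>"
    have k: "real k \<le> (2 * real n) powr p" by (simp add: k_def)
    have "x ^ k = exp (real k * ln x)" using x by (simp add: exp_of_nat_mult)
    also have "\<dots> \<le> exp ((2 * real n) powr p * ln x)" using k x by (simp add: mult_right_mono)
    finally have le: "x ^ k \<le> exp ((2 * real n) powr p * ln x)" .
    define y where "y = (real (2 * n) powr (- d) / 4)\<^sup>2 * real n / 8"
    have "x ^ k * exp (- y) \<le> exp ((2 * real n) powr p * ln x) * exp (- y)"
      using le by (rule mult_right_mono) simp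
    also have "\<dots> = exp ((2 * real n) powr p * ln x - y)" by (simp add: exp_diff exp_minus divide_inverse)
    finally have "4 * x ^ k * exp (- y) \<le> 4 * exp ((2 * real n) powr p * ln x - y)" by simp
    moreover have "real (n * (2 * n ^ 3 + 1)) = x" by (simp add: x_def algebra_simps)
    moreover have "2 * real n = real (2 * n)" by simp
    ultimately show ?case unfolding x_def[symmetric] k_def[symmetric] y_def by (simp only:)
  qed
  show "(\<lambda>n. 4 * exp ((2 * real n) powr p * ln (real n * (2 * real n ^ 3 + 1)) -
      ((2 * real n) powr (- d) / 4)\<^sup>2 * real n / 8)) \<longlonglongrightarrow> 0"
  proof -
    have "filterlim (\<lambda>n. (2 * real n) powr p * ln (real n * (2 * real n ^ 3 + 1)) -
      ((2 * real n) powr (- d) / 4)\<^sup>2 * real n / 8) at_bot sequentially"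
      using assms by real_asymp
    then show ?thesis by (intro tendsto_mult_right_zero filterlim_compose[OF exp_at_bot])
  qed
qed auto

text \<open>The two bounds on the RIP parameter match the two clauses of the hypothesis: the one for
  cliques holds for every graph, the one from concentration only with probability tending to 1.
  Between the thresholds, nothing is assumed about the answer of \<open>P\<close>.\<close>

lemma no_promise_decider:
  fixes \<epsilon> :: real
  assumes \<epsilon>: "0 < \<epsilon>" "\<epsilon> < 1 / 2" and hyp: "hidden_clique_hypothesis \<epsilon>" and P: "polytime_on mat_inputs P"
    and k: "\<And>n. k n = nat \<lfloor>real n powr ((1 - 2 * \<epsilon>) * (1 - \<epsilon>))\<rfloor>"
    and yes: "\<And>n \<Phi>. n0 \<le> n \<Longrightarrow> \<Phi> \<in> carrier_mat n n \<Longrightarrow>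
      RIP_param (k n) (map_mat of_rat \<Phi>) \<le> real n powr (- (5 * \<epsilon> / 4 - \<epsilon>\<^sup>2 / 2)) \<Longrightarrow>
      outputs_yes P (encode_mat \<Phi>)"
    and no: "\<And>n \<Phi>. n0 \<le> n \<Longrightarrow> \<Phi> \<in> carrier_mat n n \<Longrightarrow>
      real n powr (- \<epsilon>) / 4 \<le> RIP_param (k n) (map_mat of_rat \<Phi>) \<Longrightarrow> outputs_no P (encode_mat \<Phi>)"
  shows False
proof -
  define p d where "p = (1 - 2 * \<epsilon>) * (1 - \<epsilon>)" and "d = 5 * \<epsilon> / 4 - \<epsilon>\<^sup>2 / 2"
  have pd: "0 < d" "d < 1 / 2" "0 < p" "p < 1 - 2 * d" "1 / 2 - \<epsilon> < p"
    using approximation_gap[OF \<epsilon>] \<epsilon> by (auto simp: p_def d_def)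
  define K where "K n = nat \<lfloor>real n powr (1 / 2 - \<epsilon>)\<rfloor>" for n :: nat
  \<comment> \<open>A quarter of the yes-threshold at order 2 n: it enters the RIP bound twice,
    which leaves half of the threshold for the lower order terms.\<close>
  define \<eta> where "\<eta> n = real (2 * n) powr (- d) / 4" for n :: nat
  have "\<forall>\<^sub>F n in sequentially. n0 \<le> n \<and> 0 < n \<and>
      (1 \<le> K n \<and> 2 * K n \<le> k (2 * n) \<and> real (2 * n) powr (- \<epsilon>) / 4 \<le> 24 / 25 * (real (K n) - 2) / real (odd_sqrt n)) \<and>
      \<eta> n + real (k (2 * n)) / n + (\<eta> n * sqrt n + 3)\<^sup>2 / n + 4 / n + 8 / sqrt n + \<eta> n + 3 / sqrt n \<le> real (2 * n) powr (- d)"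
    using eventually_ge_at_top[of n0] eventually_gt_at_top[of "0::nat"]
      eventually_clique_scale[OF \<epsilon> pd(5)] eventually_RIP_scale[OF pd(1-4)]
    unfolding K_def \<eta>_def k p_def[symmetric] by eventually_elim blast
  then obtain n1 where n1: "\<And>n. n1 \<le> n \<Longrightarrow> n0 \<le> n \<and> 0 < n \<and>
      (1 \<le> K n \<and> 2 * K n \<le> k (2 * n) \<and> real (2 * n) powr (- \<epsilon>) / 4 \<le> 24 / 25 * (real (K n) - 2) / real (odd_sqrt n)) \<and>
      \<eta> n + real (k (2 * n)) / n + (\<eta> n * sqrt n + 3)\<^sup>2 / n + 4 / n + 8 / sqrt n + \<eta> n + 3 / sqrt n \<le> real (2 * n) powr (- d)"
    unfolding eventually_sequentially by blast
  \<comment> \<open>The property contains \<open>0 < n\<close>, which fails at 0.\<close>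
  have "1 \<le> n1" using n1[of 0] by (cases n1) auto
  then obtain R where R: "polytime_on graph_inputs R"
    "\<And>n E. n < n1 \<Longrightarrow> outputs R (encode_graph n E) 1"
    "\<And>n E y. n1 \<le> n \<Longrightarrow> outputs P (encode_mat (graph_mat n E (odd_sqrt n))) y \<Longrightarrow> outputs R (encode_graph n E) (1 - y)"
    using graph_reduction[OF P] by blast
  have "outputs_yes R (encode_graph n E)" if E: "E \<in> graphs n" and clique: "has_clique n E (K n)" for n E
  proof (cases "n < n1")
    case False
    then have n: "n1 \<le> n" by simp
    have "real (2 * n) powr (- \<epsilon>) / 4 \<le> 24 / 25 * (real (K n) - 2) / real (odd_sqrt n)" using n1[OF n] by blast
    also have "\<dots> \<le> RIP_param (k (2 * n)) (real_graph_mat n E (odd_sqrt n))"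
      using n1[OF n] by (intro RIP_param_if_clique[OF E clique]) (auto simp: odd_pos odd_odd_sqrt)
    finally have "outputs_no P (encode_mat (graph_mat n E (odd_sqrt n)))"
      using n1[OF n] by (intro no[OF _ graph_mat_carrier]) auto
    then show ?thesis using R(3)[OF n] by fastforce
  qed (rule R(2))
  moreover have "(\<lambda>n. measure_pmf.prob (uniform_graph n) {E. outputs_no R (encode_graph n E)}) \<longlonglongrightarrow> 1"
  proof (rule tendsto_sandwich)
    have "(\<lambda>n. 1 - 4 * real (n * (2 * n ^ 3 + 1)) ^ k (2 * n) * exp (- ((\<eta> n)\<^sup>2 * n / 8))) \<longlonglongrightarrow> 1 - 0"
      unfolding k p_def[symmetric] \<eta>_def by (intro tendsto_intros failure_probability_tendsto_0 pd)
    then show "(\<lambda>n. 1 - 4 * real (n * (2 * n ^ 3 + 1)) ^ k (2 * n) * exp (- ((\<eta> n)\<^sup>2 * n / 8))) \<longlonglongrightarrow> 1" by simp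
    show "\<forall>\<^sub>F n in sequentially. 1 - 4 * real (n * (2 * n ^ 3 + 1)) ^ k (2 * n) * exp (- ((\<eta> n)\<^sup>2 * n / 8)) \<le>
        measure_pmf.prob (uniform_graph n) {E. outputs_no R (encode_graph n E)}"
      using eventually_ge_at_top[of n1]
    proof eventually_elim
      case (elim n)
      note n = n1[OF elim]
      have \<eta>: "0 \<le> \<eta> n" "\<eta> n \<le> 1 / 2"
      proof -
        show "0 \<le> \<eta> n" by (simp add: \<eta>_def)
        have "real (2 * n) powr (- d) \<le> real (2 * n) powr 0"
          using n pd(1) by (intro powr_mono) auto
        then show "\<eta> n \<le> 1 / 2" using n by (simp add: \<eta>_def)
      qed
      have "outputs_no R (encode_graph n E)" if "concentrated n (k (2 * n)) E (\<eta> n)" for E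
      proof -
        have "RIP_param (k (2 * n)) (real_graph_mat n E (odd_sqrt n)) \<le> real (2 * n) powr (- d)"
          using n that \<eta>(1) by (intro RIP_param_least(3) RIP_if_concentrated) auto
        then have "outputs_yes P (encode_mat (graph_mat n E (odd_sqrt n)))"
          using n by (intro yes[OF _ graph_mat_carrier]) (auto simp: d_def)
        then show ?thesis using R(3)[OF elim] by fastforce
      qed
      then have "- {E. \<not> concentrated n (k (2 * n)) E (\<eta> n)} \<subseteq> {E. outputs_no R (encode_graph n E)}"
        by auto
      then have "measure_pmf.prob (uniform_graph n) (- {E. \<not> concentrated n (k (2 * n)) E (\<eta> n)}) \<le>
          measure_pmf.prob (uniform_graph n) {E. outputs_no R (encode_graph n E)}"
        by (intro measure_pmf.finite_measure_mono) auto
      moreover have "measure_pmf.prob (uniform_graph n) (- {E. \<not> concentrated n (k (2 * n)) E (\<eta> n)}) =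
          1 - measure_pmf.prob (uniform_graph n) {E. \<not> concentrated n (k (2 * n)) E (\<eta> n)}"
        using measure_pmf.prob_compl[of "{E. \<not> concentrated n (k (2 * n)) E (\<eta> n)}" "uniform_graph n"]
        by (simp add: Compl_eq_Diff_UNIV)
      ultimately show ?case
        using concentrated_probability[of n "\<eta> n" "k (2 * n)"] n \<eta> by linarith
    qed
  qed auto
  ultimately show False
    using hyp R(1) unfolding hidden_clique_hypothesis_def K_def by blast
qed

theorem theorem5:
  fixes \<epsilon> :: real and k :: "nat \<Rightarrow> nat" and \<delta> :: "nat \<Rightarrow> real"
  assumes "0 < \<epsilon>" and "\<epsilon> < 1/2"
    and k: "\<And>n. k n = nat \<lfloor>real n powr ((1 - 2 * \<epsilon>) * (1 - \<epsilon>))\<rfloor>"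
    and \<delta>: "\<And>n. \<delta> n = real n powr (- 5 * \<epsilon> / 4 + \<epsilon>\<^sup>2 / 2)"
  shows "\<delta> \<in> o(\<lambda>n. real n powr (- \<epsilon>) / 4) \<and>
    (hidden_clique_hypothesis \<epsilon> \<longrightarrow>
      \<not> (\<exists>P. polytime_on mat_inputs P \<and>
           (\<exists>n0. \<forall>n \<ge> n0. \<forall>\<Phi> \<in> carrier_mat n n.
              (RIP_param (k n) (map_mat of_rat \<Phi>) \<le> \<delta> n \<longrightarrow>
                 outputs_yes P (encode_mat \<Phi>)) \<and>
              (RIP_param (k n) (map_mat of_rat \<Phi>) \<ge> real n powr (- \<epsilon>) / 4 \<longrightarrow>
                 outputs_no P (encode_mat \<Phi>)))) \<and>
      (\<forall>\<rho> \<ge> 1. \<not> (\<exists>P. polytime_on mat_inputs P \<and>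
           (\<exists>n0. \<forall>n \<ge> n0. \<forall>\<Phi> \<in> carrier_mat n n. \<exists>q.
              outputs_rat P (encode_mat \<Phi>) q \<and>
              RIP_param (k n) (map_mat of_rat \<Phi>) \<le> real_of_rat q \<and>
              real_of_rat q \<le> \<rho> * RIP_param (k n) (map_mat of_rat \<Phi>)))))"
proof -
  define d where "d = 5 * \<epsilon> / 4 - \<epsilon>\<^sup>2 / 2"
  have gap: "\<epsilon> < d" using approximation_gap(1)[OF assms(1,2)] by (simp add: d_def)
  have \<delta>': "\<delta> n = real n powr (- d)" for n by (simp add: \<delta> d_def)
  have "\<delta> \<in> o(\<lambda>n. real n powr (- \<epsilon>) / 4)"
    unfolding \<delta>'[abs_def] using gap by real_asymp
  moreover have decider: False
    if "hidden_clique_hypothesis \<epsilon>" "polytime_on mat_inputs P"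
      "\<And>n \<Phi>. n0 \<le> n \<Longrightarrow> \<Phi> \<in> carrier_mat n n \<Longrightarrow> RIP_param (k n) (map_mat of_rat \<Phi>) \<le> \<delta> n \<Longrightarrow>
        outputs_yes P (encode_mat \<Phi>)"
      "\<And>n \<Phi>. n0 \<le> n \<Longrightarrow> \<Phi> \<in> carrier_mat n n \<Longrightarrow> real n powr (- \<epsilon>) / 4 \<le> RIP_param (k n) (map_mat of_rat \<Phi>) \<Longrightarrow>
        outputs_no P (encode_mat \<Phi>)" for P n0
    by (rule no_promise_decider[where k = k and ?n0.0 = n0, OF assms(1,2) that(1,2) k])
      (use that(3,4) in \<open>auto simp: \<delta>' d_def\<close>)
  moreover have False
    if hyp: "hidden_clique_hypothesis \<epsilon>" and "1 \<le> \<rho>" and P: "polytime_on mat_inputs P"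
      and approx: "\<And>n \<Phi>. n0 \<le> n \<Longrightarrow> \<Phi> \<in> carrier_mat n n \<Longrightarrow> \<exists>q. outputs_rat P (encode_mat \<Phi>) q \<and>
        RIP_param (k n) (map_mat of_rat \<Phi>) \<le> real_of_rat q \<and>
        real_of_rat q \<le> \<rho> * RIP_param (k n) (map_mat of_rat \<Phi>)" for \<rho> P n0
  proof -
    \<comment> \<open>Any exponent strictly between \<epsilon> and d separates the cases, since the
      constants \<rho> and 1/4 are absorbed by powers of n. A rational one can be tested by integer
      arithmetic.\<close>
    obtain \<theta> where \<theta>: "\<theta> \<in> \<rat>" "\<epsilon> < \<theta>" "\<theta> < d" using Rats_dense_in_real[OF gap] by blast
    then obtain a b :: nat where ab: "b \<noteq> 0" "\<theta> = a / b"
      using Rats_abs_nat_div_natE[of \<theta>] assms(1) by (metis abs_of_pos less_trans)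
    obtain R where R: "polytime_on mat_inputs R"
      "\<And>N \<Phi> q. \<Phi> \<in> carrier_mat N N \<Longrightarrow> outputs_rat P (encode_mat \<Phi>) q \<Longrightarrow>
        outputs R (encode_mat \<Phi>) (if q ^ b * of_nat N ^ a \<le> 1 then 1 else 0)"
      using threshold_reduction[OF P, of b a] by blast
    have threshold: "q ^ b * of_nat N ^ a \<le> 1 \<longleftrightarrow> real_of_rat q \<le> real N powr (- \<theta>)"
      if "0 \<le> q" "0 < N" for q :: rat and N :: nat
    proof -
      have "q ^ b * of_nat N ^ a \<le> 1 \<longleftrightarrow> real_of_rat (q ^ b * of_nat N ^ a) \<le> real_of_rat 1"
        by (simp only: of_rat_less_eq)
      also have "\<dots> \<longleftrightarrow> real_of_rat q ^ b * real N ^ a \<le> 1" by (simp add: of_rat_mult of_rat_power)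
      also have "\<dots> \<longleftrightarrow> real_of_rat q ^ b \<le> (real N powr (- \<theta>)) ^ b"
      proof -
        have "(real N powr (- \<theta>)) ^ b = real N powr (- real a)"
          using ab that by (simp add: powr_realpow[symmetric] powr_powr)
        also have "\<dots> = 1 / real N ^ a" using that by (simp add: powr_minus powr_realpow divide_inverse)
        finally show ?thesis using that by (simp add: pos_le_divide_eq)
      qed
      also have "\<dots> \<longleftrightarrow> real_of_rat q \<le> real N powr (- \<theta>)"
        using that ab(1) by (intro power_mono_iff) auto
      finally show ?thesis .
    qed
    have "\<forall>\<^sub>F n in sequentially. \<rho> * real n powr (- d) \<le> real n powr (- \<theta>)"
      using \<theta> by real_asymp
    moreover have "\<forall>\<^sub>F n in sequentially. real n powr (- \<theta>) < real n powr (- \<epsilon>) / 4"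
      using \<theta> by real_asymp
    ultimately have "\<forall>\<^sub>F n in sequentially. n0 \<le> n \<and> 0 < n \<and> \<rho> * real n powr (- d) \<le> real n powr (- \<theta>) \<and>
        real n powr (- \<theta>) < real n powr (- \<epsilon>) / 4"
      using eventually_ge_at_top[of n0] eventually_gt_at_top[of 0] by eventually_elim blast
    then obtain n1 where n1: "\<And>n. n1 \<le> n \<Longrightarrow> n0 \<le> n \<and> 0 < n \<and> \<rho> * real n powr (- d) \<le> real n powr (- \<theta>) \<and>
        real n powr (- \<theta>) < real n powr (- \<epsilon>) / 4"
      unfolding eventually_sequentially by blast
    show False
    proof (rule decider[OF hyp R(1), of n1])
      fix n and \<Phi> :: "rat Matrix.mat" assume n: "n1 \<le> n" and \<Phi>: "\<Phi> \<in> carrier_mat n n"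
      obtain q where q: "outputs_rat P (encode_mat \<Phi>) q" "RIP_param (k n) (map_mat of_rat \<Phi>) \<le> real_of_rat q"
        "real_of_rat q \<le> \<rho> * RIP_param (k n) (map_mat of_rat \<Phi>)"
        using approx[of n \<Phi>] n1[OF n] \<Phi> by blast
      \<comment> \<open>The answer is at least the RIP parameter, hence nonnegative; only then is
        comparing b-th powers the same as comparing the numbers.\<close>
      have "0 \<le> real_of_rat q" using q(2) RIP_param_least(1) order_trans by blast
      then have q0: "0 \<le> q" by simp
      note out = R(2)[OF \<Phi> q(1)] and thr = threshold[OF q0, of n]
      {
        assume "RIP_param (k n) (map_mat of_rat \<Phi>) \<le> \<delta> n"
        then have "\<rho> * RIP_param (k n) (map_mat of_rat \<Phi>) \<le> \<rho> * real n powr (- d)"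
          using \<open>1 \<le> \<rho>\<close> unfolding \<delta>' by (intro mult_left_mono) auto
        then have "real_of_rat q \<le> real n powr (- \<theta>)" using q(3) n1[OF n] by linarith
        then show "outputs_yes R (encode_mat \<Phi>)" using out thr n1[OF n] by simp
      next
        assume "real n powr (- \<epsilon>) / 4 \<le> RIP_param (k n) (map_mat of_rat \<Phi>)"
        then have "\<not> real_of_rat q \<le> real n powr (- \<theta>)" using q(2) n1[OF n] by linarith
        then show "outputs_no R (encode_mat \<Phi>)" using out thr n1[OF n] by simp
      }
    qed
  qed
  ultimately show ?thesis by blast
qed

end
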